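(* Let $k\in\mathbb{N}$, $k\ge1$. The Berezin transform $A\mapsto\widetilde A$ is injective on the set $\{T_{f,(k)}:f\in L^\infty(\mathbb{C})\}$. The Toeplitz quantization $f\mapsto T_{f,(k)}$ is injective on $\{\widetilde A:A\in\mathcal{L}(F^2_{(k)})\}$.
   Context: Let $\mathrm{d}\mu(z)=\frac1\pi e^{-|z|^2}\,\mathrm{d}z$ on $\mathbb{C}\cong\mathbb{R}^2$. For $n\ge1$, $F_n^2$ is the closed subspace of $L^2(\mathbb{C},\mu)$ of smooth functions $f$ with $\partial^n f/\partial\overline z^n=0$; $F^2_{(1)}:=F^2_1$ and $F^2_{(k)}:=F^2_k\ominus F^2_{k-1}$ for $k\ge2$; $P_{(k)}$ is the orthogonal projection of $L^2(\mathbb{C},\mu)$ onto $F^2_{(k)}$. $\mathcal{L}(H)$ denotes the bounded operators on $H$. For $f\in L^\infty(\mathbb{C})$, the Toeplitz operator on $F^2_{(k)}$ is $T_{f,(k)}g=P_{(k)}(fg)$. $L^0_m(x)=\sum_{j=0}^m(-1)^j\binom{m}{m-j}\frac{x^j}{j!}$. The normalized reproducing kernels of $F^2_{(k)}$ are $k_{z,(k)}(w)=L^0_{k-1}(|w-z|^2)e^{w\overline z-|z|^2/2}$, and the Berezin transform of $A\in\mathcal{L}(F^2_{(k)})$ is the bounded function $\widetilde A(z)=\langle Ak_{z,(k)},k_{z,(k)}\rangle$, $z\in\mathbb{C}$. *)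

theory Defs
  imports "HOL-Analysis.Analysis"
begin

definition gauss :: "complex measure" where
  "gauss = density lborel (\<lambda>z. ennreal (exp (- (cmod z)\<^sup>2) / pi))"

definition L2 :: "(complex \<Rightarrow> complex) set" where
  "L2 = {f \<in> borel_measurable lborel. integrable gauss (\<lambda>z. (cmod (f z))\<^sup>2)}"

definition Linf :: "(complex \<Rightarrow> complex) set" where
  "Linf = {f \<in> borel_measurable lborel. \<exists>C. AE z in lborel. cmod (f z) \<le> C}"

definition ip :: "(complex \<Rightarrow> complex) \<Rightarrow> (complex \<Rightarrow> complex) \<Rightarrow> complex" where
  "ip f g = (LINT z|gauss. f z * cnj (g z))"

definition nrm :: "(complex \<Rightarrow> complex) \<Rightarrow> real" where
  "nrm f = sqrt (LINT z|gauss. (cmod (f z))\<^sup>2)"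

text \<open>Real partial derivatives of functions on \<open>\<complex> = \<real>\<^sup>2\<close>; note that
  \<^const>\<open>frechet_derivative\<close> and \<^const>\<open>differentiable\<close> are with respect to the real
  structure of \<^typ>\<open>complex\<close>.\<close>

definition d_x :: "(complex \<Rightarrow> complex) \<Rightarrow> complex \<Rightarrow> complex" where
  "d_x f z = frechet_derivative f (at z) 1"

definition d_y :: "(complex \<Rightarrow> complex) \<Rightarrow> complex \<Rightarrow> complex" where
  "d_y f z = frechet_derivative f (at z) \<i>"

fun C_diff :: "nat \<Rightarrow> (complex \<Rightarrow> complex) \<Rightarrow> bool" where
  "C_diff 0 f \<longleftrightarrow> continuous_on UNIV f"
| "C_diff (Suc n) f \<longleftrightarrow> (\<forall>z. f differentiable (at z)) \<and> C_diff n (d_x f) \<and> C_diff n (d_y f)"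

definition smooth :: "(complex \<Rightarrow> complex) \<Rightarrow> bool" where
  "smooth f \<longleftrightarrow> (\<forall>n. C_diff n f)"

definition d_zbar :: "(complex \<Rightarrow> complex) \<Rightarrow> complex \<Rightarrow> complex" where
  "d_zbar f z = (d_x f z + \<i> * d_y f z) / 2"

text \<open>Elements of \<open>L\<^sup>2\<close> and \<open>L\<^sup>\<infinity>\<close> are represented by functions rather than by classes modulo
  null sets. A class in a Fock space has exactly one smooth representative, so on \<open>fock n\<close> and
  \<open>true_fock k\<close> below, equality of functions is equality in \<open>L\<^sup>2\<close>.\<close>

definition fock :: "nat \<Rightarrow> (complex \<Rightarrow> complex) set" where
  "fock n = {f \<in> L2. smooth f \<and> (\<forall>z. (d_zbar ^^ n) f z = 0)}"

definition true_fock :: "nat \<Rightarrow> (complex \<Rightarrow> complex) set" where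
  "true_fock k = (if k = 1 then fock 1 else {f \<in> fock k. \<forall>g\<in>fock (k - 1). ip f g = 0})"

definition proj :: "nat \<Rightarrow> (complex \<Rightarrow> complex) \<Rightarrow> complex \<Rightarrow> complex" where
  "proj k u = (THE h. h \<in> true_fock k \<and> (\<forall>v\<in>true_fock k. ip (\<lambda>z. u z - h z) v = 0))"

text \<open>Operators on a space \<open>H\<close> of functions are extensional (\<^const>\<open>undefined\<close> off \<open>H\<close>), so that
  equality of operators is equality on \<open>H\<close>.\<close>

definition bounded_ops ::
  "(complex \<Rightarrow> complex) set \<Rightarrow> ((complex \<Rightarrow> complex) \<Rightarrow> complex \<Rightarrow> complex) set" where
  "bounded_ops H = {A \<in> H \<rightarrow>\<^sub>E H.
     (\<forall>f\<in>H. \<forall>g\<in>H. A (\<lambda>z. f z + g z) = (\<lambda>z. A f z + A g z)) \<and>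
     (\<forall>c. \<forall>f\<in>H. A (\<lambda>z. c * f z) = (\<lambda>z. c * A f z)) \<and>
     (\<exists>C. \<forall>f\<in>H. nrm (A f) \<le> C * nrm f)}"

definition toeplitz ::
  "nat \<Rightarrow> (complex \<Rightarrow> complex) \<Rightarrow> (complex \<Rightarrow> complex) \<Rightarrow> complex \<Rightarrow> complex" where
  "toeplitz k f = (\<lambda>g\<in>true_fock k. proj k (\<lambda>z. f z * g z))"

definition laguerre :: "nat \<Rightarrow> real \<Rightarrow> real" where
  "laguerre m x = (\<Sum>j=0..m. (-1) ^ j * real (m choose (m - j)) * (x ^ j / fact j))"

definition nkernel :: "nat \<Rightarrow> complex \<Rightarrow> complex \<Rightarrow> complex" where
  "nkernel k z w = of_real (laguerre (k - 1) ((cmod (w - z))\<^sup>2)) *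
     exp (w * cnj z - of_real ((cmod z)\<^sup>2 / 2))"

definition berezin ::
  "nat \<Rightarrow> ((complex \<Rightarrow> complex) \<Rightarrow> complex \<Rightarrow> complex) \<Rightarrow> complex \<Rightarrow> complex" where
  "berezin k A z = ip (A (nkernel k z)) (nkernel k z)"

end

theory Submission
  imports Defs "HOL-Complex_Analysis.Complex_Analysis" "HOL-Computational_Algebra.Fundamental_Theorem_Algebra"
begin

text \<open>
  Let \<open>m = k - 1\<close> and let \<open>B\<close> be a bounded sesquilinear form on the true Fock space. Expanding
  \<open>B\<close> on the Weyl translates of \<open>cnj w ^ m\<close> into Taylor series over circles shows that the
  function \<open>c \<mapsto> B (W\<^sub>c (cnj w ^ m)) (W\<^sub>c (cnj w ^ m))\<close> determines \<open>B\<close>, and that the Berezin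
  transform of \<open>B\<close> arises from it by applying \<open>L\<^sub>m (- \<Delta>/4)\<close> in the weak sense of integrals
  against radial Gaussian weights. For Toeplitz operators that function is itself the average of
  the symbol against the weight \<open>\<bar>w\<bar> ^ (2 * m) * exp (- \<bar>w\<bar>\<^sup>2)\<close>, which equals
  \<open>L\<^sub>m (- \<Delta>/4)\<close> of the Gaussian up to a constant. Both claims therefore reduce to cancelling one
  of two factors \<open>L\<^sub>m (- \<Delta>/4)\<close> acting on a bounded function.

  All zeros of \<open>L\<^sub>m\<close> are positive, so a single factor \<open>\<Delta>/4 + l\<close> with \<open>l > 0\<close> has to be cancelled.
  By Pizzetti's formula the circular means of a function annihilated by \<open>(\<Delta>/4 + l)\<^sup>2\<close> solve a
  Bessel equation with a resonant right-hand side, whose solutions are unbounded unless the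
  right-hand side vanishes. What remains is that a bounded continuous function with vanishing
  Gaussian averages is zero.
\<close>

section \<open>Averages over circles\<close>

text \<open>For \<open>m > 0\<close> a single factor L_m(-\<Delta>/4) is not injective on bounded
  functions: it kills every plane wave of frequency \<xi> with L_m(|\<xi>|^2/4) = 0, and such a wave
  is a nonzero symbol of the zero Toeplitz operator. What holds is that, on bounded functions, the
  square of the factor annihilates no more than the factor does. Each claim restricts one map to the
  range of the other, and this restriction supplies the second factor.

  Symbols are only measurable, so they are never differentiated: a function is represented by its
  integrals against exp(-|w|^2) P(|w|^2), and \<Delta>/4 acts on the polynomial P as
  \<open>lap\<close>. Circle means of these integrals are entire functions of the squared radius, so
  equations between distributions become equations between Taylor coefficients. The Laguerre
  polynomial arises the same way: the factor exp(r^2) between \<open>psi\<close> and the Weyl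
  translates turns the coefficients of a circle mean into the coefficients binom(m,n)/n! of
  L_m(-x).\<close>

definition circ :: "real measure" where
  "circ = density lborel (\<lambda>t. ennreal (indicator {0..1} t))"

lemma space_circ [simp]: "space circ = UNIV" by (simp add: circ_def)
lemma sets_circ [simp, measurable_cong]: "sets circ = sets borel" by (simp add: circ_def)

lemma emeasure_circ: "emeasure circ UNIV = 1"
  by (simp add: circ_def emeasure_density ennreal_indicator)

lemma measure_circ [simp]: "measure circ UNIV = 1"
  by (simp add: measure_def emeasure_circ)

interpretation circ: finite_measure circ
  by (rule finite_measureI) (simp add: emeasure_circ)

lemma integrable_circ:
  fixes f :: "real \<Rightarrow> 'b::{banach, second_countable_topology}"
  assumes "f \<in> borel_measurable borel" "\<And>t. norm (f t) \<le> C"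
  shows "integrable circ f"
  by (rule circ.integrable_const_bound[where B = C]) (use assms in auto)

lemma integrable_circ_continuous:
  fixes f :: "real \<Rightarrow> complex"
  assumes c: "continuous_on UNIV f"
  shows "integrable circ f"
proof -
  have m: "f \<in> borel_measurable borel" by (rule borel_measurable_continuous_onI[OF c])
  have "integrable lborel (\<lambda>t. indicator {0..1} t *\<^sub>R f t)"
    using borel_integrable_compact[of "{0..1::real}" f] continuous_on_subset[OF c]
    by (simp add: indicator_scaleR_eq_if)
  then show ?thesis unfolding circ_def by (subst integrable_density) (use m in auto)
qed

definition ucis :: "real \<Rightarrow> complex" where "ucis t = cis (2 * pi * t)"

lemma norm_ucis [simp]: "cmod (ucis t) = 1" by (simp add: ucis_def)
lemma ucis_measurable [measurable]: "ucis \<in> borel_measurable borel"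
  unfolding ucis_def[abs_def] by (intro borel_measurable_continuous_onI continuous_intros)
lemma continuous_ucis [continuous_intros]: "continuous_on A ucis"
  unfolding ucis_def[abs_def] by (intro continuous_intros)

lemma circ_integral_cis:
  fixes n :: int
  assumes "n \<noteq> 0"
  shows "(\<integral>t. cis (2 * pi * n * t) \<partial>circ) = 0"
proof -
  have c: "continuous_on S (\<lambda>t. cis (2 * pi * n * t))" for S by (intro continuous_intros)
  have "(\<integral>t. cis (2 * pi * n * t) \<partial>circ) = (LINT t:{0..1}|lborel. cis (2 * pi * n * t))"
    unfolding circ_def set_lebesgue_integral_def
    by (subst integral_density) (auto intro!: borel_measurable_continuous_onI c)
  also have "\<dots> = integral {0..1} (\<lambda>t. cis (2 * pi * n * t))"
    by (intro set_borel_integral_eq_integral borel_integrable_atLeastAtMost' c)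
  also have "\<dots> = 0"
  proof (rule integral_unique)
    let ?F = "\<lambda>t. cis (2 * pi * n * t) / (\<i> * complex_of_real (2 * pi * n))"
    have "((\<lambda>t. cis (2 * pi * n * t)) has_integral ?F 1 - ?F 0) {0..1}"
    proof (rule fundamental_theorem_of_calculus)
      fix x :: real
      have e: "cis (2 * pi * n * t) = exp (\<i> * complex_of_real (2 * pi * n) * complex_of_real t)" for t
        by (simp add: cis_conv_exp algebra_simps)
      have "((\<lambda>z. exp (\<i> * complex_of_real (2 * pi * n) * z) / (\<i> * complex_of_real (2 * pi * n))) has_field_derivative
          exp (\<i> * complex_of_real (2 * pi * n) * complex_of_real x)) (at (complex_of_real x))"
        using assms by (auto intro!: derivative_eq_intros)
      then have "((\<lambda>t. exp (\<i> * complex_of_real (2 * pi * n) * complex_of_real t) / (\<i> * complex_of_real (2 * pi * n))) has_vector_derivative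
          exp (\<i> * complex_of_real (2 * pi * n) * complex_of_real x)) (at x)"
        by (rule has_vector_derivative_real_field)
      then show "(?F has_vector_derivative cis (2 * pi * n * x)) (at x within {0..1})"
        unfolding e by (rule has_vector_derivative_at_within)
    qed simp
    moreover have "cis (2 * pi * real_of_int n) = 1"
      by (metis cis_multiple_2pi Ints_of_int)
    ultimately show "((\<lambda>t. cis (2 * pi * n * t)) has_integral 0) {0..1}" by simp
  qed
  finally show ?thesis .
qed

lemma circ_integral_ucis: "(\<integral>t. ucis t ^ i * cnj (ucis t) ^ j \<partial>circ) = (if i = j then 1 else 0)"
proof -
  have e: "ucis t ^ i * cnj (ucis t) ^ j = cis (2 * pi * of_int (int i - int j) * t)" for t
    by (simp add: ucis_def cis_cnj Complex.DeMoivre cis_mult algebra_simps)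
  show ?thesis
  proof (cases "i = j")
    case True
    then show ?thesis unfolding e by (simp)
  next
    case False
    then show ?thesis unfolding e using circ_integral_cis[of "int i - int j"] by simp
  qed
qed

text \<open>After integration term by term, orthogonality of the characters keeps only the index
  \<open>n = i - l\<close>, or nothing if \<open>i < l\<close>. The corollaries on entire functions
  read off these cases.\<close>

lemma circ_integral_power_series:
  assumes h: "\<And>z. (\<lambda>n. a n * z ^ n) sums h z"
  shows "(\<lambda>n. if n + l = i then a n * w ^ n else 0) sums (\<integral>t. ucis t ^ l * cnj (ucis t) ^ i * h (ucis t * w) \<partial>circ)"
proof -
  define f where "f n t = ucis t ^ l * cnj (ucis t) ^ i * (a n * (ucis t * w) ^ n)" for n t
  have nf: "norm (f n t) = norm (a n * w ^ n)" for n t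
    by (simp add: f_def norm_mult norm_power)
  have s: "summable (\<lambda>n. norm (a n * w ^ n))"
  proof -
    \<comment> \<open>Convergence at the larger radius \<open>cmod w + 1\<close> gives absolute
      convergence on the circle through \<open>w\<close>.\<close>
    have "summable (\<lambda>n. a n * (of_real (cmod w + 1)) ^ n)" using h sums_summable by blast
    then show ?thesis by (rule powser_insidea) simp
  qed
  have "(\<lambda>n. \<integral>t. f n t \<partial>circ) sums (\<integral>t. (\<Sum>n. f n t) \<partial>circ)"
  proof (rule sums_integral)
    show "integrable circ (f n)" for n
      unfolding f_def by (intro integrable_circ_continuous continuous_intros)
    show "AE t in circ. summable (\<lambda>n. norm (f n t))" using s by (simp add: nf)
    show "summable (\<lambda>n. \<integral>t. norm (f n t) \<partial>circ)" using s by (simp add: nf)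
  qed
  moreover have "(\<integral>t. f n t \<partial>circ) = (if n + l = i then a n * w ^ n else 0)" for n
  proof -
    have "f n t = a n * w ^ n * (ucis t ^ (n + l) * cnj (ucis t) ^ i)" for t
      by (simp add: f_def power_add power_mult_distrib)
    then show ?thesis by (simp add: circ_integral_ucis)
  qed
  moreover have "(\<Sum>n. f n t) = ucis t ^ l * cnj (ucis t) ^ i * h (ucis t * w)" for t
    unfolding f_def using sums_unique[OF sums_mult[OF h]] by metis
  ultimately show ?thesis by simp
qed

lemma entire_power_series:
  assumes "h holomorphic_on UNIV"
  shows "(\<lambda>n. (deriv ^^ n) h 0 / fact n * z ^ n) sums h z"
  using holomorphic_power_series[of h 0 "norm z + 1" z] assms holomorphic_on_subset by fastforce

lemma circ_integral_entire_0:
  assumes "h holomorphic_on UNIV" "i < l"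
  shows "(\<integral>t. ucis t ^ l * cnj (ucis t) ^ i * h (ucis t * w) \<partial>circ) = 0"
proof -
  have "(\<lambda>n. 0 :: complex) sums (\<integral>t. ucis t ^ l * cnj (ucis t) ^ i * h (ucis t * w) \<partial>circ)"
    using circ_integral_power_series[OF entire_power_series[OF assms(1)], of l i w] assms(2) by simp
  then show ?thesis using sums_unique2 sums_zero by blast
qed

lemma circ_integral_entire:
  assumes "h holomorphic_on UNIV"
  shows "(\<integral>t. cnj (ucis t) ^ i * h (ucis t * w) \<partial>circ) = (deriv ^^ i) h 0 / fact i * w ^ i"
proof -
  have "(\<lambda>n. if n = i then (deriv ^^ n) h 0 / fact n * w ^ n else 0) sums (\<integral>t. cnj (ucis t) ^ i * h (ucis t * w) \<partial>circ)"
    using circ_integral_power_series[OF entire_power_series[OF assms(1)], of 0 i w] by simp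
  moreover have "(\<lambda>n. if n = i then (deriv ^^ n) h 0 / fact n * w ^ n else 0) sums ((deriv ^^ i) h 0 / fact i * w ^ i)"
    by (rule sums_single)
  ultimately show ?thesis using sums_unique2 by blast
qed

section \<open>A resonance lemma for the Bessel equation\<close>

text \<open>The bounded \<open>V\<close> solves a Bessel equation driven by its own homogeneous solution \<open>J\<close>. The
  Wronskian of \<open>V\<close> and \<open>J\<close> is \<open>W0\<close> times the integral \<open>G\<close> of \<open>J\<^sup>2\<close>; boundedness of \<open>V\<close> makes
  it \<open>O (sqrt G)\<close>, so \<open>G\<close> is bounded, whereas an energy estimate shows that \<open>G\<close> grows at least
  logarithmically.\<close>

lemma bessel_resonance:
  fixes V V1 J J1 :: "real \<Rightarrow> real" and W0 lm C C' :: real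
  assumes lam: "lm > 0"
    and dV: "\<And>s. (V has_real_derivative V1 s) (at s)"
    and dV1: "\<And>s. ((\<lambda>s. s * V1 s) has_real_derivative (W0 * J s - lm * V s)) (at s)"
    and dJ: "\<And>s. (J has_real_derivative J1 s) (at s)"
    and dJ1: "\<And>s. ((\<lambda>s. s * J1 s) has_real_derivative (- lm * J s)) (at s)"
    and J0: "J 0 = 1"
    and bV: "\<And>s. s \<ge> 0 \<Longrightarrow> \<bar>V s\<bar> \<le> C"
    and bD: "\<And>s. s \<ge> 0 \<Longrightarrow> \<bar>W0 * J s - lm * V s\<bar> \<le> C'"
  shows "W0 = 0"
proof (rule ccontr)
  assume W0: "W0 \<noteq> 0"
  have C: "C \<ge> 0" using bV[of 0] by simp
  have C': "C' \<ge> 0" using bD[of 0] by simp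
  \<comment> \<open>A closed form of the primitive of \<open>J\<^sup>2\<close> that vanishes at 0:
    in its derivative the cross terms \<open>J * J1\<close> cancel by the equation for
    \<open>J\<close>. For \<open>s \<ge> 0\<close> both summands are nonnegative, so
    \<open>G\<close> controls \<open>s * (J s)\<^sup>2\<close> and
    \<open>(s * J1 s)\<^sup>2\<close>.\<close>
  define G where "G s = ((s * J1 s)\<^sup>2 + lm * s * (J s)\<^sup>2) / lm" for s
  define A where "A s = s * J1 s" for s
  define B where "B s = s * V1 s" for s
  have dA: "(A has_real_derivative (- lm * J s)) (at s)" for s
    using dJ1 unfolding A_def[abs_def] .
  have dB: "(B has_real_derivative (W0 * J s - lm * V s)) (at s)" for s
    using dV1 unfolding B_def[abs_def] .
  have dG: "(G has_real_derivative (J s)\<^sup>2) (at s)" for s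
  proof -
    have "((\<lambda>s. ((A s)\<^sup>2 + lm * s * (J s)\<^sup>2) / lm) has_real_derivative
       (2 * A s * (- lm * J s) + (lm * (J s)\<^sup>2 + lm * s * (2 * J s * J1 s))) / lm) (at s)"
      by (rule derivative_eq_intros dJ dA refl | use lam in simp)+
    also have "(2 * A s * (- lm * J s) + (lm * (J s)\<^sup>2 + lm * s * (2 * J s * J1 s))) / lm = (J s)\<^sup>2"
      using lam by (simp add: field_simps A_def)
    finally show ?thesis unfolding G_def[abs_def] A_def .
  qed
  have G0: "G 0 = 0" by (simp add: G_def)
  have Gmono: "G a \<le> G b" if "a \<le> b" for a b
    by (rule DERIV_nonneg_imp_nondecreasing[OF that]) (use dG in \<open>auto intro!: exI\<close>)
  have Gpos: "G s \<ge> 0" if "s \<ge> 0" for s using Gmono[OF that] G0 by simp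
  have sJ: "s * (J s)\<^sup>2 \<le> G s" for s
  proof -
    have "(s * J1 s)\<^sup>2 / lm \<ge> 0" using lam by simp
    then show ?thesis unfolding G_def using lam by (simp add: add_divide_distrib)
  qed
  have sJ1: "(s * J1 s)\<^sup>2 \<le> lm * G s" if "s \<ge> 0" for s
    unfolding G_def using lam that by simp
  define Q where "Q s = s * V1 s * J s - V s * (s * J1 s) - W0 * G s" for s
  have dQ: "(Q has_real_derivative 0) (at s)" for s
  proof -
    have "((\<lambda>s. B s * J s - V s * A s - W0 * G s) has_real_derivative
       ((W0 * J s - lm * V s) * J s + s * V1 s * J1 s - (V1 s * (s * J1 s) + V s * (- lm * J s)) - W0 * (J s)\<^sup>2)) (at s)"
      by (rule derivative_eq_intros dJ dA dV dB dG refl | simp add: A_def B_def)+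
    also have "((W0 * J s - lm * V s) * J s + s * V1 s * J1 s - (V1 s * (s * J1 s) + V s * (- lm * J s)) - W0 * (J s)\<^sup>2) = 0"
      by (simp add: algebra_simps power2_eq_square)
    finally show ?thesis unfolding Q_def[abs_def] A_def B_def .
  qed
  have "Q s = Q 0" for s
    using DERIV_isconst_all[of Q] dQ by blast
  then have Q: "W0 * G s = s * V1 s * J s - V s * (s * J1 s)" for s
    by (simp add: Q_def G0)
  have V1: "sqrt s * \<bar>V1 s\<bar> \<le> 4 * C + C'" if s: "s \<ge> 1" for s
  proof -
    \<comment> \<open>The mean value theorem over a step of length \<open>sqrt s\<close> finds a
      point \<xi> with \<open>sqrt s * \<bar>V1 \<xi>\<bar> \<le> 2 * C\<close>. The bounded
      derivative of \<open>s * V1 s\<close> carries this back to \<open>s\<close> at a cost of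
      \<open>sqrt s * C'\<close>, and \<open>\<xi> \<le> 2 * s\<close> because
      \<open>s \<ge> 1\<close>.\<close>
    define r where "r = sqrt s"
    have r: "r \<ge> 1" "s = r * r" using s by (auto simp: r_def)
    have "\<exists>z. s < z \<and> z < s + r \<and> V (s + r) - V s = (s + r - s) * V1 z"
      by (rule MVT2) (use r dV in auto)
    then obtain \<xi> where x: "s < \<xi>" "\<xi> < s + r" "V (s + r) - V s = r * V1 \<xi>" by auto
    have "\<exists>z. s < z \<and> z < \<xi> \<and> \<xi> * V1 \<xi> - s * V1 s = (\<xi> - s) * (W0 * J z - lm * V z)"
      by (rule MVT2[where f = "\<lambda>s. s * V1 s"]) (use x dV1 in auto)
    then obtain z where z: "s < z" "z < \<xi>" "\<xi> * V1 \<xi> - s * V1 s = (\<xi> - s) * (W0 * J z - lm * V z)" by auto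
    have a: "r * \<bar>V1 \<xi>\<bar> \<le> 2 * C"
    proof -
      have "r * \<bar>V1 \<xi>\<bar> = \<bar>V (s + r) - V s\<bar>" using x r by (simp add: abs_mult)
      also have "\<dots> \<le> 2 * C" using bV[of "s+r"] bV[of s] s r by linarith
      finally show ?thesis .
    qed
    have "\<bar>\<xi> * V1 \<xi> - s * V1 s\<bar> \<le> r * C'"
      unfolding z(3) abs_mult
      by (rule mult_mono) (use x(1,2) r(1) bD[of z] z(1,2) s in \<open>simp_all\<close>)
    then have "\<bar>s * V1 s\<bar> \<le> \<bar>\<xi> * V1 \<xi>\<bar> + r * C'" by linarith
    then have "s * \<bar>V1 s\<bar> \<le> \<xi> * \<bar>V1 \<xi>\<bar> + r * C'"
      using s x(1) by (simp add: abs_mult)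
    also have "\<xi> * \<bar>V1 \<xi>\<bar> \<le> (2 * r * r) * \<bar>V1 \<xi>\<bar>"
    proof (rule mult_right_mono)
      have "r \<le> r * r" using r by simp
      then show "\<xi> \<le> 2 * r * r" using x(2) r(2) by linarith
    qed simp
    also have "\<dots> = 2 * r * (r * \<bar>V1 \<xi>\<bar>)" by simp
    also have "\<dots> \<le> 2 * r * (2 * C)" using a r by (intro mult_left_mono) auto
    finally have "r * (r * \<bar>V1 s\<bar>) \<le> r * (4 * C + C')" using r by (simp add: algebra_simps)
    then show ?thesis using r by (simp add: r_def[symmetric])
  qed
  define K where "K = 4 * C + C' + C * sqrt lm"
  have bnd: "\<bar>W0\<bar> * sqrt (G s) \<le> K" if s: "s \<ge> 1" for s
  proof (cases "G s = 0")
    case True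
    then show ?thesis using C C' lam by (simp add: K_def)
  next
    case False
    then have gp: "G s > 0" using Gpos[of s] s by simp
    have e1: "sqrt s * \<bar>J s\<bar> \<le> sqrt (G s)"
      using sJ[of s] s by (intro real_le_rsqrt) (simp add: power_mult_distrib)
    have e2: "\<bar>s * J1 s\<bar> \<le> sqrt lm * sqrt (G s)"
      unfolding real_sqrt_mult[symmetric] using sJ1[of s] s by (intro real_le_rsqrt) simp
    have "\<bar>W0\<bar> * G s = \<bar>s * V1 s * J s - V s * (s * J1 s)\<bar>"
      using Q[of s] gp by (metis abs_mult abs_of_pos)
    also have "\<dots> \<le> \<bar>s * V1 s * J s\<bar> + \<bar>V s * (s * J1 s)\<bar>" by (rule abs_triangle_ineq4)
    also have "\<bar>s * V1 s * J s\<bar> = (sqrt s * \<bar>V1 s\<bar>) * (sqrt s * \<bar>J s\<bar>)"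
    proof -
      have "s = sqrt s * sqrt s" using s by simp
      then show ?thesis using s by (simp add: abs_mult)
    qed
    also have "\<dots> \<le> (4 * C + C') * sqrt (G s)"
      using V1[OF s] e1 C C' s by (intro mult_mono) auto
    also have "\<bar>V s * (s * J1 s)\<bar> \<le> C * (sqrt lm * sqrt (G s))"
      unfolding abs_mult[of "V s"] using bV[of s] e2 s C by (intro mult_mono) auto
    finally have "\<bar>W0\<bar> * G s \<le> K * sqrt (G s)" by (simp add: K_def algebra_simps)
    moreover have "G s = sqrt (G s) * sqrt (G s)" using gp by simp
    ultimately have "(\<bar>W0\<bar> * sqrt (G s)) * sqrt (G s) \<le> K * sqrt (G s)" by (metis mult.assoc)
    then show ?thesis using gp by simp
  qed
  define M where "M = (K / \<bar>W0\<bar>)\<^sup>2"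
  have GM: "G s \<le> M" if "s \<ge> 1" for s
  proof -
    have "sqrt (G s) \<le> K / \<bar>W0\<bar>" using bnd[OF that] W0 by (simp add: field_simps)
    then have "(sqrt (G s))\<^sup>2 \<le> M" unfolding M_def using that Gpos[of s] by (intro power_mono) auto
    then show ?thesis using that Gpos[of s] by simp
  qed
  \<comment> \<open>Otherwise \<open>J\<close> vanishes between 0 and 1, against continuity and
    \<open>J 0 = 1\<close>.\<close>
  have c: "G 1 > 0"
  proof (rule ccontr)
    assume "\<not> G 1 > 0"
    then have Jz: "J s = 0" if "0 < s" "s \<le> 1" for s
    proof -
      have "s * (J s)\<^sup>2 \<le> 0" using Gmono[of s 1] sJ[of s] that \<open>\<not> G 1 > 0\<close> by linarith
      then show ?thesis using that by (simp add: mult_le_0_iff)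
    qed
    have "(J \<longlongrightarrow> J 0) (at_right 0)"
      using DERIV_isCont[OF dJ, of 0] by (simp add: isCont_def filterlim_at_split)
    moreover have "\<forall>\<^sub>F s in at_right 0. J s = 0"
      by (rule eventually_at_rightI[of 0 1]) (auto intro: Jz)
    ultimately have "((\<lambda>_::real. 0) \<longlongrightarrow> J 0) (at_right (0::real))"
      by (rule Lim_transform_eventually)
    then show False using J0 by (simp add: tendsto_const_iff)
  qed
  \<comment> \<open>The energy is arranged to have derivative \<open>lm * G s / s\<close>, which is
    at least \<open>lm * G 1 / s\<close> from \<open>s = 1\<close> on. It therefore grows like a
    logarithm, whereas a bounded \<open>G\<close> keeps it bounded.\<close>
  define E where "E s = 2 * lm * G s + J s * (s * J1 s)" for s
  have dE: "(E has_real_derivative lm * G s / s) (at s)" if "s > 0" for s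
  proof -
    have "((\<lambda>s. 2 * lm * G s + J s * A s) has_real_derivative
       (2 * lm * (J s)\<^sup>2 + (J1 s * (s * J1 s) + J s * (- lm * J s)))) (at s)"
      by (rule derivative_eq_intros dJ dA dG refl | simp add: A_def)+
    also have "2 * lm * (J s)\<^sup>2 + (J1 s * (s * J1 s) + J s * (- lm * J s)) = lm * G s / s"
      unfolding G_def using lam that by (simp add: field_simps power2_eq_square)
    finally show ?thesis unfolding E_def[abs_def] A_def .
  qed
  have Eln: "E s - E 1 \<ge> lm * G 1 * ln s" if "s \<ge> 1" for s
  proof -
    have "(\<lambda>s. E s - lm * G 1 * ln s) 1 \<le> (\<lambda>s. E s - lm * G 1 * ln s) s"
    proof (rule DERIV_nonneg_imp_nondecreasing[OF that])
      fix x :: real assume x: "1 \<le> x" "x \<le> s"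
      have "((\<lambda>s. E s - lm * G 1 * ln s) has_real_derivative (lm * G x / x - lm * G 1 * (1 / x))) (at x)"
        by (intro DERIV_diff DERIV_cmult dE DERIV_ln_divide) (use x in simp_all)
      moreover have "lm * G x / x - lm * G 1 * (1 / x) = lm * (G x - G 1) / x"
        by (simp add: diff_divide_distrib right_diff_distrib)
      moreover have "lm * (G x - G 1) / x \<ge> 0" using Gmono[OF x(1)] lam x by simp
      ultimately show "\<exists>y. ((\<lambda>s. E s - lm * G 1 * ln s) has_real_derivative y) (at x) \<and> 0 \<le> y" by auto
    qed
    then show ?thesis by simp
  qed
  have Ebd: "E s \<le> (2 * lm + sqrt lm) * M" if s: "s \<ge> 1" for s
  proof -
    have "1 * (J s)\<^sup>2 \<le> s * (J s)\<^sup>2" using s by (intro mult_right_mono) auto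
    then have "(J s)\<^sup>2 \<le> G s" using sJ[of s] by linarith
    then have "\<bar>J s\<bar> \<le> sqrt (G s)" by (intro real_le_rsqrt) simp
    moreover have "\<bar>s * J1 s\<bar> \<le> sqrt lm * sqrt (G s)"
      unfolding real_sqrt_mult[symmetric] using sJ1[of s] s by (intro real_le_rsqrt) simp
    ultimately have "\<bar>J s * (s * J1 s)\<bar> \<le> sqrt (G s) * (sqrt lm * sqrt (G s))"
      unfolding abs_mult[of "J s"] by (intro mult_mono) (use Gpos[of s] s in auto)
    also have "\<dots> = sqrt lm * G s" using Gpos[of s] s by simp
    finally have "E s \<le> (2 * lm + sqrt lm) * G s" unfolding E_def by (simp add: algebra_simps)
    also have "\<dots> \<le> (2 * lm + sqrt lm) * M" using GM[OF s] lam by (intro mult_left_mono) auto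
    finally show ?thesis .
  qed
  have "lm * G 1 * ln s \<le> (2 * lm + sqrt lm) * M - E 1" if "s \<ge> 1" for s
    using Eln[OF that] Ebd[OF that] by linarith
  note A1 = this
  \<comment> \<open>At \<open>s = exp y\<close> the logarithmic lower bound exceeds the upper bound
    by at least \<open>lm * G 1\<close>; the maximum with 0 ensures
    \<open>exp y \<ge> 1\<close>.\<close>
  define y where "y = max 0 (((2 * lm + sqrt lm) * M - E 1) / (lm * G 1) + 1)"
  have "lm * G 1 * ln (exp y) \<le> (2 * lm + sqrt lm) * M - E 1" by (rule A1) (simp add: y_def)
  then have "lm * G 1 * y \<le> (2 * lm + sqrt lm) * M - E 1" by simp
  moreover have "lm * G 1 * (((2 * lm + sqrt lm) * M - E 1) / (lm * G 1) + 1) \<le> lm * G 1 * y"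
    using c lam by (intro mult_left_mono) (auto simp: y_def)
  ultimately have "lm * G 1 * (((2 * lm + sqrt lm) * M - E 1) / (lm * G 1) + 1) \<le> (2 * lm + sqrt lm) * M - E 1"
    by simp
  moreover have "D * (X / D + 1) = X + D" if "D \<noteq> 0" for D X :: real using that by (simp add: distrib_left)
  then have "lm * G 1 * (((2 * lm + sqrt lm) * M - E 1) / (lm * G 1) + 1) = (2 * lm + sqrt lm) * M - E 1 + lm * G 1"
    using c lam by (metis less_irrefl mult_eq_0_iff)
  ultimately have "lm * G 1 \<le> 0" by linarith
  then show False using c lam by (simp add: mult_le_0_iff)
qed

text \<open>On power series the Bessel operator V |-> (s V')' replaces the coefficient
  \<open>v n\<close> by \<open>(n + 1)\<^sup>2 * v (n + 1)\<close>. So \<open>ww\<close> makes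
  \<open>w\<close> a multiple of the homogeneous solution, and \<open>w\<close> is at the same time
  the right-hand side of the equation for \<open>v\<close>.\<close>

lemma bessel_resonance_series:
  fixes v w :: "nat \<Rightarrow> real" and lm :: real
  assumes lam: "lm > 0"
    and sv: "\<And>R. summable (\<lambda>n. v n * R ^ n)"
    and w: "\<And>n. w n = (real (Suc n))\<^sup>2 * v (Suc n) + lm * v n"
    and ww: "\<And>n. (real (Suc n))\<^sup>2 * w (Suc n) + lm * w n = 0"
    and bV: "\<And>s. s \<ge> 0 \<Longrightarrow> \<bar>\<Sum>n. v n * s ^ n\<bar> \<le> C"
    and bD: "\<And>s. s \<ge> 0 \<Longrightarrow> \<bar>\<Sum>n. (real (Suc n))\<^sup>2 * v (Suc n) * s ^ n\<bar> \<le> C'"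
  shows "w n = 0"
proof -
  \<comment> \<open>Taylor coefficients of J_0(2 sqrt(lm s)), the solution that is regular at
    0.\<close>
  define j where "j n = (- lm) ^ n / (fact n)\<^sup>2" for n
  have j_rec: "(real (Suc n))\<^sup>2 * j (Suc n) = - lm * j n" for n
    by (simp add: j_def power2_eq_square field_simps del: of_nat_Suc)
  have wj: "w n = w 0 * j n" for n
  proof (induction n)
    case (Suc n)
    have "(real (Suc n))\<^sup>2 * w (Suc n) = - lm * w n" using ww[of n] by simp
    also have "\<dots> = w 0 * ((real (Suc n))\<^sup>2 * j (Suc n))" unfolding j_rec Suc.IH by simp
    finally have "(real (Suc n))\<^sup>2 * w (Suc n) = (real (Suc n))\<^sup>2 * (w 0 * j (Suc n))" by simp
    then show ?case by simp
  qed (simp add: j_def)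
  have sj: "summable (\<lambda>n. j n * R ^ n)" for R
  proof (rule summable_comparison_test'[OF summable_exp[of "lm * \<bar>R\<bar>"]])
    fix n
    have "norm (j n * R ^ n) = (lm * \<bar>R\<bar>) ^ n / (fact n)\<^sup>2"
      using lam by (simp add: j_def norm_mult norm_divide norm_power power_mult_distrib power_abs abs_mult)
    also have "\<dots> \<le> (lm * \<bar>R\<bar>) ^ n / fact n"
      using lam by (intro divide_left_mono) (auto simp: power2_eq_square)
    finally show "norm (j n * R ^ n) \<le> inverse (fact n) * (lm * \<bar>R\<bar>) ^ n" by (simp add: divide_inverse mult.commute)
  qed
  have D: "((\<lambda>x. \<Sum>n. c n * x ^ n) has_real_derivative (\<Sum>n. diffs c n * s ^ n)) (at s)"
    if "\<And>R. summable (\<lambda>n. c n * R ^ n)" for c :: "nat \<Rightarrow> real" and s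
    by (rule termdiffs_strong_converges_everywhere[OF that])
  have D2: "((\<lambda>s. s * (\<Sum>n. diffs c n * s ^ n)) has_real_derivative (\<Sum>n. (real (Suc n))\<^sup>2 * c (Suc n) * s ^ n)) (at s)"
    if c: "\<And>R. summable (\<lambda>n. c n * R ^ n)" for c :: "nat \<Rightarrow> real" and s
  proof -
    have sd: "summable (\<lambda>n. diffs c n * R ^ n)" for R by (rule termdiff_converges_all[OF c])
    have eq: "s * (\<Sum>n. diffs c n * s ^ n) = (\<Sum>n. (real n * c n) * s ^ n)" for s
    proof -
      have "(\<lambda>n. (real (Suc n) * c (Suc n)) * s ^ Suc n) sums (s * (\<Sum>n. diffs c n * s ^ n))"
        using sums_mult[OF summable_sums[OF sd[of s]], of s] by (simp add: diffs_def mult_ac)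
      then have "(\<lambda>n. (real n * c n) * s ^ n) sums (s * (\<Sum>n. diffs c n * s ^ n) + (real 0 * c 0) * s ^ 0)"
        by (subst (asm) sums_Suc_iff[of "\<lambda>n. (real n * c n) * s ^ n"]) simp
      then show ?thesis using sums_unique by fastforce
    qed
    have s1: "summable (\<lambda>n. (real n * c n) * R ^ n)" for R
    proof -
      have "summable (\<lambda>n. (real (Suc n) * c (Suc n)) * R ^ Suc n)"
        using summable_mult[OF sd[of R], of R] by (simp add: diffs_def mult_ac)
      then show ?thesis by (subst (asm) summable_Suc_iff[of "\<lambda>n. (real n * c n) * R ^ n"])
    qed
    have "diffs (\<lambda>n. real n * c n) n = (real (Suc n))\<^sup>2 * c (Suc n)" for n
      by (simp add: diffs_def power2_eq_square del: of_nat_Suc)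
    then show ?thesis unfolding eq using D[OF s1, of s] by simp
  qed
  have e0: "(real (Suc n))\<^sup>2 * v (Suc n) = w 0 * j n - lm * v n" for n
    using w[of n] wj[of n] by linarith
  have sv2: "summable (\<lambda>n. (real (Suc n))\<^sup>2 * v (Suc n) * s ^ n)" for s
  proof -
    have "(real (Suc n))\<^sup>2 * v (Suc n) * s ^ n = w 0 * (j n * s ^ n) - lm * (v n * s ^ n)" for n
      unfolding e0 by (simp add: left_diff_distrib mult.assoc)
    then show ?thesis by (simp only:) (intro summable_diff summable_mult sj sv)
  qed
  have e1: "(\<Sum>n. (real (Suc n))\<^sup>2 * v (Suc n) * s ^ n) = w 0 * (\<Sum>n. j n * s ^ n) - lm * (\<Sum>n. v n * s ^ n)" for s
  proof -
    have "(real (Suc n))\<^sup>2 * v (Suc n) * s ^ n = w 0 * (j n * s ^ n) - lm * (v n * s ^ n)" for n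
      unfolding e0 by (simp add: left_diff_distrib mult.assoc)
    then have "(\<Sum>n. (real (Suc n))\<^sup>2 * v (Suc n) * s ^ n) = (\<Sum>n. w 0 * (j n * s ^ n) - lm * (v n * s ^ n))" by (simp only:)
    also have "\<dots> = w 0 * (\<Sum>n. j n * s ^ n) - lm * (\<Sum>n. v n * s ^ n)"
      by (subst suminf_diff[symmetric]) (simp_all add: suminf_mult sj sv summable_mult)
    finally show ?thesis .
  qed
  have e2: "(\<Sum>n. (real (Suc n))\<^sup>2 * j (Suc n) * s ^ n) = - lm * (\<Sum>n. j n * s ^ n)" for s
    unfolding j_rec by (simp only: mult.assoc suminf_mult[OF sj])
  have "w 0 = 0"
  proof (rule bessel_resonance[OF lam, where V = "\<lambda>s. \<Sum>n. v n * s ^ n" and J = "\<lambda>s. \<Sum>n. j n * s ^ n"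
      and C = C and C' = C'])
    show "((\<lambda>s. s * (\<Sum>n. diffs v n * s ^ n)) has_real_derivative
         w 0 * (\<Sum>n. j n * s ^ n) - lm * (\<Sum>n. v n * s ^ n)) (at s)" for s
      using D2[OF sv, of s] unfolding e1 .
    show "((\<lambda>s. s * (\<Sum>n. diffs j n * s ^ n)) has_real_derivative - lm * (\<Sum>n. j n * s ^ n)) (at s)" for s
      using D2[OF sj, of s] unfolding e2 .
    show "(\<Sum>n. j n * 0 ^ n) = 1" by (subst powser_zero) (simp add: j_def)
    show "\<bar>w 0 * (\<Sum>n. j n * s ^ n) - lm * (\<Sum>n. v n * s ^ n)\<bar> \<le> C'" if "s \<ge> 0" for s
      using bD[OF that] unfolding e1 .
    show "((\<lambda>s. \<Sum>n. v n * s ^ n) has_real_derivative (\<Sum>n. diffs v n * s ^ n)) (at s)" for s by (rule D[OF sv])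
    show "((\<lambda>s. \<Sum>n. j n * s ^ n) has_real_derivative (\<Sum>n. diffs j n * s ^ n)) (at s)" for s by (rule D[OF sj])
    show "\<bar>\<Sum>n. v n * s ^ n\<bar> \<le> C" if "s \<ge> 0" for s by (rule bV[OF that])
  qed
  then show ?thesis using wj[of n] by simp
qed

section \<open>The Gaussian measure\<close>

lemma nn_integral_exp_minus_abs:
  fixes c :: real
  assumes c: "c > 0"
  shows "(\<integral>\<^sup>+x. ennreal (exp (- c * \<bar>x\<bar>)) \<partial>lborel) < \<infinity>"
proof -
  have h: "(\<integral>\<^sup>+x. ennreal (exp (- c * x)) * indicator {0..} x \<partial>lborel) = ennreal (0 - (- exp (- c * 0) / c))"
  proof (rule nn_integral_FTC_atLeast)
    fix x :: real
    show "((\<lambda>x. - exp (- c * x) / c) has_real_derivative exp (- c * x)) (at x)"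
      using c by (auto intro!: derivative_eq_intros)
    have "((\<lambda>x. exp (- c * x)) \<longlongrightarrow> 0) at_top"
      using c by real_asymp
    then have "((\<lambda>x. - exp (- c * x) / c) \<longlongrightarrow> - 0 / c) at_top"
      using c by (intro tendsto_intros) auto
    then show "((\<lambda>x. - exp (- c * x) / c) \<longlongrightarrow> 0) at_top" by simp
  qed auto
  have "(\<integral>\<^sup>+x. ennreal (exp (- c * \<bar>x\<bar>)) \<partial>lborel) \<le>
      (\<integral>\<^sup>+x. ennreal (exp (- c * x)) * indicator {0..} x + ennreal (exp (- c * (0 + (-1) * x))) * indicator {0..} (0 + (-1) * x) \<partial>lborel)"
    by (intro nn_integral_mono) (auto split: split_indicator)
  also have "\<dots> = (\<integral>\<^sup>+x. ennreal (exp (- c * x)) * indicator {0..} x \<partial>lborel) + (\<integral>\<^sup>+x. ennreal (exp (- c * (0 + (-1) * x))) * indicator {0..} (0 + (-1) * x) \<partial>lborel)"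
    by (intro nn_integral_add) auto
  also have "(\<integral>\<^sup>+x. ennreal (exp (- c * (0 + (-1) * x))) * indicator {0..} (0 + (-1) * x) \<partial>lborel) = (\<integral>\<^sup>+x. ennreal (exp (- c * x)) * indicator {0..} x \<partial>lborel)"
    by (subst (2) nn_integral_real_affine[where c = "-1" and t = 0]) auto
  finally show ?thesis unfolding h by (auto simp: less_top[symmetric] top_unique)
qed

text \<open>The Gaussian is a product over the two real coordinates, and completing the square in
  \<open>c * (\<bar>x\<bar> - 1/2)\<^sup>2 \<ge> 0\<close> bounds each factor by a multiple of
  \<open>exp (- c * \<bar>x\<bar>)\<close>.\<close>

lemma integrable_gaussian_complex:
  assumes c: "c > 0"
  shows "integrable lborel (\<lambda>z::complex. exp (- c * (cmod z)\<^sup>2))"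
proof (rule integrableI_nonneg)
  have r: "(\<integral>\<^sup>+(x::real). ennreal (exp (- c * x\<^sup>2)) \<partial>lborel) < \<infinity>"
  proof -
    have "(\<integral>\<^sup>+(x::real). ennreal (exp (- c * x\<^sup>2)) \<partial>lborel) \<le> (\<integral>\<^sup>+x. ennreal (exp (c / 4)) * ennreal (exp (- c * \<bar>x\<bar>)) \<partial>lborel)"
    proof (intro nn_integral_mono)
      fix x :: real
      have "0 \<le> c * (\<bar>x\<bar> - 1/2)\<^sup>2" using c by simp
      then have "- c * x\<^sup>2 \<le> c / 4 + - c * \<bar>x\<bar>" by (simp add: power2_eq_square algebra_simps)
      then have "exp (- c * x\<^sup>2) \<le> exp (c / 4 + - c * \<bar>x\<bar>)" by (simp only: exp_le_cancel_iff)
      then show "ennreal (exp (- c * x\<^sup>2)) \<le> ennreal (exp (c / 4)) * ennreal (exp (- c * \<bar>x\<bar>))"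
        unfolding exp_add by (simp add: ennreal_mult[symmetric])
    qed
    also have "\<dots> = ennreal (exp (c / 4)) * (\<integral>\<^sup>+x. ennreal (exp (- c * \<bar>x\<bar>)) \<partial>lborel)"
      by (rule nn_integral_cmult) auto
    also have "\<dots> < \<infinity>" using nn_integral_exp_minus_abs[OF c] by (simp add: ennreal_mult_less_top)
    finally show ?thesis .
  qed
  have "(\<integral>\<^sup>+(z::complex). ennreal (exp (- c * (cmod z)\<^sup>2)) \<partial>lborel) =
      (\<integral>\<^sup>+(z::complex). ennreal (\<Prod>b\<in>Basis. exp (- c * (z \<bullet> b)\<^sup>2)) \<partial>lborel)"
    by (intro nn_integral_cong) (auto simp: Basis_complex_def cmod_power2 inner_complex_def exp_add[symmetric] algebra_simps)
  also have "\<dots> = (\<integral>\<^sup>+(z::complex). (\<Prod>b\<in>Basis. ennreal (exp (- c * (z \<bullet> b)\<^sup>2))) \<partial>lborel)"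
    by (simp add: prod_ennreal)
  also have "\<dots> = (\<Prod>b\<in>(Basis::complex set). (\<integral>\<^sup>+x. ennreal (exp (- c * x\<^sup>2)) \<partial>lborel))"
    by (rule nn_integral_lborel_prod) auto
  also have "\<dots> < \<infinity>" using r by (auto simp: Basis_complex_def ennreal_mult_less_top)
  finally show "(\<integral>\<^sup>+(z::complex). ennreal (exp (- c * (cmod z)\<^sup>2)) \<partial>lborel) < \<infinity>" .
qed auto

section \<open>Translations and rotations of Lebesgue measure on the plane\<close>

lemma lborel_shift_distr: "distr lborel borel (\<lambda>w. w + a) = (lborel :: complex measure)"
proof -
  have "(\<lambda>w. w + a) = (+) a" by auto
  then show ?thesis by (simp add: lborel_distr_plus)
qed

lemma nn_integral_lborel_shift:
  assumes "f \<in> borel_measurable borel"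
  shows "(\<integral>\<^sup>+w. f (w + a) \<partial>lborel) = (\<integral>\<^sup>+(w::complex). f w \<partial>lborel)"
  by (subst (2) lborel_shift_distr[of a, symmetric]) (use assms in \<open>simp add: nn_integral_distr\<close>)

lemma integral_lborel_shift:
  fixes f :: "complex \<Rightarrow> 'b::{banach, second_countable_topology}"
  assumes "f \<in> borel_measurable borel"
  shows "(\<integral>w. f (w + a) \<partial>lborel) = (\<integral>w. f w \<partial>lborel)"
  by (subst (2) lborel_shift_distr[of a, symmetric]) (use assms in \<open>simp add: integral_distr\<close>)

lemma integrable_lborel_shift:
  fixes f :: "complex \<Rightarrow> 'b::{banach, second_countable_topology}"
  assumes "f \<in> borel_measurable borel"
  shows "integrable lborel (\<lambda>w. f (w + a)) \<longleftrightarrow> integrable lborel f"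
  by (subst (2) lborel_shift_distr[of a, symmetric]) (use assms in \<open>simp add: integrable_distr_eq\<close>)

text \<open>Averaging against a ball, which rotations preserve, compares the two sides.\<close>

lemma nn_integral_lborel_rotate:
  fixes u :: complex
  assumes f[measurable]: "f \<in> borel_measurable borel" and u: "cmod u = 1"
  shows "(\<integral>\<^sup>+w. f (u * w) \<partial>lborel) = (\<integral>\<^sup>+w. f w \<partial>lborel)"
proof -
  have u0: "u \<noteq> 0" using u by auto
  define g :: "complex \<Rightarrow> ennreal" where "g = indicator (ball 0 1)"
  have g[measurable]: "g \<in> borel_measurable borel" unfolding g_def by (intro borel_measurable_indicator) auto
  define I where "I = (\<integral>\<^sup>+y. g y \<partial>lborel)"
  have I: "I = emeasure lborel (ball (0::complex) 1)" by (simp add: I_def g_def)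
  have "Gamma (2::real) \<noteq> 0" using Gamma_real_pos[of "2::real"] by linarith
  then have I0: "I \<noteq> 0" "I \<noteq> \<infinity>" unfolding I using emeasure_lborel_ball_finite[of "0::complex" 1]
    by (auto simp: emeasure_ball unit_ball_vol_def)
  have "(\<integral>\<^sup>+x. f (u * x) \<partial>lborel) * I = (\<integral>\<^sup>+y. (\<integral>\<^sup>+x. f (u * x) * g y \<partial>lborel) \<partial>lborel)"
    by (simp add: I_def nn_integral_multc nn_integral_cmult)
  \<comment> \<open>Shifting \<open>x\<close> by \<open>y / u\<close> turns \<open>u * x\<close>
    into \<open>u * x + y\<close>. After exchanging the integrals and shifting \<open>y\<close>
    back, \<open>u\<close> occurs only in the indicator of the ball, which a rotation does not
    change.\<close>
  also have "\<dots> = (\<integral>\<^sup>+y. (\<integral>\<^sup>+x. f (u * (x + y / u)) * g y \<partial>lborel) \<partial>lborel)"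
    by (intro nn_integral_cong nn_integral_lborel_shift[symmetric, where f = "\<lambda>x. f (u * x) * g y" for y]) measurable
  also have "\<dots> = (\<integral>\<^sup>+y. (\<integral>\<^sup>+x. f (y + u * x) * g y \<partial>lborel) \<partial>lborel)"
    using u0 by (simp add: distrib_left add.commute)
  also have "\<dots> = (\<integral>\<^sup>+x. (\<integral>\<^sup>+y. f (y + u * x) * g y \<partial>lborel) \<partial>lborel)"
    by (rule lborel_pair.Fubini') measurable
  also have "\<dots> = (\<integral>\<^sup>+x. (\<integral>\<^sup>+y. f y * g (y - u * x) \<partial>lborel) \<partial>lborel)"
  proof (rule nn_integral_cong)
    fix x
    show "(\<integral>\<^sup>+y. f (y + u * x) * g y \<partial>lborel) = (\<integral>\<^sup>+y. f y * g (y - u * x) \<partial>lborel)"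
      using nn_integral_lborel_shift[where f = "\<lambda>y. f y * g (y - u * x)" and a = "u * x"] by simp
  qed
  also have "\<dots> = (\<integral>\<^sup>+y. (\<integral>\<^sup>+x. f y * g (y - u * x) \<partial>lborel) \<partial>lborel)"
    by (rule lborel_pair.Fubini'[symmetric]) measurable
  also have "\<dots> = (\<integral>\<^sup>+y. f y * (\<integral>\<^sup>+x. g (x + - y / u) \<partial>lborel) \<partial>lborel)"
  proof (rule nn_integral_cong)
    fix y
    have "g (y - u * x) = g (x + - y / u)" for x
    proof -
      have "cmod (y - u * x) = cmod (- u * (x + - y / u))" using u0 by (simp add: algebra_simps)
      also have "\<dots> = cmod (x + - y / u)" using u by (simp only: norm_mult norm_minus_cancel)
      finally show ?thesis by (simp add: g_def indicator_def)
    qed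
    then show "(\<integral>\<^sup>+x. f y * g (y - u * x) \<partial>lborel) = f y * (\<integral>\<^sup>+x. g (x + - y / u) \<partial>lborel)"
      by (simp add: nn_integral_cmult)
  qed
  also have "\<dots> = (\<integral>\<^sup>+y. f y * I \<partial>lborel)"
    unfolding I_def nn_integral_lborel_shift[OF g] ..
  also have "\<dots> = (\<integral>\<^sup>+y. f y \<partial>lborel) * I" by (simp add: nn_integral_multc)
  finally show ?thesis using I0 by (metis ennreal_mult_divide_eq infinity_ennreal_def)
qed

section \<open>The measure \<open>gauss\<close> and its rotation invariance\<close>

lemma space_gauss [simp]: "space gauss = UNIV" by (simp add: gauss_def)
lemma sets_gauss [simp, measurable_cong]: "sets gauss = sets borel" by (simp add: gauss_def)

lemma integrable_gauss_iff:
  fixes f :: "complex \<Rightarrow> 'b::{banach, second_countable_topology}"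
  assumes "f \<in> borel_measurable borel"
  shows "integrable gauss f \<longleftrightarrow> integrable lborel (\<lambda>z. (exp (- (cmod z)\<^sup>2) / pi) *\<^sub>R f z)"
  unfolding gauss_def by (rule integrable_density) (use assms in auto)

lemma integral_gauss:
  fixes f :: "complex \<Rightarrow> 'b::{banach, second_countable_topology}"
  assumes "f \<in> borel_measurable borel"
  shows "integral\<^sup>L gauss f = (\<integral>z. (exp (- (cmod z)\<^sup>2) / pi) *\<^sub>R f z \<partial>lborel)"
  unfolding gauss_def by (rule integral_density) (use assms in auto)

lemma nn_integral_gauss:
  assumes "f \<in> borel_measurable borel"
  shows "integral\<^sup>N gauss f = (\<integral>\<^sup>+z. ennreal (exp (- (cmod z)\<^sup>2) / pi) * f z \<partial>lborel)"
  unfolding gauss_def by (rule nn_integral_density) (use assms in auto)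

lemma AE_gauss_iff: "(AE z in gauss. P z) \<longleftrightarrow> (AE z in lborel. P z)"
  unfolding gauss_def by (subst AE_density) auto

lemma gauss_rotate_distr:
  assumes u: "cmod u = 1"
  shows "distr gauss borel (\<lambda>w. u * w) = gauss"
proof (rule measure_eqI)
  fix A :: "complex set" assume "A \<in> sets (distr gauss borel (\<lambda>w. u * w))"
  then have A[measurable]: "A \<in> sets borel" by simp
  have "emeasure (distr gauss borel (\<lambda>w. u * w)) A = (\<integral>\<^sup>+w. indicator A w \<partial>distr gauss borel (\<lambda>w. u * w))"
    by simp
  also have "\<dots> = (\<integral>\<^sup>+w. indicator A (u * w) \<partial>gauss)" by (rule nn_integral_distr) auto
  also have "\<dots> = (\<integral>\<^sup>+w. ennreal (exp (- (cmod (u * w))\<^sup>2) / pi) * indicator A (u * w) \<partial>lborel)"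
    by (subst nn_integral_gauss) (use u in \<open>auto simp: norm_mult\<close>)
  also have "\<dots> = (\<integral>\<^sup>+w. ennreal (exp (- (cmod w)\<^sup>2) / pi) * indicator A w \<partial>lborel)"
    by (rule nn_integral_lborel_rotate) (use u in auto)
  also have "\<dots> = (\<integral>\<^sup>+w. indicator A w \<partial>gauss)" by (subst nn_integral_gauss) auto
  finally show "emeasure (distr gauss borel (\<lambda>w. u * w)) A = emeasure gauss A" by simp
qed simp

lemma integral_gauss_rotate:
  fixes f :: "complex \<Rightarrow> 'b::{banach, second_countable_topology}"
  assumes "f \<in> borel_measurable borel" "cmod u = 1"
  shows "(\<integral>w. f (u * w) \<partial>gauss) = (\<integral>w. f w \<partial>gauss)"
  by (subst (2) gauss_rotate_distr[OF assms(2), symmetric]) (use assms in \<open>simp add: integral_distr\<close>)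

lemma integrable_gauss_rotate:
  fixes f :: "complex \<Rightarrow> 'b::{banach, second_countable_topology}"
  assumes "f \<in> borel_measurable borel" "cmod u = 1"
  shows "integrable gauss (\<lambda>w. f (u * w)) \<longleftrightarrow> integrable gauss f"
  by (subst (2) gauss_rotate_distr[OF assms(2), symmetric]) (use assms in \<open>simp add: integrable_distr_eq\<close>)

lemma integrable_gauss_bound:
  fixes f :: "complex \<Rightarrow> 'b::{banach, second_countable_topology}"
  assumes [measurable]: "f \<in> borel_measurable borel" and a: "a < 1"
    and b: "\<And>z. norm (f z) \<le> A * exp (a * (cmod z)\<^sup>2)"
  shows "integrable gauss f"
proof -
  have "integrable lborel (\<lambda>z. (exp (- (cmod z)\<^sup>2) / pi) *\<^sub>R f z)"
  proof (rule Bochner_Integration.integrable_bound)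
    show "integrable lborel (\<lambda>z::complex. (A / pi) * exp (- (1 - a) * (cmod z)\<^sup>2))"
      using a by (intro integrable_mult_right integrable_gaussian_complex) auto
    show "AE z in lborel. norm ((exp (- (cmod z)\<^sup>2) / pi) *\<^sub>R f z) \<le> norm ((A / pi) * exp (- (1 - a) * (cmod z)\<^sup>2))"
    proof (rule AE_I2)
      fix z :: complex
      have "norm ((exp (- (cmod z)\<^sup>2) / pi) *\<^sub>R f z) = exp (- (cmod z)\<^sup>2) / pi * norm (f z)" by simp
      also have "\<dots> \<le> exp (- (cmod z)\<^sup>2) / pi * (A * exp (a * (cmod z)\<^sup>2))"
        using b by (intro mult_left_mono) auto
      also have "\<dots> = (A / pi) * exp (- (1 - a) * (cmod z)\<^sup>2)"
        by (simp add: exp_add[symmetric] exp_diff exp_minus field_simps)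
      finally show "norm ((exp (- (cmod z)\<^sup>2) / pi) *\<^sub>R f z) \<le> norm ((A / pi) * exp (- (1 - a) * (cmod z)\<^sup>2))"
        by (smt (verit) real_norm_def)
    qed
  qed measurable
  then show ?thesis by (simp add: integrable_gauss_iff)
qed

lemma finite_measure_gauss: "finite_measure gauss"
proof (rule finite_measureI)
  have "integrable gauss (\<lambda>_. 1::real)"
    by (rule integrable_gauss_bound[where a = 0 and A = 1]) auto
  then show "emeasure gauss (space gauss) \<noteq> \<infinity>"
    by (simp add: integrable_iff_bounded)
qed

interpretation gauss: finite_measure gauss by (rule finite_measure_gauss)

section \<open>Pizzetti's formula\<close>

text \<open>If \<open>g w = exp (- \<bar>w\<bar>\<^sup>2) * poly P (\<bar>w\<bar>\<^sup>2)\<close>, then a quarter of the Laplacian of \<open>g\<close> is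
  \<open>exp (- \<bar>w\<bar>\<^sup>2) * poly (lap P) (\<bar>w\<bar>\<^sup>2)\<close>.\<close>

definition lap :: "complex poly \<Rightarrow> complex poly" where
  "lap P = pCons 0 (pderiv (pderiv P)) + [:1, -2:] * pderiv P + [:-1, 1:] * P"

text \<open>The Taylor series at 0 of the radial profile \<open>kr P\<close> in the variable x =
  |w|^2. On formal series the Laplacian becomes a rule for coefficients.\<close>

definition kfps :: "complex poly \<Rightarrow> complex fps" where
  "kfps P = fps_of_poly P * fps_exp (-1)"

definition kr :: "complex poly \<Rightarrow> complex \<Rightarrow> complex" where
  "kr P x = poly P x * exp (- x)"

lemma fps_conv_radius_kfps: "fps_conv_radius (kfps P) = \<infinity>"
  using fps_conv_radius_mult[of "fps_of_poly P" "fps_exp (-1)"] by (simp add: kfps_def)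

lemma kfps_sums: "(\<lambda>k. kfps P $ k * x ^ k) sums kr P x"
proof -
  have "eval_fps (kfps P) x = kr P x"
    unfolding kfps_def kr_def by (subst eval_fps_mult) auto
  then show ?thesis using sums_eval_fps[of x "kfps P"] by (simp add: fps_conv_radius_kfps)
qed

lemma kfps_summable: "summable (\<lambda>k. norm (kfps P $ k) * R ^ k)" if "R \<ge> 0"
  using norm_summable_fps[of "of_real R" "kfps P"] that
  by (simp add: fps_conv_radius_kfps norm_mult norm_power)

text \<open>On functions of x = |w|^2 a quarter of the Laplacian is d/dx (x d/dx). The three terms
  of \<open>lap\<close> are what remains of it after dividing out exp(-x).\<close>

lemma kfps_lap: "kfps (lap P) = fps_deriv (fps_X * fps_deriv (kfps P))"
proof -
  let ?E = "fps_exp (-1) :: complex fps"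
  have 1: "fps_of_poly [:1, -2:] = (1 - 2 * fps_X :: complex fps)"
    by (simp add: fps_of_poly_pCons numeral_fps_const algebra_simps fps_const_neg[symmetric] del: fps_const_neg)
  have 2: "fps_of_poly [:-1, 1:] = (fps_X - 1 :: complex fps)"
    by (simp add: fps_of_poly_pCons algebra_simps fps_const_neg[symmetric] del: fps_const_neg)
  have 3: "fps_of_poly (pCons 0 Q) = fps_X * fps_of_poly Q" for Q :: "complex poly"
    by (simp add: fps_of_poly_pCons mult.commute)
  have D: "fps_of_poly (lap P) = fps_X * fps_deriv (fps_deriv (fps_of_poly P)) +
      (1 - 2 * fps_X) * fps_deriv (fps_of_poly P) + (fps_X - 1) * fps_of_poly P"
    by (simp only: lap_def fps_of_poly_add fps_of_poly_mult 1 2 3 fps_of_poly_pderiv)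
  have dE: "fps_deriv ?E = - ?E" by (simp add: fps_const_neg[symmetric] del: fps_const_neg)
  show ?thesis
    unfolding kfps_def D by (simp add: dE algebra_simps del: fps_exp_deriv)
qed

lemma kfps_lap_nth: "kfps (lap P) $ k = (of_nat (k + 1))\<^sup>2 * kfps P $ (k + 1)"
  unfolding kfps_lap by (simp add: power2_eq_square algebra_simps)

lemma kfps_lapn_nth: "kfps ((lap ^^ n) P) $ k = (fact (n + k) / fact k)\<^sup>2 * kfps P $ (n + k)"
proof (induction n arbitrary: k)
  case (Suc n)
  have "kfps ((lap ^^ Suc n) P) $ k = (of_nat (k + 1))\<^sup>2 * ((fact (n + (k + 1)) / fact (k + 1))\<^sup>2 * kfps P $ (n + (k + 1)))"
    by (simp only: funpow.simps o_apply kfps_lap_nth Suc.IH)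
  also have "\<dots> = (fact (Suc n + k) / fact k)\<^sup>2 * kfps P $ (Suc n + k)"
    by (simp add: power_divide power_mult_distrib field_simps del: of_nat_Suc)
  finally show ?case .
qed simp

lemma kr_lapn_sums:
  "(\<lambda>l. (of_nat ((n + l) choose n))\<^sup>2 * kfps P $ (n + l) * x ^ l) sums (kr ((lap ^^ n) P) x / (fact n)\<^sup>2)"
proof -
  have "(of_nat ((n + l) choose n))\<^sup>2 * kfps P $ (n + l) * x ^ l = kfps ((lap ^^ n) P) $ l * x ^ l / (fact n)\<^sup>2" for l
    unfolding kfps_lapn_nth by (simp add: binomial_fact power_divide power_mult_distrib field_simps)
  then show ?thesis using sums_divide[OF kfps_sums[of "(lap ^^ n) P" x], of "(fact n)\<^sup>2"] by simp
qed

text \<open>Parseval on the circle: the binomial expansion of the power is a trigonometric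
  polynomial, whose mean square is the sum of its squared coefficients.\<close>

lemma circ_integral_norm_power:
  "(\<integral>t. (w - of_real r * ucis t) ^ k * cnj (w - of_real r * ucis t) ^ k \<partial>circ) =
   of_real (\<Sum>j\<le>k. real (k choose j) ^ 2 * (cmod w)\<^sup>2 ^ (k - j) * (r\<^sup>2) ^ j)"
proof -
  define A where "A j = of_nat (k choose j) * w ^ (k - j) * (- of_real r) ^ j" for j
  have b: "(w - of_real r * ucis t) ^ k = (\<Sum>j\<le>k. A j * ucis t ^ j)" for t
  proof -
    have "(w - of_real r * ucis t) ^ k = (- of_real r * ucis t + w) ^ k" by simp
    also have "\<dots> = (\<Sum>j\<le>k. A j * ucis t ^ j)"
      unfolding binomial_ring A_def by (intro sum.cong) (simp_all only: power_mult_distrib mult_ac)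
    finally show ?thesis .
  qed
  have "(w - of_real r * ucis t) ^ k * cnj (w - of_real r * ucis t) ^ k =
     (\<Sum>j\<le>k. \<Sum>i\<le>k. A j * cnj (A i) * (ucis t ^ j * cnj (ucis t) ^ i))" for t
    unfolding complex_cnj_power[symmetric] b cnj_sum sum_product by (simp add: mult_ac)
  then have "(\<integral>t. (w - of_real r * ucis t) ^ k * cnj (w - of_real r * ucis t) ^ k \<partial>circ) =
     (\<integral>t. (\<Sum>j\<le>k. \<Sum>i\<le>k. A j * cnj (A i) * (ucis t ^ j * cnj (ucis t) ^ i)) \<partial>circ)" by simp
  also have "\<dots> = (\<Sum>j\<le>k. \<Sum>i\<le>k. A j * cnj (A i) * (\<integral>t. ucis t ^ j * cnj (ucis t) ^ i \<partial>circ))"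
    by (simp add: Bochner_Integration.integral_sum integrable_circ_continuous continuous_intros)
  also have "\<dots> = (\<Sum>j\<le>k. A j * cnj (A j))"
    by (simp add: circ_integral_ucis if_distrib[of "\<lambda>x. _ * x"] cong: if_cong)
  also have "\<dots> = of_real (\<Sum>j\<le>k. real (k choose j) ^ 2 * (cmod w)\<^sup>2 ^ (k - j) * (r\<^sup>2) ^ j)"
  proof -
    have "A j * cnj (A j) = of_real (real (k choose j) ^ 2 * (cmod w)\<^sup>2 ^ (k - j) * (r\<^sup>2) ^ j)" for j
    proof -
      have "A j * cnj (A j) = of_real ((cmod (A j))\<^sup>2)" by (rule complex_norm_square[symmetric])
      also have "(cmod (A j))\<^sup>2 = real (k choose j) ^ 2 * (cmod w)\<^sup>2 ^ (k - j) * (r\<^sup>2) ^ j"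
      proof -
        have "(\<bar>r\<bar> ^ j)\<^sup>2 = (r\<^sup>2) ^ j" by (metis power2_abs power_mult mult.commute)
        moreover have "(cmod w ^ (k - j))\<^sup>2 = (cmod w)\<^sup>2 ^ (k - j)" by (metis power_mult mult.commute)
        ultimately show ?thesis by (simp add: A_def norm_mult norm_power power_mult_distrib)
      qed
      finally show ?thesis .
    qed
    then show ?thesis by simp
  qed
  finally show ?thesis .
qed

text \<open>Absolute convergence along the diagonals permits summation by rows; the bijection (j, l)
  |-> (j + l, j) exchanges the two orders.\<close>

lemma sums_triangle:
  fixes a :: "nat \<Rightarrow> nat \<Rightarrow> complex"
  assumes s: "summable (\<lambda>k. \<Sum>j\<le>k. norm (a j (k - j)))"
  shows "(\<lambda>j. \<Sum>l. a j l) sums (\<Sum>k. \<Sum>j\<le>k. a j (k - j))"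
proof -
  let ?T = "Sigma UNIV (\<lambda>k::nat. {..k})"
  define f where "f = (\<lambda>(k, j). a j (k - j))"
  have "(\<lambda>k. \<Sum>j\<le>k. norm (a j (k - j))) summable_on UNIV"
    using s by (intro norm_summable_imp_summable_on) (simp add: sum_nonneg)
  then have "(\<lambda>x. norm (f x)) summable_on ?T"
    using Infinite_Sum.abs_summable_on_Sigma_iff[of f UNIV "\<lambda>k. {..k}"] by (simp add: f_def sum_nonneg)
  then have fT: "f summable_on ?T" by (rule abs_summable_summable)
  have bij: "bij_betw (\<lambda>(j, l). (j + l, j)) (UNIV \<times> UNIV) ?T"
    by (rule bij_betw_byWitness[where f' = "\<lambda>(k, j). (j, k - j)"]) auto
  define g where "g = (\<lambda>(j, l). a j l)"
  have gf: "g x = f ((\<lambda>(j, l). (j + l, j)) x)" for x by (auto simp: g_def f_def split: prod.split)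
  have gabs: "(\<lambda>x. norm (g x)) summable_on UNIV \<times> UNIV"
    using \<open>(\<lambda>x. norm (f x)) summable_on ?T\<close> summable_on_reindex_bij_betw[OF bij, of "\<lambda>x. norm (f x)"] gf by simp
  then have gT: "g summable_on UNIV \<times> UNIV" by (rule abs_summable_summable)
  have inner: "(\<lambda>l. norm (a j l)) summable_on UNIV" for j
    using Infinite_Sum.abs_summable_on_Sigma_iff[of g UNIV "\<lambda>_. UNIV"] gabs by (auto simp: g_def)
  have in2: "infsum (a j) UNIV = (\<Sum>l. a j l)" for j
    by (rule sums_unique[OF has_sum_imp_sums[OF has_sum_infsum[OF Infinite_Sum.abs_summable_summable[OF inner]]]])
  have "infsum g (UNIV \<times> UNIV) = infsum f ?T"
    using infsum_reindex_bij_betw[OF bij, of f] ext[of g, OF gf] by simp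
  moreover have "infsum f ?T = infsum (\<lambda>k. \<Sum>j\<le>k. a j (k - j)) UNIV"
    using infsum_Sigma'_banach[of "\<lambda>k j. a j (k - j)" UNIV "\<lambda>k. {..k}"] fT by (simp add: f_def)
  moreover have "((\<lambda>k. \<Sum>j\<le>k. a j (k - j)) has_sum infsum (\<lambda>k. \<Sum>j\<le>k. a j (k - j)) UNIV) UNIV"
    using summable_on_Sigma_banach[of "\<lambda>k j. a j (k - j)" UNIV "\<lambda>k. {..k}"] fT
    by (intro has_sum_infsum) (simp add: f_def)
  then have "infsum (\<lambda>k. \<Sum>j\<le>k. a j (k - j)) UNIV = (\<Sum>k. \<Sum>j\<le>k. a j (k - j))"
    by (rule sums_unique[OF has_sum_imp_sums])
  moreover have "infsum g (UNIV \<times> UNIV) = infsum (\<lambda>j. infsum (a j) UNIV) UNIV"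
    using infsum_Sigma'_banach[of a UNIV "\<lambda>_. UNIV"] gT by (simp add: g_def)
  moreover have "((\<lambda>j. infsum (a j) UNIV) has_sum infsum (\<lambda>j. infsum (a j) UNIV) UNIV) UNIV"
    using summable_on_Sigma_banach[of a UNIV "\<lambda>_. UNIV"] gT by (intro has_sum_infsum) (simp add: g_def)
  from has_sum_imp_sums[OF this] have "(\<lambda>j. \<Sum>l. a j l) sums infsum (\<lambda>j. infsum (a j) UNIV) UNIV"
    by (simp only: in2)
  ultimately show ?thesis by simp
qed

text \<open>Expanding the profile in powers of |w - r u|^2 and averaging each power gives a double
  series in |w|^2 and r^2, grouped by total degree. Regrouped by powers of r^2 it produces the
  iterates of \<open>lap\<close>, because the squared binomials are those of
  \<open>kr_lapn_sums\<close>.\<close>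

lemma pizzetti:
  "(\<lambda>n. of_real (r\<^sup>2) ^ n / (fact n)\<^sup>2 * kr ((lap ^^ n) P) (of_real ((cmod w)\<^sup>2)))
     sums (\<integral>t. kr P (of_real ((cmod (w - of_real r * ucis t))\<^sup>2)) \<partial>circ)"
proof -
  define q where "q = fps_nth (kfps P)"
  define x where "x = (cmod w)\<^sup>2"
  define R where "R = (cmod w + \<bar>r\<bar>)\<^sup>2"
  have bd: "(cmod (w - of_real r * ucis t))\<^sup>2 \<le> R" for t
  proof -
    have "cmod (w - of_real r * ucis t) \<le> cmod w + \<bar>r\<bar>"
      using norm_triangle_ineq4[of w "of_real r * ucis t"] by (simp add: norm_mult)
    then show ?thesis unfolding R_def by (intro power_mono) auto
  qed
  define f where "f k t = q k * of_real ((cmod (w - of_real r * ucis t))\<^sup>2) ^ k" for k t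
  have sR: "summable (\<lambda>k. norm (q k) * R ^ k)" unfolding q_def by (rule kfps_summable) (simp add: R_def)
  have nf: "norm (f k t) \<le> norm (q k) * R ^ k" for k t
    unfolding f_def norm_mult norm_power
    using bd[of t] by (intro mult_left_mono power_mono) (auto simp: norm_power)
  have fc: "continuous_on UNIV (f k)" for k
    unfolding f_def by (intro continuous_intros)
  have "(\<lambda>k. \<integral>t. f k t \<partial>circ) sums (\<integral>t. (\<Sum>k. f k t) \<partial>circ)"
  proof (rule sums_integral)
    show "integrable circ (f k)" for k by (rule integrable_circ_continuous[OF fc])
    show "AE t in circ. summable (\<lambda>k. norm (f k t))"
      by (intro AE_I2 summable_comparison_test'[OF sR]) (simp add: nf)
    show "summable (\<lambda>k. \<integral>t. norm (f k t) \<partial>circ)"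
    proof (rule summable_comparison_test'[OF sR])
      fix k
      have "(\<integral>t. norm (f k t) \<partial>circ) \<le> (\<integral>t. norm (q k) * R ^ k \<partial>circ)"
        by (intro integral_mono integrable_norm integrable_circ_continuous fc) (auto simp: nf)
      then show "norm (\<integral>t. norm (f k t) \<partial>circ) \<le> norm (q k) * R ^ k" by simp
    qed
  qed
  moreover have "(\<Sum>k. f k t) = kr P (of_real ((cmod (w - of_real r * ucis t))\<^sup>2))" for t
    using sums_unique[OF kfps_sums] unfolding f_def q_def by metis
  moreover have "(\<integral>t. f k t \<partial>circ) = (\<Sum>j\<le>k. (of_nat ((j + (k - j)) choose j))\<^sup>2 * q (j + (k - j)) * of_real x ^ (k - j) * of_real (r\<^sup>2) ^ j)" for k
  proof -
    have "f k t = q k * ((w - of_real r * ucis t) ^ k * cnj (w - of_real r * ucis t) ^ k)" for t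
      unfolding f_def complex_norm_square[symmetric] power_mult_distrib[symmetric] by simp
    then have "(\<integral>t. f k t \<partial>circ) = q k * of_real (\<Sum>j\<le>k. real (k choose j) ^ 2 * (cmod w)\<^sup>2 ^ (k - j) * (r\<^sup>2) ^ j)"
      by (simp only: integral_mult_right_zero circ_integral_norm_power)
    then show ?thesis by (simp add: sum_distrib_left x_def mult_ac)
  qed
  ultimately have s1: "(\<lambda>k. \<Sum>j\<le>k. (of_nat ((j + (k - j)) choose j))\<^sup>2 * q (j + (k - j)) * of_real x ^ (k - j) * of_real (r\<^sup>2) ^ j)
      sums (\<integral>t. kr P (of_real ((cmod (w - of_real r * ucis t))\<^sup>2)) \<partial>circ)" by simp
  define a where "a j l = (of_nat ((j + l) choose j))\<^sup>2 * q (j + l) * of_real x ^ l * of_real (r\<^sup>2) ^ j" for j l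
  have "(\<lambda>j. \<Sum>l. a j l) sums (\<Sum>k. \<Sum>j\<le>k. a j (k - j))"
  proof (rule sums_triangle, rule summable_comparison_test'[OF sR])
    fix k
    have "norm (\<Sum>j\<le>k. norm (a j (k - j))) = (\<Sum>j\<le>k. norm (a j (k - j)))" by (simp add: sum_nonneg)
    also have "\<dots> = norm (q k) * (\<Sum>j\<le>k. real (k choose j) ^ 2 * ((cmod w) ^ (k - j) * \<bar>r\<bar> ^ j) ^ 2)"
      by (simp add: a_def norm_mult norm_power sum_distrib_left x_def mult_ac power_mult_distrib flip: power_mult)
    \<comment> \<open>A sum of squares of nonnegative terms is at most the square of the sum, and
      the binomial theorem evaluates the latter as \<open>R ^ k\<close>.\<close>
    also have "\<dots> \<le> norm (q k) * (\<Sum>j\<le>k. real (k choose j) * ((cmod w) ^ (k - j) * \<bar>r\<bar> ^ j)) ^ 2"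
    proof (intro mult_left_mono)
      have "(\<Sum>j\<le>k. (g j)\<^sup>2) \<le> (\<Sum>j\<le>k. g j)\<^sup>2" if "\<And>j. g j \<ge> 0" for g :: "nat \<Rightarrow> real"
      proof -
        have "(\<Sum>j\<le>k. (g j)\<^sup>2) \<le> (\<Sum>j\<le>k. g j * (\<Sum>j\<le>k. g j))"
          unfolding power2_eq_square
          by (intro sum_mono mult_left_mono member_le_sum) (use that in auto)
        then show ?thesis by (simp add: power2_eq_square sum_distrib_right)
      qed
      from this[of "\<lambda>j. real (k choose j) * ((cmod w) ^ (k - j) * \<bar>r\<bar> ^ j)"]
      show "(\<Sum>j\<le>k. real (k choose j) ^ 2 * ((cmod w) ^ (k - j) * \<bar>r\<bar> ^ j) ^ 2) \<le> (\<Sum>j\<le>k. real (k choose j) * ((cmod w) ^ (k - j) * \<bar>r\<bar> ^ j)) ^ 2"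
        by (simp add: power_mult_distrib)
    qed simp
    also have "(\<Sum>j\<le>k. real (k choose j) * ((cmod w) ^ (k - j) * \<bar>r\<bar> ^ j)) = (\<bar>r\<bar> + cmod w) ^ k"
      by (simp add: binomial_ring mult_ac)
    also have "norm (q k) * ((\<bar>r\<bar> + cmod w) ^ k)\<^sup>2 = norm (q k) * R ^ k"
      by (simp add: R_def add.commute flip: power_mult) (simp add: mult.commute)
    finally show "norm (\<Sum>j\<le>k. norm (a j (k - j))) \<le> norm (q k) * R ^ k" .
  qed
  moreover have "(\<Sum>k. \<Sum>j\<le>k. a j (k - j)) = (\<integral>t. kr P (of_real ((cmod (w - of_real r * ucis t))\<^sup>2)) \<partial>circ)"
    using sums_unique[OF s1] by (simp add: a_def)
  moreover have "(\<Sum>l. a j l) = of_real (r\<^sup>2) ^ j / (fact j)\<^sup>2 * kr ((lap ^^ j) P) (of_real ((cmod w)\<^sup>2))" for j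
    using sums_unique[OF sums_mult2[OF kr_lapn_sums[of j P "of_real x"], of "of_real (r\<^sup>2) ^ j"]]
    by (simp add: a_def q_def x_def mult_ac)
  ultimately show ?thesis by simp
qed

section \<open>Polynomials in the radial Laplacian\<close>

lemma coeff_lap: "coeff (lap P) n = (of_nat (Suc n))\<^sup>2 * coeff P (Suc n) - of_nat (2 * n + 1) * coeff P n +
    (if n = 0 then 0 else coeff P (n - 1))"
  by (cases n) (simp_all add: lap_def coeff_pderiv power2_eq_square algebra_simps)

lemma lap_add: "lap (P + Q) = lap P + lap Q"
  by (rule poly_eqI) (simp add: coeff_lap algebra_simps)
lemma lap_smult: "lap (smult c P) = smult c (lap P)"
  by (rule poly_eqI) (simp add: coeff_lap algebra_simps)
lemma lap_0 [simp]: "lap 0 = 0" by (simp add: lap_def)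
lemma lapn_add: "(lap ^^ n) (P + Q) = (lap ^^ n) P + (lap ^^ n) Q"
  by (induction n) (auto simp: lap_add)
lemma lapn_smult: "(lap ^^ n) (smult c P) = smult c ((lap ^^ n) P)"
  by (induction n) (auto simp: lap_smult)
lemma lapn_0 [simp]: "(lap ^^ n) 0 = 0" by (induction n) auto
lemma lapn_sum: "(lap ^^ n) (sum f A) = (\<Sum>x\<in>A. (lap ^^ n) (f x))"
  by (induction A rule: infinite_finite_induct) (auto simp: lapn_add)
lemma lapn_lap: "(lap ^^ n) (lap P) = (lap ^^ Suc n) P" by (simp add: funpow_swap1)

lemma lap_monom: "lap (monom 1 j) = smult ((of_nat j)\<^sup>2) (monom 1 (j - 1)) + smult (- of_nat (2 * j + 1)) (monom 1 j) + monom 1 (j + 1)"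
proof (rule poly_eqI)
  fix n
  show "coeff (lap (monom 1 j)) n = coeff (smult ((of_nat j)\<^sup>2) (monom 1 (j - 1)) + smult (- of_nat (2 * j + 1)) (monom 1 j) + monom 1 (j + 1)) n"
    by (cases j; cases n) (auto simp: coeff_lap)
qed

text \<open>This is q(lap) applied to P: a polynomial in \<Delta>/4 acting on a radial Gaussian
  weight.\<close>

definition act :: "complex poly \<Rightarrow> complex poly \<Rightarrow> complex poly" where
  "act q P = (\<Sum>i\<le>degree q. smult (coeff q i) ((lap ^^ i) P))"

lemma act_eq: "degree q \<le> N \<Longrightarrow> act q P = (\<Sum>i\<le>N. smult (coeff q i) ((lap ^^ i) P))"
  unfolding act_def by (rule sum.mono_neutral_left) (auto simp: coeff_eq_0)

lemma act_pCons: "act (pCons c q) P = smult c P + act q (lap P)"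
proof -
  have "act (pCons c q) P = (\<Sum>i\<le>Suc (degree q). smult (coeff (pCons c q) i) ((lap ^^ i) P))"
    by (rule act_eq) (rule degree_pCons_le)
  also have "\<dots> = smult c P + (\<Sum>i\<le>degree q. smult (coeff q i) ((lap ^^ Suc i) P))"
    by (subst sum.atMost_Suc_shift) simp
  also have "(\<Sum>i\<le>degree q. smult (coeff q i) ((lap ^^ Suc i) P)) = act q (lap P)"
    unfolding act_def lapn_lap ..
  finally show ?thesis .
qed

lemma act_0 [simp]: "act 0 P = 0" by (simp add: act_def)
lemma act_1 [simp]: "act 1 P = P" by (simp add: act_def)

lemma act_add: "act (p + q) P = act p P + act q P"
proof -
  define N where "N = max (degree p) (degree q)"
  have "degree (p + q) \<le> N" "degree p \<le> N" "degree q \<le> N" by (auto simp: N_def degree_add_le_max)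
  then show ?thesis by (simp add: act_eq[of _ N] smult_add_left sum.distrib)
qed

lemma smult_sum_right: "smult c (sum f A) = (\<Sum>x\<in>A. smult c (f x))"
  by (induction A rule: infinite_finite_induct) (auto simp: smult_add_right)

lemma act_smult: "act (smult c q) P = smult c (act q P)"
  by (simp add: act_eq[of "smult c q" "degree q"] act_def smult_sum_right degree_smult_le)

lemma act_smult_right: "act q (smult c P) = smult c (act q P)"
  by (simp add: act_def lapn_smult smult_sum_right mult.commute)

lemma act_lap: "act q (lap P) = lap (act q P)"
proof (induction q arbitrary: P rule: pCons_induct)
  case (pCons c q)
  then show ?case by (simp add: act_pCons lap_add lap_smult)
qed simp

text \<open>Products of polynomials become compositions, so the linear factors of a polynomial
  commute as operators and can be cancelled one at a time in any order.\<close>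

lemma act_mult: "act (p * q) P = act p (act q P)"
proof (induction p arbitrary: P rule: pCons_induct)
  case (pCons c p)
  have "act (pCons c p * q) P = smult c (act q P) + act (pCons 0 (p * q)) P"
    by (simp add: act_add act_smult)
  also have "act (pCons 0 (p * q)) P = act p (act q (lap P))" by (simp add: act_pCons pCons.IH)
  finally show ?case by (simp add: act_pCons act_lap)
qed simp

section \<open>Radial integrals\<close>

text \<open>The radial profile without the factor exp(-|w|^2), which is contributed by the measure
  \<open>gauss\<close>; \<open>rp_kr\<close> relates the two forms.\<close>

definition rp :: "complex poly \<Rightarrow> complex \<Rightarrow> complex" where "rp P w = poly P (of_real ((cmod w)\<^sup>2))"

lemma continuous_rp [continuous_intros]: "continuous_on A (rp P)"
  unfolding rp_def[abs_def] by (intro continuous_intros)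
lemma rp_measurable [measurable]: "rp P \<in> borel_measurable borel"
  by (rule borel_measurable_continuous_onI) (rule continuous_rp)
lemma rp_add: "rp (P + Q) w = rp P w + rp Q w" by (simp add: rp_def)
lemma rp_smult: "rp (smult c P) w = c * rp P w" by (simp add: rp_def)
lemma rp_0 [simp]: "rp 0 w = 0" by (simp add: rp_def)
lemma rp_sum: "rp (sum f A) w = (\<Sum>x\<in>A. rp (f x) w)" by (simp add: rp_def poly_sum)

definition gaussK :: real where "gaussK = (\<integral>w. exp ((cmod w)\<^sup>2 / 2) \<partial>gauss)"

lemma integrable_gaussK: "integrable gauss (\<lambda>w. exp ((cmod w)\<^sup>2 / 2))"
  by (rule integrable_gauss_bound[where a = "1/2" and A = 1]) (auto simp: divide_simps)

lemma power_fact_le_exp: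
  fixes x :: real
  assumes "x \<ge> 0"
  shows "x ^ j / fact j \<le> exp x"
proof -
  have "x ^ j / fact j = (\<Sum>n\<in>{j}. x ^ n /\<^sub>R fact n)" by (simp add: divide_inverse mult.commute)
  also have "\<dots> \<le> (\<Sum>n. x ^ n /\<^sub>R fact n)"
    by (rule sum_le_suminf[OF summable_exp_generic]) (use assms in auto)
  finally show ?thesis by (simp add: exp_def)
qed

text \<open>Half of the Gaussian exponent dominates any power of |w|; the other half is kept for
  integrability.\<close>

lemma rp_monom_bound: "cmod (rp (monom 1 j) w) \<le> 2 ^ j * fact j * exp ((cmod w)\<^sup>2 / 2)"
proof -
  have "((cmod w)\<^sup>2 / 2) ^ j / fact j \<le> exp ((cmod w)\<^sup>2 / 2)" by (rule power_fact_le_exp) simp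
  then have "((cmod w)\<^sup>2) ^ j \<le> 2 ^ j * fact j * exp ((cmod w)\<^sup>2 / 2)"
    by (simp add: power_divide divide_simps mult_ac)
  then show ?thesis by (simp add: rp_def poly_monom norm_power)
qed

lemma rp_bound: "\<exists>A. \<forall>w. cmod (rp P w) \<le> A * exp ((cmod w)\<^sup>2 / 2)"
proof -
  have "cmod (rp P w) \<le> (\<Sum>j\<le>degree P. cmod (coeff P j) * (2 ^ j * fact j)) * exp ((cmod w)\<^sup>2 / 2)" for w
  proof -
    have "rp P w = (\<Sum>j\<le>degree P. coeff P j * rp (monom 1 j) w)"
      by (simp add: rp_def poly_altdef[of P] poly_monom)
    then have "cmod (rp P w) \<le> (\<Sum>j\<le>degree P. cmod (coeff P j * rp (monom 1 j) w))" by (simp add: norm_sum)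
    also have "\<dots> \<le> (\<Sum>j\<le>degree P. cmod (coeff P j) * (2 ^ j * fact j * exp ((cmod w)\<^sup>2 / 2)))"
      unfolding norm_mult by (intro sum_mono mult_left_mono rp_monom_bound) auto
    finally show ?thesis by (simp only: sum_distrib_right mult.assoc)
  qed
  then show ?thesis by blast
qed

lemma integrable_rp: "integrable gauss (rp P)"
proof -
  obtain A where "\<And>w. cmod (rp P w) \<le> A * exp ((cmod w)\<^sup>2 / 2)" using rp_bound by blast
  then show ?thesis by (intro integrable_gauss_bound[where a = "1/2" and A = A]) auto
qed

definition radnorm :: "complex poly \<Rightarrow> real" where "radnorm P = (\<integral>w. cmod (rp P w) \<partial>gauss)"

lemma radnorm_nonneg [simp]: "radnorm P \<ge> 0" by (simp add: radnorm_def)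
text \<open>On monomials \<open>lap\<close> is tridiagonal with entries of size
  \<open>j\<^sup>2\<close>, \<open>2 * j + 1\<close> and 1, and the factorial absorbs them: the drop
  in degree pays for one factor \<open>j\<close> of the square. In \<open>n\<close> the growth is
  only factorial, so dividing by (n!)^2, as in Pizzetti's formula, leaves entire series.\<close>

lemma rp_lapn_monom: "cmod (rp ((lap ^^ n) (monom 1 j)) w) \<le> exp ((cmod w)\<^sup>2 / 2) * 5 ^ n * 2 ^ j * fact (n + j)"
proof (induction n arbitrary: j)
  case 0
  then show ?case using rp_monom_bound[of j w] by (simp add: mult_ac)
next
  case (Suc n)
  define eK where "eK = exp ((cmod w)\<^sup>2 / 2)"
  have K: "eK \<ge> 0" by (simp add: eK_def)
  define radnorm where "radnorm P = cmod (rp P w)" for P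
  have radnorm_add: "radnorm (P + Q) \<le> radnorm P + radnorm Q" for P Q by (simp add: radnorm_def rp_add norm_triangle_ineq)
  have radnorm_smult: "radnorm (smult c P) = cmod c * radnorm P" for c P by (simp add: radnorm_def rp_smult norm_mult)
  note IH = Suc.IH[folded radnorm_def eK_def]
  define b where "b j = eK * 5 ^ n * 2 ^ j * fact (n + j)" for j
  have b0: "b j \<ge> 0" for j using K by (simp add: b_def)
  have f1: "real j * b (j - 1) \<le> b j / 2"
  proof (cases j)
    case (Suc i)
    have "real j * fact (n + i) \<le> fact (n + j)"
      unfolding Suc by (simp add: mult_right_mono)
    then have "eK * 5 ^ n * 2 ^ i * (real j * fact (n + i)) \<le> eK * 5 ^ n * 2 ^ i * fact (n + j)"
      using K by (intro mult_left_mono) auto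
    then show ?thesis by (simp add: b_def Suc mult_ac)
  qed (use b0[of 0] in simp)
  have f2: "real (j + 1) * b j \<le> eK * 5 ^ n * 2 ^ j * fact (n + j + 1)"
  proof -
    have "real (j + 1) * fact (n + j) \<le> fact (n + j + 1)" by (simp add: mult_right_mono)
    then have "eK * 5 ^ n * 2 ^ j * (real (j + 1) * fact (n + j)) \<le> eK * 5 ^ n * 2 ^ j * fact (n + j + 1)"
      using K by (intro mult_left_mono) auto
    then show ?thesis by (simp add: b_def mult_ac)
  qed
  define B where "B = eK * 5 ^ n * 2 ^ j * fact (n + j + 1)"
  have "radnorm ((lap ^^ Suc n) (monom 1 j)) = radnorm ((lap ^^ n) (lap (monom 1 j)))" by (simp only: lapn_lap)
  also have "\<dots> = radnorm (smult ((of_nat j)\<^sup>2) ((lap ^^ n) (monom 1 (j - 1))) + smult (- of_nat (2 * j + 1)) ((lap ^^ n) (monom 1 j)) + (lap ^^ n) (monom 1 (j + 1)))"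
    unfolding lap_monom lapn_add lapn_smult ..
  also have "\<dots> \<le> (real j)\<^sup>2 * radnorm ((lap ^^ n) (monom 1 (j - 1))) + real (2 * j + 1) * radnorm ((lap ^^ n) (monom 1 j)) + radnorm ((lap ^^ n) (monom 1 (j + 1)))"
  proof -
    have "cmod (- of_nat (2 * j + 1)) = real (2 * j + 1)" by (metis norm_minus_cancel norm_of_nat)
    moreover have "cmod ((of_nat j)\<^sup>2) = (real j)\<^sup>2" by (simp add: norm_power)
    ultimately show ?thesis
      by (intro order_trans[OF radnorm_add] add_mono order_refl) (simp_all only: radnorm_smult order_refl)
  qed
  also have "\<dots> \<le> (real j)\<^sup>2 * b (j - 1) + real (2 * j + 1) * b j + b (j + 1)"
    unfolding b_def by (intro add_mono mult_left_mono IH) auto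
  also have "(real j)\<^sup>2 * b (j - 1) = real j * (real j * b (j - 1))" by (simp add: power2_eq_square)
  also have "\<dots> \<le> real j * (b j / 2)" using f1 by (intro mult_left_mono) auto
  \<comment> \<open>With \<open>x = real j * b j\<close> and \<open>x + b j \<le> B\<close> the
    three terms add up to at most 5/2 B + 2 B, which explains the constant 5.\<close>
  also have "real j * (b j / 2) + real (2 * j + 1) * b j + b (j + 1) \<le> 5 * B"
  proof -
    have "b (j + 1) = 2 * B" by (simp add: b_def B_def)
    moreover have "real j * b j \<le> B" "real (j+1) * b j \<le> B" using f2 b0[of j] by (auto simp: B_def algebra_simps)
    moreover define x where "x = real j * b j"
    moreover have "real (2 * j + 1) * b j = 2 * x + b j" "real (j+1) * b j = x + b j" "real j * (b j / 2) = x / 2"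
      by (simp_all add: x_def algebra_simps)
    moreover have "x \<ge> 0" using b0[of j] by (simp add: x_def)
    ultimately show ?thesis using b0[of j] by linarith
  qed
  finally show ?case by (simp add: B_def radnorm_def eK_def)
qed

lemma rp_lapn_bound: "\<exists>A\<ge>0. \<forall>n w. cmod (rp ((lap ^^ n) P) w) \<le> A * 10 ^ n * fact n * exp ((cmod w)\<^sup>2 / 2)"
proof -
  define A where "A = (\<Sum>j\<le>degree P. cmod (coeff P j) * (4 ^ j * fact j))"
  have "cmod (rp ((lap ^^ n) P) w) \<le> A * 10 ^ n * fact n * exp ((cmod w)\<^sup>2 / 2)" for n w
  proof -
  define eK where "eK = exp ((cmod w)\<^sup>2 / 2)"
  have K: "eK \<ge> 0" by (simp add: eK_def)
  define radnorm where "radnorm P = cmod (rp P w)" for P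
  have radnorm_add: "radnorm (P + Q) \<le> radnorm P + radnorm Q" for P Q by (simp add: radnorm_def rp_add norm_triangle_ineq)
  have radnorm_smult: "radnorm (smult c P) = cmod c * radnorm P" for c P by (simp add: radnorm_def rp_smult norm_mult)
  have radnorm_sum: "radnorm (sum f S) \<le> (\<Sum>x\<in>S. radnorm (f x))" for f and S :: "nat set"
    by (simp add: radnorm_def rp_sum norm_sum)
  have m: "radnorm ((lap ^^ n) (monom 1 j)) \<le> eK * 4 ^ j * fact j * 10 ^ n * fact n" for n j
  proof -
    \<comment> \<open>The estimate (n + j)! \<le> 2^(n + j) n! j! separates the indices; it turns
      the base 5 of \<open>rp_lapn_monom\<close> into 10 and the base 2 into 4.\<close>
    have "fact (n + j) = (of_nat ((n + j) choose n) :: real) * fact n * fact j"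
      by (simp add: binomial_fact)
    also have "\<dots> \<le> 2 ^ (n + j) * fact n * fact j"
    proof -
      have "real ((n + j) choose n) \<le> real (2 ^ (n + j))" by (intro of_nat_mono binomial_le_pow2)
      then show ?thesis by (intro mult_right_mono) simp_all
    qed
    finally have "eK * 5 ^ n * 2 ^ j * fact (n + j) \<le> eK * 5 ^ n * 2 ^ j * (2 ^ (n + j) * fact n * fact j)"
      using K by (intro mult_left_mono) auto
    also have "\<dots> = eK * (2 * 2) ^ j * fact j * (5 * 2) ^ n * fact n"
      unfolding power_mult_distrib power_add by simp
    finally show ?thesis
      using order_trans[OF rp_lapn_monom[of n j w, folded eK_def]] by (simp add: radnorm_def)
  qed
    have "(\<Sum>j\<le>degree P. smult (coeff P j) (monom 1 j)) = P"
      using poly_as_sum_of_monoms[of P] by (simp add: smult_monom)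
    then have "radnorm ((lap ^^ n) P) = radnorm ((lap ^^ n) (\<Sum>j\<le>degree P. smult (coeff P j) (monom 1 j)))" by simp
    also have "\<dots> = radnorm (\<Sum>j\<le>degree P. smult (coeff P j) ((lap ^^ n) (monom 1 j)))"
      by (simp only: lapn_sum lapn_smult)
    also have "\<dots> \<le> (\<Sum>j\<le>degree P. cmod (coeff P j) * radnorm ((lap ^^ n) (monom 1 j)))"
      by (intro order_trans[OF radnorm_sum]) (simp add: radnorm_smult)
    also have "\<dots> \<le> (\<Sum>j\<le>degree P. cmod (coeff P j) * (eK * 4 ^ j * fact j * 10 ^ n * fact n))"
      by (intro sum_mono mult_left_mono m) auto
    also have "\<dots> = A * 10 ^ n * fact n * eK"
      unfolding A_def sum_distrib_right by (rule sum.cong) simp_all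
    finally show ?thesis by (simp add: radnorm_def eK_def)
  qed
  moreover have "A \<ge> 0" unfolding A_def by (intro sum_nonneg) auto
  ultimately show ?thesis by blast
qed

lemma radnorm_lapn_bound: "\<exists>A\<ge>0. \<forall>n. radnorm ((lap ^^ n) P) \<le> A * 10 ^ n * fact n"
proof -
  obtain A where A: "A \<ge> 0" "\<And>n w. cmod (rp ((lap ^^ n) P) w) \<le> A * 10 ^ n * fact n * exp ((cmod w)\<^sup>2 / 2)"
    using rp_lapn_bound[of P] by blast
  have "radnorm ((lap ^^ n) P) \<le> A * gaussK * 10 ^ n * fact n" for n
  proof -
    have "radnorm ((lap ^^ n) P) \<le> (\<integral>w. A * 10 ^ n * fact n * exp ((cmod w)\<^sup>2 / 2) \<partial>gauss)"
      unfolding radnorm_def by (intro integral_mono integrable_norm integrable_rp integrable_mult_right integrable_gaussK A)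
    then show ?thesis by (simp add: gaussK_def mult_ac)
  qed
  moreover have "A * gaussK \<ge> 0" using A by (simp add: gaussK_def)
  ultimately show ?thesis by blast
qed

definition radint :: "(complex \<Rightarrow> complex) \<Rightarrow> complex poly \<Rightarrow> complex" where
  "radint \<phi> P = (\<integral>w. \<phi> w * rp P w \<partial>gauss)"

lemma rp_kr: "of_real (exp (- (cmod w)\<^sup>2)) * rp P w = kr P (of_real ((cmod w)\<^sup>2))"
  by (simp add: rp_def kr_def mult.commute flip: exp_of_real)

lemma kr_measurable [measurable]: "kr P \<in> borel_measurable borel"
  unfolding kr_def[abs_def] by (intro borel_measurable_continuous_onI continuous_intros)

lemma integrable_bounded_mult:
  fixes f g :: "'x \<Rightarrow> complex"
  assumes g: "integrable M g" and [measurable]: "f \<in> borel_measurable M" and b: "\<And>x. cmod (f x) \<le> C"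
  shows "integrable M (\<lambda>x. f x * g x)"
proof (rule Bochner_Integration.integrable_bound)
  show "integrable M (\<lambda>x. C * norm (g x))" using g by (intro integrable_mult_right integrable_norm)
  show "AE x in M. norm (f x * g x) \<le> norm (C * norm (g x))"
  proof (rule AE_I2)
    fix x
    have "C \<ge> 0" using b[of x] norm_ge_zero order_trans by blast
    then show "norm (f x * g x) \<le> norm (C * norm (g x))" using b[of x] by (simp add: norm_mult mult_right_mono)
  qed
qed (use g in measurable)

lemma kr_integrable: "integrable lborel (\<lambda>w. cmod (kr P (of_real ((cmod (w - a))\<^sup>2))))"
  and kr_integral: "(\<integral>w. cmod (kr P (of_real ((cmod (w - a))\<^sup>2))) \<partial>lborel) = pi * radnorm P"
proof -
  have [measurable]: "(\<lambda>w. cmod (kr P (of_real ((cmod w)\<^sup>2)))) \<in> borel_measurable borel"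
    by measurable
  have eq: "(exp (- (cmod w)\<^sup>2) / pi) *\<^sub>R cmod (rp P w) = (1 / pi) * cmod (kr P (of_real ((cmod w)\<^sup>2)))" for w
    unfolding rp_kr[symmetric] by (simp add: norm_mult)
  have "integrable gauss (\<lambda>w. cmod (rp P w))" by (intro integrable_norm integrable_rp)
  then have "integrable lborel (\<lambda>w. (exp (- (cmod w)\<^sup>2) / pi) *\<^sub>R cmod (rp P w))"
    by (subst (asm) integrable_gauss_iff) auto
  from integrable_mult_right[OF this[unfolded eq], of pi] have "integrable lborel (\<lambda>w. cmod (kr P (of_real ((cmod w)\<^sup>2))))" by simp
  then show "integrable lborel (\<lambda>w. cmod (kr P (of_real ((cmod (w - a))\<^sup>2))))"
    using integrable_lborel_shift[of "\<lambda>w. cmod (kr P (of_real ((cmod w)\<^sup>2)))" "- a"] by simp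
  have "radnorm P = (\<integral>w. (1 / pi) * cmod (kr P (of_real ((cmod w)\<^sup>2))) \<partial>lborel)"
    unfolding radnorm_def eq[symmetric] by (rule integral_gauss) measurable
  also have "\<dots> = (1 / pi) * (\<integral>w. cmod (kr P (of_real ((cmod w)\<^sup>2))) \<partial>lborel)"
    by (rule integral_mult_right_zero)
  also have "(\<integral>w. cmod (kr P (of_real ((cmod w)\<^sup>2))) \<partial>lborel) = (\<integral>w. cmod (kr P (of_real ((cmod (w - a))\<^sup>2))) \<partial>lborel)"
    using integral_lborel_shift[of "\<lambda>w. cmod (kr P (of_real ((cmod w)\<^sup>2)))" "- a"] by simp
  finally show "(\<integral>w. cmod (kr P (of_real ((cmod (w - a))\<^sup>2))) \<partial>lborel) = pi * radnorm P" by (simp add: field_simps)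
qed

lemma Re_complex_of_real_mult: "Re (of_real x * z) = x * Re z" by simp

text \<open>An identity theorem from positive real arguments alone: once the lower coefficients
  vanish, divide by the n-th power of \<open>s\<close> and let \<open>s\<close> tend to 0 along 1/(k
  + 1).\<close>

lemma power_series_zero_pos:
  fixes c :: "nat \<Rightarrow> complex"
  assumes s: "\<And>R. R \<ge> 0 \<Longrightarrow> summable (\<lambda>n. norm (c n) * R ^ n)"
    and z: "\<And>s::real. s > 0 \<Longrightarrow> (\<Sum>n. c n * of_real s ^ n) = 0"
  shows "c n = 0"
proof (induction n rule: less_induct)
  case (less n)
  have sc: "summable (\<lambda>n. c n * y ^ n)" for y
    by (rule summable_norm_cancel) (use s[of "norm y"] in \<open>simp add: norm_mult norm_power\<close>)
  have sn: "summable (\<lambda>i. c (i + n) * y ^ i)" for y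
  proof (cases "y = 0")
    case False
    have "summable (\<lambda>i. c (i + n) * y ^ (i + n) * (1 / y ^ n))"
      by (intro summable_mult2 summable_ignore_initial_segment sc)
    then show ?thesis using False by (simp add: power_add)
  qed (simp add: powser_zero)
  have h0: "(\<Sum>i. c (i + n) * y ^ i) = 0" if y: "y = of_real t" "t > 0" for y t
  proof -
    have "(\<Sum>i. c (i + n) * y ^ (i + n)) = (\<Sum>i. c i * y ^ i) - (\<Sum>i<n. c i * y ^ i)"
      using suminf_minus_initial_segment[OF sc[of y], of n] by simp
    also have "\<dots> = 0" using z[of t] y less by simp
    also have "(\<Sum>i. c (i + n) * y ^ (i + n)) = (\<Sum>i. c (i + n) * y ^ i) * y ^ n"
      using suminf_mult2[OF sn[of y], of "y ^ n"] by (simp add: power_add mult.assoc)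
    finally show ?thesis using y by simp
  qed
  have "(\<lambda>k. \<Sum>i. c (i + n) * (of_real (1 / real (Suc k))) ^ i) = (\<lambda>k. 0)"
    by (rule ext, rule h0[OF refl]) simp
  moreover have "(\<lambda>k. \<Sum>i. c (i + n) * (of_real (1 / real (Suc k))) ^ i) \<longlonglongrightarrow> (\<Sum>i. c (i + n) * 0 ^ i)"
  proof (rule isCont_tendsto_compose[OF isCont_powser_converges_everywhere[OF sn]])
    have "(\<lambda>k. complex_of_real (1 / real (Suc k))) \<longlonglongrightarrow> of_real 0"
      by (intro tendsto_of_real LIMSEQ_Suc[OF lim_1_over_n])
    then show "(\<lambda>k. complex_of_real (1 / real (Suc k))) \<longlonglongrightarrow> 0" by simp
  qed
  ultimately have "(\<lambda>k::nat. 0) \<longlonglongrightarrow> (\<Sum>i. c (i + n) * 0 ^ i)" by simp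
  then have "(\<Sum>i. c (i + n) * 0 ^ i) = 0" by (simp add: LIMSEQ_const_iff)
  then show ?case by (subst (asm) powser_zero) simp
qed

section \<open>Circle means of the radial integrals of a bounded function\<close>

context
  fixes \<phi> :: "complex \<Rightarrow> complex" and C :: real
  assumes m[measurable]: "\<phi> \<in> borel_measurable borel" and bd: "\<And>z. cmod (\<phi> z) \<le> C"
begin

lemma radint_integrable: "integrable gauss (\<lambda>w. \<phi> w * rp P w)"
  by (rule integrable_bounded_mult[OF integrable_rp _ bd]) measurable

lemma radint_bound: "cmod (radint \<phi> P) \<le> C * radnorm P"
proof -
  have "cmod (radint \<phi> P) \<le> (\<integral>w. cmod (\<phi> w * rp P w) \<partial>gauss)" unfolding radint_def by (rule integral_norm_bound)
  also have "\<dots> \<le> (\<integral>w. C * cmod (rp P w) \<partial>gauss)"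
    unfolding norm_mult
    by (intro integral_mono integrable_mult_right integrable_norm integrable_rp mult_right_mono bd)
       (use radint_integrable[of P, THEN integrable_norm] in \<open>auto simp: norm_mult\<close>)
  finally show ?thesis by (simp add: radnorm_def)
qed

lemma radint_add: "radint \<phi> (P + Q) = radint \<phi> P + radint \<phi> Q"
  using radint_integrable by (simp add: radint_def rp_add distrib_left)
lemma radint_smult: "radint \<phi> (smult c P) = c * radint \<phi> P"
  by (simp add: radint_def rp_smult mult.left_commute[of _ c])
lemma radint_0: "radint \<phi> 0 = 0" by (simp add: radint_def)
lemma radint_sum: "radint \<phi> (sum f A) = (\<Sum>x\<in>A. radint \<phi> (f x))"
  by (induction A rule: infinite_finite_induct) (auto simp: radint_add radint_0)

text \<open>Translation invariance moves the shift from the function, which is merely measurable, to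
  the smooth radial weight.\<close>

lemma radint_lborel: "radint (\<lambda>w. \<phi> (w + a)) P = (1 / of_real pi) * (\<integral>w. \<phi> w * kr P (of_real ((cmod (w - a))\<^sup>2)) \<partial>lborel)"
  and integrable_lborel_kr: "integrable lborel (\<lambda>w. \<phi> w * kr P (of_real ((cmod (w - a))\<^sup>2)))"
proof -
  have [measurable]: "(\<lambda>w. kr P (of_real ((cmod w)\<^sup>2))) \<in> borel_measurable borel"
    by measurable
  have eq: "(exp (- (cmod w)\<^sup>2) / pi) *\<^sub>R (\<phi> (w + a) * rp P w) = (1 / of_real pi) * (\<phi> (w + a) * kr P (of_real ((cmod w)\<^sup>2)))" for w
    unfolding rp_kr[symmetric] by (simp add: scaleR_conv_of_real)
  have "integrable gauss (\<lambda>w. \<phi> (w + a) * rp P w)"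
    by (rule integrable_bounded_mult[OF integrable_rp _ bd]) measurable
  then have "integrable lborel (\<lambda>w. (1 / of_real pi) * (\<phi> (w + a) * kr P (of_real ((cmod w)\<^sup>2))))"
    by (subst (asm) integrable_gauss_iff) (auto simp: eq)
  from integrable_mult_right[OF this, of "of_real pi"]
  have "integrable lborel (\<lambda>w. \<phi> (w + a) * kr P (of_real ((cmod w)\<^sup>2)))" by simp
  then show "integrable lborel (\<lambda>w. \<phi> w * kr P (of_real ((cmod (w - a))\<^sup>2)))"
    by (subst integrable_lborel_shift[symmetric, of _ a]) auto
  have "radint (\<lambda>w. \<phi> (w + a)) P = (\<integral>w. (1 / of_real pi) * (\<phi> (w + a) * kr P (of_real ((cmod w)\<^sup>2))) \<partial>lborel)"
    unfolding radint_def by (subst integral_gauss) (auto simp: eq)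
  also have "\<dots> = (1 / of_real pi) * (\<integral>w. \<phi> (w + a) * kr P (of_real ((cmod w)\<^sup>2)) \<partial>lborel)"
    by (rule integral_mult_right_zero)
  also have "(\<integral>w. \<phi> (w + a) * kr P (of_real ((cmod w)\<^sup>2)) \<partial>lborel) = (\<integral>w. \<phi> w * kr P (of_real ((cmod (w - a))\<^sup>2)) \<partial>lborel)"
    by (subst (2) integral_lborel_shift[symmetric, of _ a]) auto
  finally show "radint (\<lambda>w. \<phi> (w + a)) P = (1 / of_real pi) * (\<integral>w. \<phi> w * kr P (of_real ((cmod (w - a))\<^sup>2)) \<partial>lborel)" .
qed

lemma radint_shift_bound: "cmod (radint (\<lambda>w. \<phi> (w + a)) P) \<le> C * radnorm P"
proof -
  have "integrable gauss (\<lambda>w. \<phi> (w + a) * rp P w)"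
    by (rule integrable_bounded_mult[OF integrable_rp _ bd]) measurable
  have "cmod (radint (\<lambda>w. \<phi> (w + a)) P) \<le> (\<integral>w. cmod (\<phi> (w + a) * rp P w) \<partial>gauss)" unfolding radint_def by (rule integral_norm_bound)
  also have "\<dots> \<le> (\<integral>w. C * cmod (rp P w) \<partial>gauss)"
    unfolding norm_mult
    by (intro integral_mono integrable_mult_right integrable_norm integrable_rp mult_right_mono bd)
       (use \<open>integrable gauss (\<lambda>w. \<phi> (w + a) * rp P w)\<close>[THEN integrable_norm] in \<open>auto simp: norm_mult\<close>)
  finally show ?thesis by (simp add: radnorm_def)
qed

lemma radint_summable_aux: "summable (\<lambda>n. C * radnorm ((lap ^^ n) P) / (fact n)\<^sup>2 * R ^ n)" if R: "R \<ge> 0"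
proof -
  obtain A where A: "A \<ge> 0" "\<And>n. radnorm ((lap ^^ n) P) \<le> A * 10 ^ n * fact n" using radnorm_lapn_bound by blast
  have C0: "C \<ge> 0" using bd[of 0] norm_ge_zero order_trans by blast
  have "summable (\<lambda>n. C * A * (inverse (fact n) * (10 * R) ^ n))"
    by (intro summable_mult summable_exp)
  then show ?thesis
  proof (rule summable_comparison_test')
    fix n
    have "C * radnorm ((lap ^^ n) P) / (fact n)\<^sup>2 * R ^ n \<le> C * (A * 10 ^ n * fact n) / (fact n)\<^sup>2 * R ^ n"
      using R C0 A(2)[of n] by (intro mult_right_mono divide_right_mono mult_left_mono) auto
    also have "\<dots> = C * A * (inverse (fact n) * (10 * R) ^ n)"
      by (simp add: power2_eq_square field_simps power_mult_distrib)
    finally show "norm (C * radnorm ((lap ^^ n) P) / (fact n)\<^sup>2 * R ^ n) \<le> C * A * (inverse (fact n) * (10 * R) ^ n)"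
      using R C0 by simp
  qed
qed

lemma radint_coeff_summable: "summable (\<lambda>n. norm (radint \<phi> ((lap ^^ n) P) / (fact n)\<^sup>2) * R ^ n)" if R: "R \<ge> 0"
  by (rule summable_comparison_test'[OF radint_summable_aux[OF R, of P]])
    (use R in \<open>auto simp: norm_divide norm_power intro!: mult_right_mono divide_right_mono radint_bound\<close>)

lemma circle_mean_radint_measurable: "(\<lambda>t. radint (\<lambda>w. \<phi> (w + of_real r * ucis t)) P) \<in> borel_measurable borel"
proof -
  have "(\<lambda>t. \<integral>w. \<phi> (w + of_real r * ucis t) * rp P w \<partial>gauss) \<in> borel_measurable borel"
    by (rule gauss.borel_measurable_lebesgue_integral) measurable
  then show ?thesis by (simp add: radint_def)
qed

text \<open>With the shift on the weight, Fubini puts the circle average there too, and Pizzetti's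
  formula expands it. The factorial bound of \<open>rp_lapn_bound\<close> permits integration term
  by term, so even for a measurable \<open>\<phi>\<close> the mean is entire in
  \<open>r\<^sup>2\<close>.\<close>

lemma circle_mean_radint:
  "(\<lambda>n. radint \<phi> ((lap ^^ n) P) / (fact n)\<^sup>2 * of_real (r\<^sup>2) ^ n) sums
     (\<integral>t. radint (\<lambda>w. \<phi> (w + of_real r * ucis t)) P \<partial>circ)"
proof -
  interpret P: pair_sigma_finite circ "lborel :: complex measure" ..
  define f where "f w t = \<phi> w * kr P (of_real ((cmod (w - of_real r * ucis t))\<^sup>2))" for w t
  have C0: "C \<ge> 0" using bd[of 0] norm_ge_zero order_trans by blast
  have fm: "(\<lambda>(t, w). f w t) \<in> borel_measurable (circ \<Otimes>\<^sub>M lborel)" unfolding f_def by measurable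
  have nint: "(\<integral>w. norm (f w t) \<partial>lborel) \<le> pi * (C * radnorm P)" for t
  proof -
    have "(\<integral>w. norm (f w t) \<partial>lborel) \<le> (\<integral>w. C * cmod (kr P (of_real ((cmod (w - of_real r * ucis t))\<^sup>2))) \<partial>lborel)"
      unfolding f_def norm_mult
      by (intro integral_mono integrable_mult_right kr_integrable mult_right_mono bd)
        (use integrable_lborel_kr[of P, THEN integrable_norm] in \<open>auto simp: norm_mult\<close>)
    also have "\<dots> = pi * (C * radnorm P)" by (simp only: integral_mult_right_zero kr_integral mult_ac)
    finally show ?thesis .
  qed
  have fint: "integrable (circ \<Otimes>\<^sub>M lborel) (\<lambda>(t, w). f w t)"
  proof (rule P.Fubini_integrable[OF fm])
    show "integrable circ (\<lambda>t. \<integral>w. norm (case (t, w) of (t, w) \<Rightarrow> f w t) \<partial>lborel)"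
    proof (rule integrable_circ[where C = "pi * (C * radnorm P)"])
      show "(\<lambda>t. \<integral>w. norm (case (t, w) of (t, w) \<Rightarrow> f w t) \<partial>lborel) \<in> borel_measurable borel"
        unfolding f_def by measurable
      show "norm (\<integral>w. norm (case (t, w) of (t, w) \<Rightarrow> f w t) \<partial>lborel) \<le> pi * (C * radnorm P)" for t
        using nint[of t] by simp
    qed
    show "AE t in circ. integrable lborel (\<lambda>w. case (t, w) of (t, w) \<Rightarrow> f w t)"
      by (intro AE_I2) (simp only: f_def prod.case integrable_lborel_kr)
  qed
  have "(\<integral>t. radint (\<lambda>w. \<phi> (w + of_real r * ucis t)) P \<partial>circ) = (\<integral>t. (1 / of_real pi) * (\<integral>w. f w t \<partial>lborel) \<partial>circ)"
    by (simp add: radint_lborel f_def)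
  also have "\<dots> = (1 / of_real pi) * (\<integral>t. (\<integral>w. f w t \<partial>lborel) \<partial>circ)" by (rule integral_mult_right_zero)
  also have "(\<integral>t. (\<integral>w. f w t \<partial>lborel) \<partial>circ) = (\<integral>w. (\<integral>t. f w t \<partial>circ) \<partial>lborel)"
    by (rule P.Fubini_integral[OF fint, symmetric])
  also have "(\<lambda>w. \<integral>t. f w t \<partial>circ) = (\<lambda>w. \<Sum>n. \<phi> w * (of_real (r\<^sup>2) ^ n / (fact n)\<^sup>2 * kr ((lap ^^ n) P) (of_real ((cmod w)\<^sup>2))))"
  proof
    fix w
    show "(\<integral>t. f w t \<partial>circ) = (\<Sum>n. \<phi> w * (of_real (r\<^sup>2) ^ n / (fact n)\<^sup>2 * kr ((lap ^^ n) P) (of_real ((cmod w)\<^sup>2))))"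
      using sums_unique[OF sums_mult[OF pizzetti[of r P w], of "\<phi> w"]] by (simp add: f_def)
  qed
  finally have 1: "(\<integral>t. radint (\<lambda>w. \<phi> (w + of_real r * ucis t)) P \<partial>circ) =
     (1 / of_real pi) * (\<integral>w. (\<Sum>n. \<phi> w * (of_real (r\<^sup>2) ^ n / (fact n)\<^sup>2 * kr ((lap ^^ n) P) (of_real ((cmod w)\<^sup>2)))) \<partial>lborel)" .
  obtain A where A: "A \<ge> 0" "\<And>n w. cmod (rp ((lap ^^ n) P) w) \<le> A * 10 ^ n * fact n * exp ((cmod w)\<^sup>2 / 2)"
    using rp_lapn_bound[of P] by blast
  define g where "g n w = \<phi> w * (of_real (r\<^sup>2) ^ n / (fact n)\<^sup>2 * kr ((lap ^^ n) P) (of_real ((cmod w)\<^sup>2)))" for n w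
  have g': "g n w = (of_real (r\<^sup>2) ^ n / (fact n)\<^sup>2) * (\<phi> w * kr ((lap ^^ n) P) (of_real ((cmod (w - 0))\<^sup>2)))" for n w
    by (simp add: g_def mult_ac)
  have gint: "integrable lborel (g n)" for n
    unfolding g' by (intro integrable_mult_right integrable_lborel_kr)
  have gI: "(\<integral>w. g n w \<partial>lborel) = of_real pi * (radint \<phi> ((lap ^^ n) P) / (fact n)\<^sup>2 * of_real (r\<^sup>2) ^ n)" for n
    unfolding g' integral_mult_right_zero using radint_lborel[of 0 "(lap ^^ n) P"] by (simp add: field_simps)
  have "(\<lambda>n. \<integral>w. g n w \<partial>lborel) sums (\<integral>w. (\<Sum>n. g n w) \<partial>lborel)"
  proof (rule sums_integral)
    show "integrable lborel (g n)" for n by (rule gint)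
    show "AE w in lborel. summable (\<lambda>n. norm (g n w))"
    proof (rule AE_I2)
      fix w
      have "summable (\<lambda>n. C * A * exp (- (cmod w)\<^sup>2 / 2) * (inverse (fact n) * (10 * r\<^sup>2) ^ n))"
        by (intro summable_mult summable_exp)
      then show "summable (\<lambda>n. norm (g n w))"
      proof (rule summable_comparison_test')
        fix n
        have "norm (g n w) = cmod (\<phi> w) * ((r\<^sup>2) ^ n / (fact n)\<^sup>2 * (exp (- (cmod w)\<^sup>2) * cmod (rp ((lap ^^ n) P) w)))"
          unfolding g_def rp_kr[symmetric] norm_mult by (simp add: norm_divide norm_power power_mult)
        also have "\<dots> \<le> C * ((r\<^sup>2) ^ n / (fact n)\<^sup>2 * (exp (- (cmod w)\<^sup>2) * (A * 10 ^ n * fact n * exp ((cmod w)\<^sup>2 / 2))))"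
          using C0 by (intro mult_mono bd mult_left_mono A order_refl) auto
        also have "\<dots> = C * A * (exp (- (cmod w)\<^sup>2) * exp ((cmod w)\<^sup>2 / 2)) * (inverse (fact n) * (10 * r\<^sup>2) ^ n)"
          by (simp add: power2_eq_square[of "fact n"] field_simps power_mult_distrib)
        also have "exp (- (cmod w)\<^sup>2) * exp ((cmod w)\<^sup>2 / 2) = exp (- (cmod w)\<^sup>2 / 2)"
          unfolding exp_add[symmetric] by simp
        finally show "norm (norm (g n w)) \<le> C * A * exp (- (cmod w)\<^sup>2 / 2) * (inverse (fact n) * (10 * r\<^sup>2) ^ n)"
          by simp
      qed
    qed
    show "summable (\<lambda>n. \<integral>w. norm (g n w) \<partial>lborel)"
    proof (rule summable_comparison_test'[OF summable_mult[OF radint_summable_aux[of "r\<^sup>2"]]])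
      fix n
      have "(\<integral>w. norm (g n w) \<partial>lborel) \<le> (\<integral>w. (r\<^sup>2) ^ n / (fact n)\<^sup>2 * (C * cmod (kr ((lap ^^ n) P) (of_real ((cmod (w - 0))\<^sup>2)))) \<partial>lborel)"
      proof (intro integral_mono kr_integrable integrable_norm[OF gint] integrable_mult_right)
        fix w
        show "norm (g n w) \<le> (r\<^sup>2) ^ n / (fact n)\<^sup>2 * (C * cmod (kr ((lap ^^ n) P) (of_real ((cmod (w - 0))\<^sup>2))))"
          unfolding g' norm_mult
          using bd[of w] C0 by (intro mult_mono) (auto simp: norm_divide norm_power)
      qed
      also have "\<dots> = (r\<^sup>2) ^ n / (fact n)\<^sup>2 * (C * (pi * radnorm ((lap ^^ n) P)))"
        unfolding integral_mult_right_zero kr_integral ..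
      finally show "norm (\<integral>w. norm (g n w) \<partial>lborel) \<le> pi * (C * radnorm ((lap ^^ n) P) / (fact n)\<^sup>2 * (r\<^sup>2) ^ n)"
        by (simp add: mult_ac)
    qed simp
  qed
  from sums_mult[OF this, of "1 / of_real pi"] show ?thesis
    unfolding 1 gI g_def[symmetric] by simp
qed

lemma circle_mean_radint_bound: "cmod (\<integral>t. radint (\<lambda>w. \<phi> (w + of_real r * ucis t)) P \<partial>circ) \<le> C * radnorm P"
proof -
  have i: "integrable circ (\<lambda>t. radint (\<lambda>w. \<phi> (w + of_real r * ucis t)) P)"
    by (rule integrable_circ[OF circle_mean_radint_measurable radint_shift_bound])
  have "cmod (\<integral>t. radint (\<lambda>w. \<phi> (w + of_real r * ucis t)) P \<partial>circ) \<le> (\<integral>t. cmod (radint (\<lambda>w. \<phi> (w + of_real r * ucis t)) P) \<partial>circ)"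
    by (rule integral_norm_bound)
  also have "\<dots> \<le> (\<integral>t. C * radnorm P \<partial>circ)"
    by (intro integral_mono integrable_norm i radint_shift_bound) auto
  finally show ?thesis by simp
qed

text \<open>The series sums to the circle mean of radius \<open>sqrt s\<close>, so the bound is
  uniform in \<open>s\<close>. The factor \<open>u\<close> and the real part prepare the resonance
  lemma, which is about real functions.\<close>

lemma radint_power_series_bound:
  assumes "s \<ge> 0"
  shows "\<bar>\<Sum>n. Re (u * (radint \<phi> ((lap ^^ n) P) / (fact n)\<^sup>2)) * s ^ n\<bar> \<le> cmod u * (C * radnorm P)"
proof -
  let ?X = "\<integral>t. radint (\<lambda>w. \<phi> (w + of_real (sqrt s) * ucis t)) P \<partial>circ"
  have "(\<lambda>n. Re (u * (radint \<phi> ((lap ^^ n) P) / (fact n)\<^sup>2 * of_real ((sqrt s)\<^sup>2) ^ n))) sums Re (u * ?X)"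
    by (intro sums_Re sums_mult circle_mean_radint)
  moreover have "Re (u * (radint \<phi> ((lap ^^ n) P) / (fact n)\<^sup>2 * of_real ((sqrt s)\<^sup>2) ^ n)) = Re (u * (radint \<phi> ((lap ^^ n) P) / (fact n)\<^sup>2)) * s ^ n" for n
  proof -
    have "u * (radint \<phi> ((lap ^^ n) P) / (fact n)\<^sup>2 * of_real ((sqrt s)\<^sup>2) ^ n) = of_real (s ^ n) * (u * (radint \<phi> ((lap ^^ n) P) / (fact n)\<^sup>2))"
      using assms by simp
    then show ?thesis by (simp only: Re_complex_of_real_mult) (simp add: mult.commute)
  qed
  ultimately have "(\<lambda>n. Re (u * (radint \<phi> ((lap ^^ n) P) / (fact n)\<^sup>2)) * s ^ n) sums Re (u * ?X)"
    by (simp only:)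
  then have "(\<Sum>n. Re (u * (radint \<phi> ((lap ^^ n) P) / (fact n)\<^sup>2)) * s ^ n) = Re (u * ?X)"
    by (rule sums_unique[symmetric])
  also have "\<bar>\<dots>\<bar> \<le> cmod (u * ?X)" by (rule abs_Re_le_cmod)
  also have "\<dots> \<le> cmod u * (C * radnorm P)"
    unfolding norm_mult by (intro mult_left_mono circle_mean_radint_bound) auto
  finally show ?thesis .
qed

text \<open>Up to (n!)^2 these numbers are the Taylor coefficients of the circle means around 0, so
  all those means vanish. Unlike \<open>radint \<phi> P = 0\<close>, the condition passes from
  \<open>P\<close> to \<open>lap P\<close>.\<close>

definition radnull :: "complex poly \<Rightarrow> bool" where "radnull P \<longleftrightarrow> (\<forall>n. radint \<phi> ((lap ^^ n) P) = 0)"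

lemma radnull_of_translates:
  assumes "\<And>a. radint (\<lambda>w. \<phi> (w + a)) P = 0"
  shows "radnull P"
proof -
  have "radint \<phi> ((lap ^^ n) P) / (fact n)\<^sup>2 = 0" for n
  proof (rule power_series_zero_pos[OF radint_coeff_summable])
    fix s :: real assume s: "s > 0"
    have "(\<lambda>n. radint \<phi> ((lap ^^ n) P) / (fact n)\<^sup>2 * of_real ((sqrt s)\<^sup>2) ^ n) sums 0"
      using circle_mean_radint[of P "sqrt s"] assms by simp
    then show "(\<Sum>n. radint \<phi> ((lap ^^ n) P) / (fact n)\<^sup>2 * of_real s ^ n) = 0"
      using s sums_unique by fastforce
  qed
  then show ?thesis by (simp add: radnull_def)
qed

lemma act_linear: "act [:c, 1:] P = smult c P + lap P"
  by (simp add: act_pCons)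

text \<open>The circular means of the radial integrals against \<open>P\<close> are bounded in the radius and, as
  power series in the squared radius, satisfy the hypotheses of the resonance lemma.\<close>

lemma radnull_step:
  assumes lam: "lm > 0" and Z: "radnull (act [:of_real lm, 1:] (act [:of_real lm, 1:] P))"
  shows "radnull (act [:of_real lm, 1:] P)"
proof -
  define Q where "Q = act [:of_real lm, 1:] P"
  have QQ: "radint \<phi> ((lap ^^ n) Q) = of_real lm * radint \<phi> ((lap ^^ n) P) + radint \<phi> ((lap ^^ Suc n) P)" for n
    unfolding Q_def act_linear lapn_add lapn_smult lapn_lap radint_add radint_smult ..
  have ZQ: "of_real lm * radint \<phi> ((lap ^^ n) Q) + radint \<phi> ((lap ^^ Suc n) Q) = 0" for n
    using Z unfolding Q_def[symmetric] radnull_def act_linear[of _ Q] lapn_add lapn_smult lapn_lap radint_add radint_smult by blast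
  \<comment> \<open>The resonance lemma is real, so it is applied to the real parts of all complex
    multiples \<open>u\<close>.\<close>
  have "Re (u * (radint \<phi> ((lap ^^ n) Q) / (fact n)\<^sup>2)) = 0" for u n
  proof (rule bessel_resonance_series[OF lam, where v = "\<lambda>n. Re (u * (radint \<phi> ((lap ^^ n) P) / (fact n)\<^sup>2))"
        and w = "\<lambda>n. Re (u * (radint \<phi> ((lap ^^ n) Q) / (fact n)\<^sup>2))" and n = n
        and C = "cmod u * (C * radnorm P)" and C' = "cmod u * (C * radnorm (lap P))"])
    \<comment> \<open>The factor \<open>(n + 1)\<^sup>2\<close> of the Bessel operator cancels
      against the squared factorials: on these coefficients the operator acts as \<open>lap\<close>
      does on the polynomial.\<close>
    have shift: "(real (Suc n))\<^sup>2 * Re (u * (radint \<phi> ((lap ^^ Suc n) P) / (fact (Suc n))\<^sup>2)) = Re (u * (radint \<phi> ((lap ^^ Suc n) P) / (fact n)\<^sup>2))" for n P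
    proof -
      have "u * (radint \<phi> ((lap ^^ Suc n) P) / (fact n)\<^sup>2) = of_real ((real (Suc n))\<^sup>2) * (u * (radint \<phi> ((lap ^^ Suc n) P) / (fact (Suc n))\<^sup>2))"
      proof -
        have "z / f\<^sup>2 = N\<^sup>2 * (z / (N * f)\<^sup>2)" if "N \<noteq> 0" for z f N :: complex
          using that by (simp add: power_mult_distrib)
        then have e: "radint \<phi> ((lap ^^ Suc n) P) / (fact n)\<^sup>2 = (of_nat (Suc n))\<^sup>2 * (radint \<phi> ((lap ^^ Suc n) P) / (of_nat (Suc n) * fact n)\<^sup>2)"
          by (metis of_nat_eq_0_iff old.nat.distinct(1))
        show ?thesis
          by (subst e) (simp only: fact_Suc of_real_power of_real_of_nat_eq mult.left_commute[of u])
      qed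
      then show ?thesis by (simp only: Re_complex_of_real_mult)
    qed
    show "summable (\<lambda>n. Re (u * (radint \<phi> ((lap ^^ n) P) / (fact n)\<^sup>2)) * R ^ n)" for R
    proof (rule summable_comparison_test'[OF summable_mult[OF radint_coeff_summable[of "\<bar>R\<bar>" P], of "cmod u"]])
      fix n
      show "norm (Re (u * (radint \<phi> ((lap ^^ n) P) / (fact n)\<^sup>2)) * R ^ n) \<le> cmod u * (norm (radint \<phi> ((lap ^^ n) P) / (fact n)\<^sup>2) * \<bar>R\<bar> ^ n)"
        using mult_right_mono[OF abs_Re_le_cmod[of "u * (radint \<phi> ((lap ^^ n) P) / (fact n)\<^sup>2)"], of "\<bar>R\<bar> ^ n"]
        by (simp only: norm_mult[of u] abs_mult real_norm_def power_abs mult.assoc) simp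
    qed simp
    show "Re (u * (radint \<phi> ((lap ^^ n) Q) / (fact n)\<^sup>2)) = (real (Suc n))\<^sup>2 * Re (u * (radint \<phi> ((lap ^^ Suc n) P) / (fact (Suc n))\<^sup>2)) +
        lm * Re (u * (radint \<phi> ((lap ^^ n) P) / (fact n)\<^sup>2))" for n
      unfolding shift unfolding QQ Re_complex_of_real_mult[symmetric] by (simp add: add_divide_distrib algebra_simps)
    show "(real (Suc n))\<^sup>2 * Re (u * (radint \<phi> ((lap ^^ Suc n) Q) / (fact (Suc n))\<^sup>2)) + lm * Re (u * (radint \<phi> ((lap ^^ n) Q) / (fact n)\<^sup>2)) = 0" for n
    proof -
      have "Re (u * (radint \<phi> ((lap ^^ Suc n) Q) / (fact n)\<^sup>2)) + lm * Re (u * (radint \<phi> ((lap ^^ n) Q) / (fact n)\<^sup>2))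
        = Re (u / (fact n)\<^sup>2 * (of_real lm * radint \<phi> ((lap ^^ n) Q) + radint \<phi> ((lap ^^ Suc n) Q)))"
        unfolding Re_complex_of_real_mult[symmetric] by (simp add: add_divide_distrib algebra_simps)
      then show ?thesis unfolding shift ZQ by simp
    qed
    show "\<bar>\<Sum>n. Re (u * (radint \<phi> ((lap ^^ n) P) / (fact n)\<^sup>2)) * s ^ n\<bar> \<le> cmod u * (C * radnorm P)" if "s \<ge> 0" for s
      by (rule radint_power_series_bound[OF that])
    show "\<bar>\<Sum>n. (real (Suc n))\<^sup>2 * Re (u * (radint \<phi> ((lap ^^ Suc n) P) / (fact (Suc n))\<^sup>2)) * s ^ n\<bar> \<le> cmod u * (C * radnorm (lap P))" if "s \<ge> 0" for s
      unfolding shift using radint_power_series_bound[OF that, of u "lap P"] by (simp only: lapn_lap)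
  qed
  \<comment> \<open>The choices \<open>u = 1\<close> and \<open>u = - \<i>\<close> give the real and
    the imaginary part.\<close>
  moreover have "z = 0" if "\<And>u. Re (u * z) = 0" for z
    using that[of 1] that[of "- \<i>"] by (intro complex_eqI) simp_all
  ultimately have "radint \<phi> ((lap ^^ n) Q) / (fact n)\<^sup>2 = 0" for n by blast
  then show ?thesis by (simp add: radnull_def Q_def)
qed

text \<open>By commutativity the square of the first factor can be applied last, where
  \<open>radnull_step\<close> removes one copy. The remaining copy is then applied first, to
  \<open>P\<close>, and the induction hypothesis treats the other factors.\<close>

lemma radnull_roots:
  fixes ls :: "real list"
  assumes "\<And>l. l \<in> set ls \<Longrightarrow> l > 0"
    and "radnull (act (prod_list (map (\<lambda>l. [:of_real l, 1:]) ls)) (act (prod_list (map (\<lambda>l. [:of_real l, 1:]) ls)) P))"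
  shows "radnull (act (prod_list (map (\<lambda>l. [:of_real l, 1:]) ls)) P)"
  using assms
proof (induction ls arbitrary: P)
  case (Cons l ls)
  have l: "l > 0" using Cons.prems(1) by simp
  define q where "q = [:complex_of_real l, 1:]"
  define M where "M = prod_list (map (\<lambda>l. [:complex_of_real l, 1:]) ls)"
  have "radnull (act ((q * M) * (q * M)) P)" using Cons.prems(2) by (simp only: act_mult list.map prod_list.Cons q_def M_def)
  also have "(q * M) * (q * M) = q * q * (M * M)" by (simp add: mult_ac)
  finally have "radnull (act q (act q (act (M * M) P)))" by (simp only: act_mult)
  then have "radnull (act q (act (M * M) P))" by (rule radnull_step[OF l, folded q_def])
  then have "radnull (act (q * (M * M)) P)" by (simp only: act_mult)
  also have "q * (M * M) = M * M * q" by (simp add: mult_ac)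
  finally have "radnull (act M (act M (act q P)))" by (simp only: act_mult)
  then have "radnull (act M (act q P))" by (rule Cons.IH[folded M_def, rotated]) (use Cons.prems(1) in simp)
  then have "radnull (act (M * q) P)" by (simp only: act_mult)
  also have "M * q = q * M" by (rule mult.commute)
  finally show ?case by (simp only: list.map prod_list.Cons q_def M_def)
qed simp

end

section \<open>Square-integrable functions\<close>

lemma borel_measurable_cnj [measurable]:
  assumes "f \<in> borel_measurable M"
  shows "(\<lambda>x. cnj (f x)) \<in> borel_measurable M"
  using assms by (rule measurable_compose) (intro borel_measurable_continuous_onI continuous_intros)

lemma L2_measurable: "f \<in> L2 \<Longrightarrow> f \<in> borel_measurable borel" by (simp add: L2_def)
lemma L2_integrable: "f \<in> L2 \<Longrightarrow> integrable gauss (\<lambda>z. (cmod (f z))\<^sup>2)" by (simp add: L2_def)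

lemma L2_ip_integrable:
  assumes "f \<in> L2" "g \<in> L2"
  shows "integrable gauss (\<lambda>z. f z * cnj (g z))"
proof (rule Bochner_Integration.integrable_bound)
  show "integrable gauss (\<lambda>z. (cmod (f z))\<^sup>2 + (cmod (g z))\<^sup>2)"
    using assms by (intro Bochner_Integration.integrable_add L2_integrable)
  show "(\<lambda>z. f z * cnj (g z)) \<in> borel_measurable gauss"
    using assms[THEN L2_measurable] by measurable
  show "AE z in gauss. norm (f z * cnj (g z)) \<le> norm ((cmod (f z))\<^sup>2 + (cmod (g z))\<^sup>2)"
  proof (rule AE_I2)
    fix z
    have "0 \<le> (cmod (f z) - cmod (g z))\<^sup>2" by simp
    then have "2 * (cmod (f z) * cmod (g z)) \<le> (cmod (f z))\<^sup>2 + (cmod (g z))\<^sup>2"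
      by (simp add: power2_eq_square algebra_simps)
    moreover have "0 \<le> cmod (f z) * cmod (g z)" by simp
    ultimately have "cmod (f z) * cmod (g z) \<le> (cmod (f z))\<^sup>2 + (cmod (g z))\<^sup>2" by linarith
    then show "norm (f z * cnj (g z)) \<le> norm ((cmod (f z))\<^sup>2 + (cmod (g z))\<^sup>2)"
      by (simp add: norm_mult)
  qed
qed

lemma L2_add: assumes "f \<in> L2" "g \<in> L2" shows "(\<lambda>z. f z + g z) \<in> L2"
proof -
  have [measurable]: "f \<in> borel_measurable borel" "g \<in> borel_measurable borel"
    using assms[THEN L2_measurable] .
  have "integrable gauss (\<lambda>z. (cmod (f z + g z))\<^sup>2)"
  proof (rule Bochner_Integration.integrable_bound)
    show "integrable gauss (\<lambda>z. 2 * (cmod (f z))\<^sup>2 + 2 * (cmod (g z))\<^sup>2)"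
      using assms by (intro Bochner_Integration.integrable_add integrable_mult_right L2_integrable)
    show "AE z in gauss. norm ((cmod (f z + g z))\<^sup>2) \<le> norm (2 * (cmod (f z))\<^sup>2 + 2 * (cmod (g z))\<^sup>2)"
    proof (rule AE_I2)
      fix z
      have "(cmod (f z + g z))\<^sup>2 \<le> (cmod (f z) + cmod (g z))\<^sup>2"
        by (intro power_mono norm_triangle_ineq) auto
      also have "\<dots> \<le> 2 * (cmod (f z))\<^sup>2 + 2 * (cmod (g z))\<^sup>2"
        using zero_le_power2[of "cmod (f z) - cmod (g z)"] by (simp add: power2_eq_square algebra_simps)
      finally show "norm ((cmod (f z + g z))\<^sup>2) \<le> norm (2 * (cmod (f z))\<^sup>2 + 2 * (cmod (g z))\<^sup>2)" by simp
    qed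
  qed measurable
  then show ?thesis by (simp add: L2_def)
qed

lemma L2_scale: assumes "f \<in> L2" shows "(\<lambda>z. c * f z) \<in> L2"
  using assms by (auto simp: L2_def norm_mult power_mult_distrib)

lemma L2_diff: assumes "f \<in> L2" "g \<in> L2" shows "(\<lambda>z. f z - g z) \<in> L2"
  using L2_add[OF assms(1) L2_scale[OF assms(2), of "-1"]] by simp

lemma L2_0: "(\<lambda>z. 0) \<in> L2" by (simp add: L2_def)

lemma L2_sum: "(\<And>i. i \<in> S \<Longrightarrow> f i \<in> L2) \<Longrightarrow> (\<lambda>z. \<Sum>i\<in>S. f i z) \<in> L2"
  by (induction S rule: infinite_finite_induct) (auto intro: L2_add L2_0)

lemma L2_mult_bounded:
  assumes "f \<in> L2" and [measurable]: "\<phi> \<in> borel_measurable borel" and b: "AE z in lborel. cmod (\<phi> z) \<le> C"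
  shows "(\<lambda>z. \<phi> z * f z) \<in> L2"
proof -
  have [measurable]: "f \<in> borel_measurable borel" using assms(1) by (rule L2_measurable)
  have "integrable gauss (\<lambda>z. (cmod (\<phi> z * f z))\<^sup>2)"
  proof (rule Bochner_Integration.integrable_bound)
    show "integrable gauss (\<lambda>z. C\<^sup>2 * (cmod (f z))\<^sup>2)"
      using assms by (intro integrable_mult_right L2_integrable)
    show "AE z in gauss. norm ((cmod (\<phi> z * f z))\<^sup>2) \<le> norm (C\<^sup>2 * (cmod (f z))\<^sup>2)"
      using b unfolding AE_gauss_iff[symmetric]
    proof eventually_elim
      case (elim z)
      then have "(cmod (\<phi> z))\<^sup>2 \<le> C\<^sup>2" by (intro power_mono) auto
      then show ?case by (simp add: norm_mult power_mult_distrib mult_right_mono)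
    qed
  qed measurable
  then show ?thesis by (simp add: L2_def)
qed

lemma ip_add_left: "f \<in> L2 \<Longrightarrow> g \<in> L2 \<Longrightarrow> h \<in> L2 \<Longrightarrow> ip (\<lambda>z. f z + g z) h = ip f h + ip g h"
  by (simp add: ip_def distrib_right L2_ip_integrable)
lemma ip_diff_left: "f \<in> L2 \<Longrightarrow> g \<in> L2 \<Longrightarrow> h \<in> L2 \<Longrightarrow> ip (\<lambda>z. f z - g z) h = ip f h - ip g h"
  by (simp add: ip_def left_diff_distrib L2_ip_integrable)
lemma ip_scale_left: "ip (\<lambda>z. c * f z) h = c * ip f h"
  by (simp add: ip_def mult.assoc)
lemma ip_cnj: "cnj (ip f g) = ip g f"
  unfolding ip_def Bochner_Integration.integral_cnj[symmetric] by (simp add: mult.commute)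
lemma ip_scale_right: "ip h (\<lambda>z. c * f z) = cnj c * ip h f"
  by (simp add: ip_def mult.left_commute)
lemma ip_add_right: "f \<in> L2 \<Longrightarrow> g \<in> L2 \<Longrightarrow> h \<in> L2 \<Longrightarrow> ip h (\<lambda>z. f z + g z) = ip h f + ip h g"
  by (simp add: ip_def distrib_left L2_ip_integrable)
lemma ip_diff_right: "f \<in> L2 \<Longrightarrow> g \<in> L2 \<Longrightarrow> h \<in> L2 \<Longrightarrow> ip h (\<lambda>z. f z - g z) = ip h f - ip h g"
  by (simp add: ip_def right_diff_distrib L2_ip_integrable)
lemma ip_0_left [simp]: "ip (\<lambda>z. 0) h = 0" by (simp add: ip_def)
lemma ip_0_right [simp]: "ip h (\<lambda>z. 0) = 0" by (simp add: ip_def)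
lemma ip_sum_right:
  assumes "\<And>i. i \<in> S \<Longrightarrow> f i \<in> L2" "h \<in> L2"
  shows "ip h (\<lambda>z. \<Sum>i\<in>S. c i * f i z) = (\<Sum>i\<in>S. cnj (c i) * ip h (f i))"
  using assms
  by (induction S rule: infinite_finite_induct) (auto simp: ip_add_right ip_scale_right L2_scale L2_sum)

lemma nrm_nonneg [simp]: "nrm f \<ge> 0" by (simp add: nrm_def)
lemma nrm_sq: "(nrm f)\<^sup>2 = (\<integral>z. (cmod (f z))\<^sup>2 \<partial>gauss)" by (simp add: nrm_def)
lemma ip_self: "ip f f = of_real ((nrm f)\<^sup>2)"
proof -
  have "ip f f = (\<integral>z. complex_of_real ((cmod (f z))\<^sup>2) \<partial>gauss)"
    unfolding ip_def complex_norm_square ..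
  then show ?thesis unfolding nrm_sq integral_complex_of_real .
qed
lemma nrm_scale: "nrm (\<lambda>z. c * f z) = cmod c * nrm f"
  by (simp add: nrm_def norm_mult power_mult_distrib real_sqrt_mult)

text \<open>The bound is smallest at \<open>t = sqrt G / sqrt F\<close>, where its two summands
  agree. If \<open>F\<close> or \<open>G\<close> vanishes, a large or a small \<open>t\<close>
  forces \<open>X \<le> 0\<close>.\<close>

lemma le_sqrt_mult_if_amgm:
  fixes X F G :: real
  assumes "F \<ge> 0" "G \<ge> 0" and h: "\<And>t. t > 0 \<Longrightarrow> X \<le> t * F + G / t"
  shows "X \<le> 2 * (sqrt F * sqrt G)"
proof (cases "F = 0 \<or> G = 0")
  case True
  have "X \<le> 0"
  proof (rule ccontr)
    assume "\<not> X \<le> 0"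
    then have X: "X > 0" by simp
    show False
    proof (cases "F = 0")
      case True
      then show False using h[of "(2 * G + 1) / X"] X assms(2)
        by (simp add: field_simps) (smt (verit) mult_pos_pos mult_nonneg_nonneg)
    next
      case False
      with \<open>F = 0 \<or> G = 0\<close> have "G = 0" by simp
      have "F > 0" using False assms by simp
      then show False using h[of "X / (2 * F)"] X \<open>G = 0\<close> by (simp add: field_simps)
    qed
  qed
  then show ?thesis using assms by (smt (verit) mult_nonneg_nonneg real_sqrt_ge_zero)
next
  case False
  then have p: "sqrt F > 0" "sqrt G > 0" using assms by auto
  have F: "F = sqrt F * sqrt F" "G = sqrt G * sqrt G" using assms by auto
  have "X \<le> sqrt G / sqrt F * F + G / (sqrt G / sqrt F)" using p by (intro h) auto
  also have "sqrt G / sqrt F * F = sqrt F * sqrt G" using p F(1) by (metis nonzero_mult_div_cancel_right less_irrefl mult.commute mult.assoc times_divide_eq_left)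
  also have "G / (sqrt G / sqrt F) = sqrt F * sqrt G" using p F(2) by (metis nonzero_mult_div_cancel_right less_irrefl mult.commute mult.assoc divide_divide_eq_right times_divide_eq_left)
  finally show ?thesis by simp
qed

text \<open>Cauchy-Schwarz, from integrating 2ab \<le> t a^2 + b^2/t and optimising over
  \<open>t\<close>.\<close>

lemma abs_ip_integral_le:
  assumes f: "f \<in> L2" and g: "g \<in> L2"
  shows "(\<integral>z. cmod (f z) * cmod (g z) \<partial>gauss) \<le> nrm f * nrm g"
proof -
  have i: "integrable gauss (\<lambda>z. cmod (f z) * cmod (g z))"
    using L2_ip_integrable[OF f g, THEN integrable_norm] by (simp add: norm_mult)
  have "2 * (\<integral>z. cmod (f z) * cmod (g z) \<partial>gauss) \<le> 2 * (sqrt ((nrm f)\<^sup>2) * sqrt ((nrm g)\<^sup>2))"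
  proof (rule le_sqrt_mult_if_amgm)
    fix t :: real assume t: "t > 0"
    have "2 * (\<integral>z. cmod (f z) * cmod (g z) \<partial>gauss) = (\<integral>z. 2 * (cmod (f z) * cmod (g z)) \<partial>gauss)" by simp
    also have "\<dots> \<le> (\<integral>z. t * (cmod (f z))\<^sup>2 + (cmod (g z))\<^sup>2 / t \<partial>gauss)"
    proof (intro integral_mono integrable_mult_right i Bochner_Integration.integrable_add integrable_divide L2_integrable f g)
      fix z
      have "0 \<le> (t * cmod (f z) - cmod (g z))\<^sup>2 / t" using t by simp
      also have "\<dots> = t * (cmod (f z))\<^sup>2 + (cmod (g z))\<^sup>2 / t - 2 * (cmod (f z) * cmod (g z))"
        using t by (simp add: power2_eq_square field_simps)
      finally show "2 * (cmod (f z) * cmod (g z)) \<le> t * (cmod (f z))\<^sup>2 + (cmod (g z))\<^sup>2 / t" by simp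
    qed
    also have "\<dots> = t * (nrm f)\<^sup>2 + (nrm g)\<^sup>2 / t"
      using f g by (simp add: nrm_sq L2_integrable)
    finally show "2 * (\<integral>z. cmod (f z) * cmod (g z) \<partial>gauss) \<le> t * (nrm f)\<^sup>2 + (nrm g)\<^sup>2 / t" .
  qed auto
  then show ?thesis by simp
qed

lemma ip_bound:
  assumes f: "f \<in> L2" and g: "g \<in> L2"
  shows "cmod (ip f g) \<le> nrm f * nrm g"
proof -
  have "cmod (ip f g) \<le> (\<integral>z. cmod (f z * cnj (g z)) \<partial>gauss)" unfolding ip_def by (rule integral_norm_bound)
  then show ?thesis using abs_ip_integral_le[OF f g] by (simp add: norm_mult)
qed

section \<open>Functions of exponential growth\<close>

text \<open>A subclass of \<open>L2\<close> closed under sums, products and conjugation. It contains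
  the polynomials in \<open>w\<close> and \<open>cnj w\<close> and the exponentials of linear
  functions, so square integrability can be read off the shape of a term.\<close>

definition egrow :: "(complex \<Rightarrow> complex) \<Rightarrow> bool" where
  "egrow f \<longleftrightarrow> f \<in> borel_measurable borel \<and> (\<exists>A R. \<forall>z. cmod (f z) \<le> A * exp (R * cmod z))"

lemma egrowI: "f \<in> borel_measurable borel \<Longrightarrow> (\<And>z. cmod (f z) \<le> A * exp (R * cmod z)) \<Longrightarrow> egrow f"
  by (auto simp: egrow_def)

lemma egrow_measurable: "egrow f \<Longrightarrow> f \<in> borel_measurable borel" by (simp add: egrow_def)

lemma egrowE:
  assumes "egrow f"
  obtains A R where "A \<ge> 0" "R \<ge> 0" "\<And>z. cmod (f z) \<le> A * exp (R * cmod z)"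
proof -
  obtain A R where AR: "\<And>z. cmod (f z) \<le> A * exp (R * cmod z)" using assms by (auto simp: egrow_def)
  have "A \<ge> 0" using order_trans[OF norm_ge_zero AR[of 0]] by simp
  moreover have "cmod (f z) \<le> A * exp (max 0 R * cmod z)" for z
    using AR[of z] \<open>A \<ge> 0\<close> by (elim order_trans) (intro mult_left_mono, auto intro: mult_right_mono)
  ultimately show ?thesis using that[of A "max 0 R"] by simp
qed

lemma egrow_const [simp]: "egrow (\<lambda>z. c)" by (rule egrowI[where A = "cmod c" and R = 0]) auto
lemma egrow_id [simp]: "egrow (\<lambda>z. z)"
proof (rule egrowI[where A = 1 and R = 1])
  fix z
  have "cmod z \<le> exp (cmod z)" using exp_ge_add_one_self[of "cmod z"] by linarith
  then show "cmod z \<le> 1 * exp (1 * cmod z)" by simp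
qed auto
lemma egrow_cnj: assumes "egrow f" shows "egrow (\<lambda>z. cnj (f z))"
proof -
  have [measurable]: "f \<in> borel_measurable borel" using assms by (rule egrow_measurable)
  obtain A R where "\<And>z. cmod (f z) \<le> A * exp (R * cmod z)" using egrowE[OF assms] by metis
  then show ?thesis by (intro egrowI[where A = A and R = R]) auto
qed
lemma egrow_mult: assumes "egrow f" "egrow g" shows "egrow (\<lambda>z. f z * g z)"
proof -
  have [measurable]: "f \<in> borel_measurable borel" "g \<in> borel_measurable borel" using assms[THEN egrow_measurable] .
  obtain A R where 1: "A \<ge> 0" "\<And>z. cmod (f z) \<le> A * exp (R * cmod z)" using egrowE[OF assms(1)] by metis
  obtain B S where 2: "B \<ge> 0" "\<And>z. cmod (g z) \<le> B * exp (S * cmod z)" using egrowE[OF assms(2)] by metis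
  show ?thesis
  proof (rule egrowI[where A = "A * B" and R = "R + S"])
    fix z
    have "cmod (f z * g z) \<le> (A * exp (R * cmod z)) * (B * exp (S * cmod z))"
      unfolding norm_mult using 1 2 by (intro mult_mono) auto
    then show "cmod (f z * g z) \<le> A * B * exp ((R + S) * cmod z)"
      unfolding distrib_right exp_add by (simp add: mult_ac)
  qed measurable
qed
lemma egrow_add: assumes "egrow f" "egrow g" shows "egrow (\<lambda>z. f z + g z)"
proof -
  have [measurable]: "f \<in> borel_measurable borel" "g \<in> borel_measurable borel" using assms[THEN egrow_measurable] .
  obtain A R where 1: "A \<ge> 0" "R \<ge> 0" "\<And>z. cmod (f z) \<le> A * exp (R * cmod z)" using egrowE[OF assms(1)] by metis
  obtain B S where 2: "B \<ge> 0" "S \<ge> 0" "\<And>z. cmod (g z) \<le> B * exp (S * cmod z)" using egrowE[OF assms(2)] by metis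
  show ?thesis
  proof (rule egrowI[where A = "A + B" and R = "R + S"])
    fix z
    have "cmod (f z + g z) \<le> A * exp (R * cmod z) + B * exp (S * cmod z)"
      using 1(3)[of z] 2(3)[of z] norm_triangle_ineq[of "f z" "g z"] by linarith
    also have "\<dots> \<le> A * exp ((R + S) * cmod z) + B * exp ((R + S) * cmod z)"
      using 1 2 by (intro add_mono mult_left_mono) (auto intro: mult_right_mono)
    finally show "cmod (f z + g z) \<le> (A + B) * exp ((R + S) * cmod z)" by (simp add: distrib_right)
  qed measurable
qed
lemma egrow_diff: "egrow f \<Longrightarrow> egrow g \<Longrightarrow> egrow (\<lambda>z. f z - g z)"
  using egrow_add[of f "\<lambda>z. (-1) * g z"] egrow_mult[of "\<lambda>z. -1" g] by simp
lemma egrow_power: "egrow f \<Longrightarrow> egrow (\<lambda>z. f z ^ n)"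
  by (induction n) (auto intro: egrow_mult)
lemma egrow_sum: "(\<And>i. i \<in> S \<Longrightarrow> egrow (f i)) \<Longrightarrow> egrow (\<lambda>z. \<Sum>i\<in>S. f i z)"
  by (induction S rule: infinite_finite_induct) (auto intro: egrow_add)
lemma egrow_exp: "egrow (\<lambda>z. exp (z * c))"
proof (rule egrowI[where A = 1 and R = "cmod c"])
  fix z
  have "cmod (exp (z * c)) \<le> exp (cmod (z * c))" by (rule norm_exp)
  then show "cmod (exp (z * c)) \<le> 1 * exp (cmod c * cmod z)" by (simp add: norm_mult mult.commute)
qed measurable
lemma exp_linear_le: "R \<ge> 0 \<Longrightarrow> exp (R * x) \<le> exp (R\<^sup>2) * exp ((1/4) * x\<^sup>2)" for x R :: real
proof -
  have "0 \<le> (R - x / 2)\<^sup>2" by simp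
  then have "R * x \<le> R\<^sup>2 + (1/4) * x\<^sup>2" by (simp add: power2_eq_square algebra_simps)
  then show ?thesis by (simp add: exp_add[symmetric])
qed

lemma egrow_integrable: assumes "egrow f" shows "integrable gauss f"
proof -
  have [measurable]: "f \<in> borel_measurable borel" using assms by (rule egrow_measurable)
  obtain A R where 1: "A \<ge> 0" "R \<ge> 0" "\<And>z. cmod (f z) \<le> A * exp (R * cmod z)" using egrowE[OF assms] by metis
  show ?thesis
  proof (rule integrable_gauss_bound[where a = "1/4" and A = "A * exp (R\<^sup>2)"])
    fix z
    have "A * exp (R * cmod z) \<le> A * (exp (R\<^sup>2) * exp ((1/4) * (cmod z)\<^sup>2))"
      using 1 by (intro mult_left_mono exp_linear_le) auto
    then show "norm (f z) \<le> A * exp (R\<^sup>2) * exp (1/4 * (cmod z)\<^sup>2)" using 1(3)[of z] by (simp add: mult.assoc)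
  qed auto
qed

lemma egrow_L2: assumes "egrow f" shows "f \<in> L2"
proof -
  have "integrable gauss (\<lambda>z. f z * cnj (f z))" by (intro egrow_integrable egrow_mult egrow_cnj assms)
  then have "integrable gauss (\<lambda>z. norm (f z * cnj (f z)))" by (rule integrable_norm)
  then show ?thesis using egrow_measurable[OF assms] by (simp add: L2_def norm_mult power2_eq_square)
qed

section \<open>Weyl operators\<close>

text \<open>The unitary translation by \<open>a\<close>: the modulus of the exponential turns the
  Gaussian weight at \<open>w\<close> into the one at \<open>w - a\<close>. The exponential is
  holomorphic in \<open>w\<close>, so polyanalyticity is preserved.\<close>

definition weyl :: "complex \<Rightarrow> (complex \<Rightarrow> complex) \<Rightarrow> complex \<Rightarrow> complex" where
  "weyl a f w = exp (w * cnj a - of_real ((cmod a)\<^sup>2 / 2)) * f (w - a)"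

lemma weyl_measurable [measurable (raw)]:
  assumes [measurable]: "f \<in> borel_measurable borel"
  shows "weyl a f \<in> borel_measurable borel"
  unfolding weyl_def[abs_def] by measurable

lemma norm_exp_weyl: "exp (- (cmod w)\<^sup>2) * (cmod (exp (w * cnj a - of_real ((cmod a)\<^sup>2 / 2))))\<^sup>2 = exp (- (cmod (w - a))\<^sup>2)"
proof -
  have "(cmod (exp (w * cnj a - of_real ((cmod a)\<^sup>2 / 2))))\<^sup>2 = exp (2 * Re (w * cnj a) - (cmod a)\<^sup>2)"
    unfolding norm_exp_eq_Re exp_double[symmetric] by (simp add: algebra_simps)
  then have "exp (- (cmod w)\<^sup>2) * (cmod (exp (w * cnj a - of_real ((cmod a)\<^sup>2 / 2))))\<^sup>2 = exp (- (cmod w)\<^sup>2 + (2 * Re (w * cnj a) - (cmod a)\<^sup>2))"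
    by (simp only: exp_add)
  also have "- (cmod w)\<^sup>2 + (2 * Re (w * cnj a) - (cmod a)\<^sup>2) = - (cmod (w - a))\<^sup>2"
    by (simp add: cmod_power2[unfolded power2_eq_square] power2_eq_square algebra_simps)
  finally show ?thesis .
qed

lemma weyl_cnj_weyl: "exp (- (cmod w)\<^sup>2) *\<^sub>R (weyl a f w * cnj (weyl a g w)) = exp (- (cmod (w - a))\<^sup>2) *\<^sub>R (f (w - a) * cnj (g (w - a)))"
proof -
  let ?e = "exp (w * cnj a - of_real ((cmod a)\<^sup>2 / 2))"
  have "exp (- (cmod w)\<^sup>2) *\<^sub>R (weyl a f w * cnj (weyl a g w)) = of_real (exp (- (cmod w)\<^sup>2)) * (?e * cnj ?e) * (f (w - a) * cnj (g (w - a)))"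
    by (simp add: weyl_def scaleR_conv_of_real mult_ac)
  also have "of_real (exp (- (cmod w)\<^sup>2)) * (?e * cnj ?e) = of_real (exp (- (cmod (w - a))\<^sup>2))"
    unfolding complex_norm_square[symmetric] of_real_mult[symmetric] norm_exp_weyl ..
  finally show ?thesis by (simp add: scaleR_conv_of_real)
qed

lemma ip_weyl:
  assumes [measurable]: "f \<in> borel_measurable borel" "g \<in> borel_measurable borel"
  shows "ip (weyl a f) (weyl a g) = ip f g"
proof -
  have [measurable]: "weyl a f \<in> borel_measurable borel" "weyl a g \<in> borel_measurable borel" by measurable
  have "ip (weyl a f) (weyl a g) = (\<integral>w. (1 / pi) *\<^sub>R (exp (- (cmod w)\<^sup>2) *\<^sub>R (weyl a f w * cnj (weyl a g w))) \<partial>lborel)"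
    unfolding ip_def by (subst integral_gauss) auto
  also have "\<dots> = (\<integral>w. (1 / pi) *\<^sub>R (exp (- (cmod (w + - a))\<^sup>2) *\<^sub>R (f (w + - a) * cnj (g (w + - a)))) \<partial>lborel)"
    unfolding weyl_cnj_weyl by simp
  also have "\<dots> = (\<integral>w. (1 / pi) *\<^sub>R (exp (- (cmod w)\<^sup>2) *\<^sub>R (f w * cnj (g w))) \<partial>lborel)"
    by (rule integral_lborel_shift[where f = "\<lambda>w. (1 / pi) *\<^sub>R (exp (- (cmod w)\<^sup>2) *\<^sub>R (f w * cnj (g w)))"]) measurable
  also have "\<dots> = ip f g" unfolding ip_def by (subst integral_gauss) auto
  finally show ?thesis .
qed

lemma weyl_L2: assumes "f \<in> L2" shows "weyl a f \<in> L2"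
proof -
  have [measurable]: "f \<in> borel_measurable borel" using assms by (rule L2_measurable)
  have e: "exp (- (cmod w)\<^sup>2) * (cmod (weyl a f w))\<^sup>2 = exp (- (cmod (w + - a))\<^sup>2) * (cmod (f (w + - a)))\<^sup>2" for w
    using norm_exp_weyl[of w a] by (simp add: weyl_def norm_mult power_mult_distrib mult.assoc[symmetric])
  have "integrable lborel (\<lambda>w. (exp (- (cmod w)\<^sup>2) / pi) *\<^sub>R (cmod (f w))\<^sup>2)"
    using L2_integrable[OF assms] by (subst (asm) integrable_gauss_iff) auto
  then have "integrable lborel (\<lambda>w. (exp (- (cmod (w + - a))\<^sup>2) / pi) *\<^sub>R (cmod (f (w + - a)))\<^sup>2)"
    by (subst integrable_lborel_shift[where f = "\<lambda>w. (exp (- (cmod w)\<^sup>2) / pi) *\<^sub>R (cmod (f w))\<^sup>2"]) auto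
  also have "(\<lambda>w. (exp (- (cmod (w + - a))\<^sup>2) / pi) *\<^sub>R (cmod (f (w + - a)))\<^sup>2) = (\<lambda>w. (exp (- (cmod w)\<^sup>2) / pi) *\<^sub>R (cmod (weyl a f w))\<^sup>2)"
    using e by (auto simp: fun_eq_iff divide_simps)
  finally have "integrable gauss (\<lambda>w. (cmod (weyl a f w))\<^sup>2)"
    by (subst integrable_gauss_iff) auto
  then show ?thesis by (simp add: L2_def)
qed

lemma nrm_weyl: assumes "f \<in> borel_measurable borel" shows "nrm (weyl a f) = nrm f"
  using ip_weyl[OF assms assms, of a] unfolding ip_self of_real_eq_iff by simp

text \<open>A projective representation of the plane. The phase has modulus one and cancels when a
  translate enters both arguments of a sesquilinear form.\<close>

lemma weyl_weyl: "weyl a (weyl b f) w = exp (- \<i> * of_real (Im (a * cnj b))) * weyl (a + b) f w"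
proof -
  have "w * cnj a - of_real ((cmod a)\<^sup>2 / 2) + ((w - a) * cnj b - of_real ((cmod b)\<^sup>2 / 2)) =
     - \<i> * of_real (Im (a * cnj b)) + (w * cnj (a + b) - of_real ((cmod (a + b))\<^sup>2 / 2))"
    by (rule complex_eqI) (simp_all add: cmod_power2[unfolded power2_eq_square] power2_eq_square algebra_simps add_divide_distrib)
  then have "exp (w * cnj a - of_real ((cmod a)\<^sup>2 / 2)) * exp ((w - a) * cnj b - of_real ((cmod b)\<^sup>2 / 2)) =
     exp (- \<i> * of_real (Im (a * cnj b))) * exp (w * cnj (a + b) - of_real ((cmod (a + b))\<^sup>2 / 2))"
    unfolding exp_add[symmetric] by simp
  then show ?thesis by (simp only: weyl_def mult.assoc[symmetric] diff_diff_eq)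
qed

lemma weyl_minus_weyl [simp]: "weyl (- a) (weyl a f) = f" "weyl a (weyl (- a) f) = f"
  by (rule ext, simp add: weyl_weyl weyl_def[of 0])+

lemma ip_weyl_left:
  assumes [measurable]: "f \<in> borel_measurable borel" "g \<in> borel_measurable borel"
  shows "ip (weyl a f) g = ip f (weyl (- a) g)"
  using ip_weyl[of f "weyl (- a) g" a] by simp

section \<open>Polyanalytic functions\<close>

text \<open>A substitute for the condition on \<open>d_zbar\<close> that permits algebra without
  differentiation; \<open>polyan_d_zbar\<close> and \<open>polyan_if_d_zbar_0\<close> show the two
  equivalent for smooth functions.\<close>

definition polyan :: "nat \<Rightarrow> (complex \<Rightarrow> complex) \<Rightarrow> bool" where
  "polyan n F \<longleftrightarrow> (\<exists>h. (\<forall>i. h i holomorphic_on UNIV) \<and> F = (\<lambda>z. \<Sum>i<n. cnj z ^ i * h i z))"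

lemma polyan_I: "(\<And>i. h i holomorphic_on UNIV) \<Longrightarrow> polyan n (\<lambda>z. \<Sum>i<n. cnj z ^ i * h i z)"
  unfolding polyan_def by blast

lemma polyanE:
  assumes "polyan n F"
  obtains h where "\<And>i. h i holomorphic_on UNIV" "F = (\<lambda>z. \<Sum>i<n. cnj z ^ i * h i z)"
  using assms unfolding polyan_def by blast

lemma polyan_monomial:
  assumes "h holomorphic_on UNIV" "i < n"
  shows "polyan n (\<lambda>z. cnj z ^ i * h z)"
proof -
  have "(\<lambda>z. cnj z ^ i * h z) = (\<lambda>z. \<Sum>j<n. cnj z ^ j * (if j = i then h z else 0))"
    using assms(2) by (auto simp: fun_eq_iff if_distrib[of "\<lambda>x. _ * x"] sum.delta cong: if_cong)
  moreover have "(\<lambda>z. if j = i then h z else 0) holomorphic_on UNIV" for j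
    using assms(1) by (cases "j = i") auto
  ultimately show ?thesis using polyan_I[of "\<lambda>j z. if j = i then h z else 0" n] by simp
qed

lemma polyan_add: "polyan n F \<Longrightarrow> polyan n G \<Longrightarrow> polyan n (\<lambda>z. F z + G z)"
proof (elim polyanE)
  fix f g
  assume h: "\<And>i. f i holomorphic_on UNIV" "\<And>i. g i holomorphic_on UNIV"
    and "F = (\<lambda>z. \<Sum>i<n. cnj z ^ i * f i z)" "G = (\<lambda>z. \<Sum>i<n. cnj z ^ i * g i z)"
  then have "(\<lambda>z. F z + G z) = (\<lambda>z. \<Sum>i<n. cnj z ^ i * (f i z + g i z))"
    by (auto simp: fun_eq_iff distrib_left sum.distrib)
  then show ?thesis using polyan_I[of "\<lambda>i z. f i z + g i z" n] h by (auto intro: holomorphic_intros)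
qed

lemma polyan_mult:
  assumes "polyan n F" and e: "e holomorphic_on UNIV"
  shows "polyan n (\<lambda>z. e z * F z)"
proof -
  obtain f where h: "\<And>i. f i holomorphic_on UNIV" "F = (\<lambda>z. \<Sum>i<n. cnj z ^ i * f i z)"
    using polyanE[OF assms(1)] by metis
  then have "(\<lambda>z. e z * F z) = (\<lambda>z. \<Sum>i<n. cnj z ^ i * (e z * f i z))"
    by (auto simp: fun_eq_iff sum_distrib_left mult_ac)
  then show ?thesis using polyan_I[of "\<lambda>i z. e z * f i z" n] h e by (auto intro: holomorphic_intros)
qed

lemma polyan_scale: "polyan n F \<Longrightarrow> polyan n (\<lambda>z. c * F z)"
  by (rule polyan_mult) (auto intro: holomorphic_intros)

lemma polyan_0: "polyan n (\<lambda>z. 0)"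
  using polyan_I[of "\<lambda>_ _. 0" n] by simp

lemma polyan_0_iff: "polyan 0 F \<longleftrightarrow> F = (\<lambda>z. 0)"
  by (auto simp: polyan_def intro: exI[of _ "\<lambda>_ _. 0"])

lemma polyan_sum: "(\<And>i. i \<in> S \<Longrightarrow> polyan n (f i)) \<Longrightarrow> polyan n (\<lambda>z. \<Sum>i\<in>S. f i z)"
  by (induction S rule: infinite_finite_induct) (auto intro: polyan_add polyan_0)

lemma polyan_diff: "polyan n F \<Longrightarrow> polyan n G \<Longrightarrow> polyan n (\<lambda>z. F z - G z)"
  using polyan_add[of n F "\<lambda>z. (-1) * G z"] polyan_scale[of n G "-1"] by simp

lemma polyan_mono: "polyan n F \<Longrightarrow> n \<le> N \<Longrightarrow> polyan N F"
  by (elim polyanE) (auto intro!: polyan_sum polyan_monomial)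

lemma polyan_shift:
  assumes "polyan n F"
  shows "polyan n (\<lambda>z. F (z + a))"
proof -
  obtain f where h: "\<And>i. f i holomorphic_on UNIV" "F = (\<lambda>z. \<Sum>i<n. cnj z ^ i * f i z)"
    using polyanE[OF assms(1)] by metis
  have hs: "(\<lambda>z. f i (z + a)) holomorphic_on UNIV" for i
  proof -
    have "(\<lambda>z. z + a) holomorphic_on UNIV" by (intro holomorphic_intros)
    moreover have "f i holomorphic_on (\<lambda>z. z + a) ` UNIV" using h(1)[of i] holomorphic_on_subset by blast
    ultimately show ?thesis using holomorphic_on_compose[of "\<lambda>z. z + a" UNIV "f i"] by (simp add: o_def)
  qed
  have eq: "(\<lambda>z. F (z + a)) = (\<lambda>z. \<Sum>i<n. \<Sum>j\<le>i. of_nat (i choose j) * cnj a ^ (i - j) * (cnj z ^ j * f i (z + a)))"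
    unfolding h(2) complex_cnj_add binomial_ring
    by (intro ext sum.cong refl) (simp only: sum_distrib_right, simp add: mult_ac)
  show ?thesis unfolding eq by (intro polyan_sum polyan_scale polyan_monomial hs) auto
qed

section \<open>Derivatives of polyanalytic functions\<close>

lemma polyan_has_derivative:
  assumes h: "\<And>i. h i holomorphic_on UNIV"
  shows "((\<lambda>z. \<Sum>i<n. cnj z ^ i * h i z) has_derivative
     (\<lambda>v. (\<Sum>i<n. of_nat i * cnj z ^ (i - 1) * h i z) * cnj v + (\<Sum>i<n. cnj z ^ i * deriv (h i) z) * v)) (at z)"
proof -
  have d: "(h i has_derivative (\<lambda>v. deriv (h i) z * v)) (at z)" for i
    using holomorphic_derivI[OF h, of z] by (simp add: has_field_derivative_def)
  have c: "(cnj has_derivative cnj) (at z)" by (rule bounded_linear.has_derivative) (auto intro: bounded_linear_cnj derivative_intros)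
  have p: "((\<lambda>z. cnj z ^ i) has_derivative (\<lambda>v. of_nat i * cnj z ^ (i - 1) * cnj v)) (at z)" for i
    using has_derivative_power[OF c, of i] by (simp add: mult_ac)
  have "((\<lambda>z. \<Sum>i<n. cnj z ^ i * h i z) has_derivative
     (\<lambda>v. \<Sum>i<n. cnj z ^ i * (deriv (h i) z * v) + of_nat i * cnj z ^ (i - 1) * cnj v * h i z)) (at z)"
    by (intro has_derivative_sum has_derivative_mult p d)
  then show ?thesis by (simp add: sum.distrib sum_distrib_left sum_distrib_right mult_ac add.commute)
qed

lemma polyan_differentiable: "polyan n F \<Longrightarrow> F differentiable (at z)"
  unfolding differentiable_def by (elim polyanE) (simp only:, rule exI, rule polyan_has_derivative)

text \<open>The real derivative is \<open>A z * cnj v + B z * v\<close>, so \<open>A\<close> and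
  \<open>B\<close> are the two Wirtinger derivatives; the partial derivatives are its values at
  \<open>v = 1\<close> and \<open>v = \<i>\<close>.\<close>

lemma polyan_partials_explicit:
  fixes n :: nat and h :: "nat \<Rightarrow> complex \<Rightarrow> complex"
  assumes h: "\<And>i. h i holomorphic_on UNIV"
  defines "F \<equiv> \<lambda>z. \<Sum>i<n. cnj z ^ i * h i z"
  defines "A \<equiv> \<lambda>z. \<Sum>i<n. of_nat i * cnj z ^ (i - 1) * h i z"
  defines "B \<equiv> \<lambda>z. \<Sum>i<n. cnj z ^ i * deriv (h i) z"
  shows "d_x F = (\<lambda>z. A z + B z)" "d_y F = (\<lambda>z. (- \<i>) * A z + \<i> * B z)" "d_zbar F = A"
proof -
  have fd: "frechet_derivative F (at z) = (\<lambda>v. A z * cnj v + B z * v)" for z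
    unfolding F_def A_def B_def by (rule frechet_derivative_at[OF polyan_has_derivative[OF h], symmetric])
  show 1: "d_x F = (\<lambda>z. A z + B z)" by (auto simp: d_x_def fd)
  show 2: "d_y F = (\<lambda>z. (- \<i>) * A z + \<i> * B z)" by (auto simp: d_y_def fd mult.commute)
  show "d_zbar F = A" by (auto simp: d_zbar_def 1 2 fun_eq_iff algebra_simps)
qed

lemma polyan_zbar_part:
  assumes h: "\<And>i. h i holomorphic_on UNIV"
  shows "polyan (n - 1) (\<lambda>z. \<Sum>i<n. of_nat i * cnj z ^ (i - 1) * h i z)"
  unfolding mult.assoc
proof (intro polyan_sum)
  fix i assume "i \<in> {..<n}"
  then show "polyan (n - 1) (\<lambda>z. of_nat i * (cnj z ^ (i - 1) * h i z))"
    using h by (cases i) (auto intro!: polyan_scale polyan_monomial polyan_0)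
qed

lemma polyan_partials:
  assumes "polyan n F"
  shows "polyan n (d_x F)" "polyan n (d_y F)" "polyan (n - 1) (d_zbar F)"
proof -
  obtain h where h: "\<And>i. h i holomorphic_on UNIV" "F = (\<lambda>z. \<Sum>i<n. cnj z ^ i * h i z)"
    using polyanE[OF assms(1)] by metis
  have A: "polyan (n - 1) (\<lambda>z. \<Sum>i<n. of_nat i * cnj z ^ (i - 1) * h i z)" by (rule polyan_zbar_part[OF h(1)])
  then have A': "polyan n (\<lambda>z. \<Sum>i<n. of_nat i * cnj z ^ (i - 1) * h i z)" by (rule polyan_mono) simp
  have B: "polyan n (\<lambda>z. \<Sum>i<n. cnj z ^ i * deriv (h i) z)"
    by (intro polyan_I holomorphic_deriv h) simp
  show "polyan n (d_x F)" unfolding h(2) polyan_partials_explicit(1)[OF h(1)] by (rule polyan_add[OF A' B])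
  show "polyan n (d_y F)" unfolding h(2) polyan_partials_explicit(2)[OF h(1)] by (intro polyan_add polyan_scale A' B)
  show "polyan (n - 1) (d_zbar F)" unfolding h(2) polyan_partials_explicit(3)[OF h(1)] by (rule A)
qed

lemma polyan_continuous: "polyan n F \<Longrightarrow> continuous_on UNIV F"
  using polyan_differentiable differentiable_imp_continuous_within
  by (metis continuous_at_imp_continuous_on)

lemma polyan_smooth: "polyan n F \<Longrightarrow> smooth F"
  unfolding smooth_def
proof
  fix k show "polyan n F \<Longrightarrow> C_diff k F"
    by (induction k arbitrary: F) (auto intro: polyan_continuous polyan_differentiable polyan_partials)
qed

lemma polyan_d_zbar: "polyan n F \<Longrightarrow> (d_zbar ^^ n) F = (\<lambda>z. 0)"
proof (induction n arbitrary: F)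
  case (Suc n)
  have "(d_zbar ^^ Suc n) F = (d_zbar ^^ n) (d_zbar F)" by (simp add: funpow_swap1)
  then show ?case using Suc.IH[of "d_zbar F"] polyan_partials(3)[OF Suc.prems] by simp
qed (simp add: polyan_0_iff)

section \<open>Smooth functions annihilated by powers of \<open>d_zbar\<close>\<close>

lemma d_x_d_y_linear:
  assumes "f differentiable (at z)" "g differentiable (at z)"
  shows "d_x (\<lambda>z. a * f z + b * g z) z = a * d_x f z + b * d_x g z"
    and "d_y (\<lambda>z. a * f z + b * g z) z = a * d_y f z + b * d_y g z"
proof -
  have "((\<lambda>z. a * f z + b * g z) has_derivative (\<lambda>v. a * frechet_derivative f (at z) v + b * frechet_derivative g (at z) v)) (at z)"
    using assms[unfolded frechet_derivative_works] by (intro derivative_intros)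
  then have fd: "frechet_derivative (\<lambda>z. a * f z + b * g z) (at z) = (\<lambda>v. a * frechet_derivative f (at z) v + b * frechet_derivative g (at z) v)"
    by (rule frechet_derivative_at[symmetric])
  show "d_x (\<lambda>z. a * f z + b * g z) z = a * d_x f z + b * d_x g z"
    and "d_y (\<lambda>z. a * f z + b * g z) z = a * d_y f z + b * d_y g z"
    by (simp_all add: d_x_def d_y_def fd)
qed

lemma C_diff_linear: "C_diff n f \<Longrightarrow> C_diff n g \<Longrightarrow> C_diff n (\<lambda>z. a * f z + b * g z)"
proof (induction n arbitrary: f g)
  case 0 then show ?case by (auto intro!: continuous_intros)
next
  case (Suc n)
  then have d: "f differentiable (at z)" "g differentiable (at z)" for z by auto
  have "d_x (\<lambda>z. a * f z + b * g z) = (\<lambda>z. a * d_x f z + b * d_x g z)"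
    "d_y (\<lambda>z. a * f z + b * g z) = (\<lambda>z. a * d_y f z + b * d_y g z)"
    using d_x_d_y_linear[OF d] by (auto simp: fun_eq_iff)
  then show ?case using Suc d by (auto intro!: derivative_intros)
qed

lemma smooth_d_zbar: "smooth F \<Longrightarrow> smooth (d_zbar F)"
proof -
  assume F: "smooth F"
  have "C_diff n (d_x F)" "C_diff n (d_y F)" for n
    using F[unfolded smooth_def, rule_format, of "Suc n"] by auto
  then have "C_diff n (\<lambda>z. (1/2) * d_x F z + (\<i>/2) * d_y F z)" for n by (intro C_diff_linear)
  moreover have "d_zbar F = (\<lambda>z. (1/2) * d_x F z + (\<i>/2) * d_y F z)" by (simp add: d_zbar_def fun_eq_iff field_simps)
  ultimately show ?thesis by (simp add: smooth_def)
qed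

text \<open>The Cauchy-Riemann equation amounts to \<open>A \<i> = \<i> * A 1\<close> for the real
  derivative \<open>A\<close>, which makes \<open>A\<close> complex linear.\<close>

lemma holomorphic_if_d_zbar_0:
  assumes d: "\<And>z. f differentiable (at z)" and 0: "\<And>z. d_zbar f z = 0"
  shows "f holomorphic_on UNIV"
  unfolding holomorphic_on_def
proof (intro ballI)
  fix z
  define A where "A = frechet_derivative f (at z)"
  have A: "(f has_derivative A) (at z)" using d[of z] unfolding A_def frechet_derivative_works .
  then have lin: "linear A" by (simp add: has_derivative_linear)
  have "A 1 + \<i> * A \<i> = 0" using 0[of z] by (simp add: d_zbar_def d_x_def d_y_def A_def)
  then have "\<i> * (A 1 + \<i> * A \<i>) = 0" by simp
  then have Ai: "A \<i> = \<i> * A 1" by (simp add: distrib_left mult.assoc[symmetric])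
  have "A v = A 1 * v" for v
  proof -
    have "A v = A (Re v *\<^sub>R 1 + Im v *\<^sub>R \<i>)" by (simp add: scaleR_conv_of_real complex_eq[symmetric] mult.commute)
    also have "\<dots> = Re v *\<^sub>R A 1 + Im v *\<^sub>R A \<i>" by (simp only: linear_add[OF lin] linear_scale[OF lin])
    also have "\<dots> = A 1 * (of_real (Re v) + \<i> * of_real (Im v))"
      unfolding Ai by (simp add: scaleR_conv_of_real algebra_simps)
    finally show ?thesis by (simp add: complex_eq[symmetric])
  qed
  then have "(f has_field_derivative A 1) (at z)" unfolding has_field_derivative_def using A by (metis ext)
  then show "f field_differentiable at z within UNIV" by (auto simp: field_differentiable_def)
qed

text \<open>Integrating \<open>d_zbar F\<close> term by term in \<open>cnj z\<close> gives a
  polyanalytic \<open>P\<close> with the same \<open>d_zbar\<close> as \<open>F\<close>. The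
  difference is entire and joins the terms of \<open>P\<close> as one of order 0 in
  \<open>cnj z\<close>.\<close>

lemma polyan_if_d_zbar_0: "smooth F \<Longrightarrow> (\<And>z. (d_zbar ^^ n) F z = 0) \<Longrightarrow> polyan n F"
proof (induction n arbitrary: F)
  case 0
  then show ?case by (simp add: polyan_0_iff fun_eq_iff)
next
  case (Suc n)
  have "polyan n (d_zbar F)"
    using Suc.prems by (intro Suc.IH smooth_d_zbar) (auto simp: funpow_swap1)
  then obtain h where h: "\<And>i. h i holomorphic_on UNIV" "d_zbar F = (\<lambda>z. \<Sum>i<n. cnj z ^ i * h i z)"
    using polyanE by metis
  define k where "k i z = (if i = 0 then 0 else h (i - 1) z / of_nat i)" for i z
  have k: "k i holomorphic_on UNIV" for i
    unfolding k_def using h(1) by (cases "i = 0") (auto intro!: holomorphic_intros)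
  define P where "P = (\<lambda>z. \<Sum>i<Suc n. cnj z ^ i * k i z)"
  have P: "polyan (Suc n) P" unfolding P_def by (rule polyan_I[OF k])
  have dP: "d_zbar P = d_zbar F"
    unfolding P_def polyan_partials_explicit(3)[OF k] h(2)
    by (subst sum.lessThan_Suc_shift) (simp add: k_def del: of_nat_Suc)
  define G where "G = (\<lambda>z. 1 * F z + (-1) * P z)"
  have Fd: "F differentiable (at z)" for z using Suc.prems(1)[unfolded smooth_def, rule_format, of 1] by simp
  have "d_zbar G z = 0" for z
  proof -
    have "d_zbar G z = d_zbar F z - d_zbar P z"
      unfolding d_zbar_def G_def d_x_d_y_linear[OF Fd polyan_differentiable[OF P]] by (simp add: field_simps)
    then show ?thesis using dP by simp
  qed
  moreover have "G differentiable (at z)" for z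
    unfolding G_def by (intro derivative_intros Fd polyan_differentiable[OF P])
  ultimately have G: "G holomorphic_on UNIV" by (intro holomorphic_if_d_zbar_0)
  have "polyan (Suc n) (\<lambda>z. cnj z ^ 0 * G z + P z)"
    by (intro polyan_add P polyan_monomial G) simp
  moreover have "(\<lambda>z. cnj z ^ 0 * G z + P z) = F" by (auto simp: G_def)
  ultimately show ?case by simp
qed

lemma fock_iff: "f \<in> fock n \<longleftrightarrow> f \<in> L2 \<and> polyan n f"
  using polyan_smooth[of n f] polyan_d_zbar[of n f] polyan_if_d_zbar_0[of f n] by (auto simp: fock_def)

section \<open>Generating functions of the true Fock spaces\<close>

lemma AE_zero_continuous:
  fixes f :: "complex \<Rightarrow> complex"
  assumes c: "continuous_on UNIV f" and ae: "AE z in lborel. f z = 0"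
  shows "f z = 0"
proof (rule ccontr)
  assume nz: "f z \<noteq> 0"
  define S where "S = {z. f z \<noteq> 0}"
  have o: "open S"
  proof -
    have "S = f -` (- {0})" by (auto simp: S_def)
    then show ?thesis using continuous_open_vimage[of "- {0}" f] c by (metis open_Compl closed_singleton open_vimage)
  qed
  have "S \<in> null_sets lborel"
    using ae AE_iff_null_sets[of S lborel] o by (auto simp: S_def)
  then have "negligible S"
    by (simp add: negligible_iff_null_sets null_sets_completionI)
  then show False using open_not_negligible[OF o] nz by (auto simp: S_def)
qed

text \<open>\<open>psi m c\<close> is a multiple of the translate by \<open>weyl c\<close> of \<open>cnj w ^ m\<close>. It is antiholomorphic in
  \<open>c\<close>, and the functions \<open>gg m j\<close> are its Taylor coefficients in \<open>cnj c\<close>.\<close>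

definition psi :: "nat \<Rightarrow> complex \<Rightarrow> complex \<Rightarrow> complex" where
  "psi m c w = (cnj w - cnj c) ^ m * exp (w * cnj c)"

definition gg :: "nat \<Rightarrow> nat \<Rightarrow> complex \<Rightarrow> complex" where
  "gg m j w = (\<Sum>i\<le>m. if i \<le> j then of_nat (m choose i) * (-1) ^ i * cnj w ^ (m - i) * w ^ (j - i) / fact (j - i) else 0)"

text \<open>The binomial theorem for the power, multiplied by the exponential series. The general
  field serves twice: for \<open>psi\<close> over the complex numbers and for its real
  majorant.\<close>

lemma generating_sums:
  fixes b s w \<eta> :: "'a :: {real_normed_field, banach}"
  shows "(\<lambda>j. \<eta> ^ j * (\<Sum>i\<le>m. if i \<le> j then of_nat (m choose i) * s ^ i * b ^ (m - i) * w ^ (j - i) / fact (j - i) else 0))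
     sums ((b + s * \<eta>) ^ m * exp (w * \<eta>))"
proof -
  have 1: "(\<lambda>j. if i \<le> j then \<eta> ^ j * (w ^ (j - i) / fact (j - i)) else 0) sums (\<eta> ^ i * exp (w * \<eta>))" for i
  proof -
    have "(\<lambda>n. \<eta> ^ i * ((w * \<eta>) ^ n /\<^sub>R fact n)) sums (\<eta> ^ i * exp (w * \<eta>))"
      by (intro sums_mult exp_converges)
    moreover have "\<eta> ^ i * ((w * \<eta>) ^ n /\<^sub>R fact n) = \<eta> ^ (n + i) * (w ^ n / fact n)" for n
      by (simp add: power_mult_distrib power_add scaleR_conv_of_real divide_inverse mult_ac)
    ultimately have "(\<lambda>n. if i \<le> n + i then \<eta> ^ (n + i) * (w ^ (n + i - i) / fact (n + i - i)) else 0) sums (\<eta> ^ i * exp (w * \<eta>))"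
      by simp
    then show ?thesis
      using sums_iff_shift[of "\<lambda>j. if i \<le> j then \<eta> ^ j * (w ^ (j - i) / fact (j - i)) else 0" i] by simp
  qed
  have "(\<lambda>j. \<Sum>i\<le>m. (of_nat (m choose i) * s ^ i * b ^ (m - i)) * (if i \<le> j then \<eta> ^ j * (w ^ (j - i) / fact (j - i)) else 0))
     sums (\<Sum>i\<le>m. (of_nat (m choose i) * s ^ i * b ^ (m - i)) * (\<eta> ^ i * exp (w * \<eta>)))"
    by (intro sums_sum sums_mult 1)
  also have "(\<Sum>i\<le>m. (of_nat (m choose i) * s ^ i * b ^ (m - i)) * (\<eta> ^ i * exp (w * \<eta>))) = (s * \<eta> + b) ^ m * exp (w * \<eta>)"
    unfolding binomial_ring sum_distrib_right by (intro sum.cong refl) (simp add: power_mult_distrib mult_ac)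
  also have "(\<lambda>j. \<Sum>i\<le>m. (of_nat (m choose i) * s ^ i * b ^ (m - i)) * (if i \<le> j then \<eta> ^ j * (w ^ (j - i) / fact (j - i)) else 0)) =
     (\<lambda>j. \<eta> ^ j * (\<Sum>i\<le>m. if i \<le> j then of_nat (m choose i) * s ^ i * b ^ (m - i) * w ^ (j - i) / fact (j - i) else 0))"
    unfolding sum_distrib_left by (intro ext sum.cong refl) (auto simp: mult_ac)
  finally show ?thesis by (simp add: add.commute)
qed

lemma psi_sums: "(\<lambda>j. cnj c ^ j * gg m j w) sums psi m c w"
  using generating_sums[of "cnj c" m "-1" "cnj w" w] by (simp add: gg_def psi_def)

text \<open>The generating function with all signs made positive. At radius
  \<open>r = cmod c\<close> it dominates \<open>psi m c\<close>, all partial sums of its expansion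
  and each single term, which makes it the common bound for dominated convergence.\<close>

definition majorant :: "nat \<Rightarrow> real \<Rightarrow> real \<Rightarrow> real" where "majorant m r x = (x + r) ^ m * exp (x * r)"

lemma gg_majorant:
  assumes r: "r \<ge> 0"
  shows "summable (\<lambda>j. r ^ j * cmod (gg m j w))" and "(\<Sum>j. r ^ j * cmod (gg m j w)) \<le> majorant m r (cmod w)"
proof -
  define G where "G j = (\<Sum>i\<le>m. if i \<le> j then real (m choose i) * 1 ^ i * cmod w ^ (m - i) * cmod w ^ (j - i) / fact (j - i) else 0)" for j
  have s: "(\<lambda>j. r ^ j * G j) sums majorant m r (cmod w)"
    using generating_sums[of r m 1 "cmod w" "cmod w"] by (simp add: G_def majorant_def)
  have le: "cmod (gg m j w) \<le> G j" for j
    unfolding gg_def G_def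
    by (intro order_trans[OF norm_sum] sum_mono) (auto simp: norm_mult norm_divide norm_power)
  have le': "r ^ j * cmod (gg m j w) \<le> r ^ j * G j" for j using le r by (intro mult_left_mono) auto
  show sm: "summable (\<lambda>j. r ^ j * cmod (gg m j w))"
    by (rule summable_comparison_test'[OF sums_summable[OF s]]) (use le' r in auto)
  show "(\<Sum>j. r ^ j * cmod (gg m j w)) \<le> majorant m r (cmod w)"
    using suminf_le[OF le' sm sums_summable[OF s]] sums_unique[OF s] by simp
qed

lemma majorant_nonneg: "r \<ge> 0 \<Longrightarrow> x \<ge> 0 \<Longrightarrow> majorant m r x \<ge> 0" by (simp add: majorant_def)

lemma gg_partial_majorant: "cmod (\<Sum>j<N. cnj c ^ j * gg m j w) \<le> majorant m (cmod c) (cmod w)"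
proof -
  have "cmod (\<Sum>j<N. cnj c ^ j * gg m j w) \<le> (\<Sum>j<N. cmod c ^ j * cmod (gg m j w))"
    by (rule order_trans[OF norm_sum]) (simp add: norm_mult norm_power)
  also have "\<dots> \<le> (\<Sum>j. cmod c ^ j * cmod (gg m j w))"
    by (rule sum_le_suminf[OF gg_majorant(1)]) auto
  also have "\<dots> \<le> majorant m (cmod c) (cmod w)" by (rule gg_majorant(2)) simp
  finally show ?thesis .
qed

lemma gg_single_majorant: "r \<ge> 0 \<Longrightarrow> r ^ j * cmod (gg m j w) \<le> majorant m r (cmod w)"
  using sum_le_suminf[OF gg_majorant(1), of r "{j}" m w] gg_majorant(2)[of r m w] by simp

lemma psi_majorant: "cmod (psi m c w) \<le> majorant m (cmod c) (cmod w)"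
proof -
  have "cmod (cnj w - cnj c) \<le> cmod w + cmod c"
    using norm_triangle_ineq4[of "cnj w" "cnj c"] by simp
  then have "cmod (cnj w - cnj c) ^ m \<le> (cmod w + cmod c) ^ m" by (intro power_mono) auto
  moreover have "cmod (exp (w * cnj c)) \<le> exp (cmod w * cmod c)"
    using norm_exp[of "w * cnj c"] by (simp add: norm_mult)
  ultimately show ?thesis unfolding psi_def majorant_def norm_mult norm_power by (intro mult_mono) auto
qed

lemma egrow_majorant: assumes "r \<ge> 0" shows "egrow (\<lambda>w. of_real (majorant m r (cmod w)))"
proof (rule egrowI[where A = "exp (real m * r)" and R = "real m + r"])
  fix w :: complex
  have "(cmod w + r) ^ m \<le> exp (cmod w + r) ^ m"
    using assms exp_ge_add_one_self[of "cmod w + r"] by (intro power_mono) (linarith, simp)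
  also have "\<dots> = exp (real m * (cmod w + r))" by (simp add: exp_of_nat_mult)
  finally have "majorant m r (cmod w) \<le> exp (real m * (cmod w + r)) * exp (cmod w * r)"
    unfolding majorant_def by (intro mult_right_mono) auto
  also have "\<dots> = exp (real m * r) * exp ((real m + r) * cmod w)"
    unfolding exp_add[symmetric] by (simp add: algebra_simps)
  finally show "cmod (complex_of_real (majorant m r (cmod w))) \<le> exp (real m * r) * exp ((real m + r) * cmod w)"
    using majorant_nonneg[OF assms, of "cmod w" m] by simp
qed (simp add: majorant_def)

lemma egrow_psi: "egrow (psi m c)"
  unfolding psi_def[abs_def] by (intro egrow_mult egrow_power egrow_diff egrow_cnj egrow_exp) auto

lemma egrow_gg: "egrow (gg m j)"
proof -
  have "egrow (\<lambda>w. if i \<le> j then of_nat (m choose i) * (-1) ^ i * cnj w ^ (m - i) * w ^ (j - i) / fact (j - i) else 0)" for i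
  proof (cases "i \<le> j")
    case True
    have "egrow (\<lambda>w. (of_nat (m choose i) * (-1) ^ i / fact (j - i)) * (cnj w ^ (m - i) * w ^ (j - i)))"
      by (intro egrow_mult egrow_power egrow_cnj) auto
    then show ?thesis using True by (simp add: mult_ac)
  qed simp
  then show ?thesis unfolding gg_def[abs_def] by (rule egrow_sum)
qed

lemmas psi_L2 = egrow_L2[OF egrow_psi] and gg_L2 = egrow_L2[OF egrow_gg]

definition ppart :: "nat \<Rightarrow> complex \<Rightarrow> nat \<Rightarrow> complex \<Rightarrow> complex" where
  "ppart m c N w = (\<Sum>j<N. cnj c ^ j * gg m j w)"

lemma ppart_L2: "ppart m c N \<in> L2"
  unfolding ppart_def[abs_def] by (intro L2_sum L2_scale gg_L2)

text \<open>Dominated convergence, with twice the majorant, upgrades the pointwise expansion to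
  convergence in norm.\<close>

lemma psi_approx: "(\<lambda>N. nrm (\<lambda>w. psi m c w - ppart m c N w)) \<longlonglongrightarrow> 0"
proof -
  have [measurable]: "psi m c \<in> borel_measurable borel" "ppart m c N \<in> borel_measurable borel" for N
    using egrow_measurable[OF egrow_psi] L2_measurable[OF ppart_L2] by auto
  have "(\<lambda>N. \<integral>w. (cmod (psi m c w - ppart m c N w))\<^sup>2 \<partial>gauss) \<longlonglongrightarrow> (\<integral>w. 0 \<partial>gauss)"
  proof (rule integral_dominated_convergence)
    show "integrable gauss (\<lambda>w. 4 * (cmod (complex_of_real (majorant m (cmod c) (cmod w))))\<^sup>2)"
      by (intro integrable_mult_right L2_integrable egrow_L2 egrow_majorant) auto
    show "AE w in gauss. (\<lambda>N. (cmod (psi m c w - ppart m c N w))\<^sup>2) \<longlonglongrightarrow> 0"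
    proof (rule AE_I2)
      fix w
      have "(\<lambda>N. ppart m c N w) \<longlonglongrightarrow> psi m c w" using psi_sums[of c m w] by (simp add: sums_def ppart_def)
      then have "(\<lambda>N. (cmod (psi m c w - ppart m c N w))\<^sup>2) \<longlonglongrightarrow> (cmod (psi m c w - psi m c w))\<^sup>2"
        by (intro tendsto_intros)
      then show "(\<lambda>N. (cmod (psi m c w - ppart m c N w))\<^sup>2) \<longlonglongrightarrow> 0" by simp
    qed
    show "AE w in gauss. norm ((cmod (psi m c w - ppart m c N w))\<^sup>2) \<le> 4 * (cmod (complex_of_real (majorant m (cmod c) (cmod w))))\<^sup>2" for N
    proof (rule AE_I2)
      fix w
      have "cmod (psi m c w - ppart m c N w) \<le> 2 * majorant m (cmod c) (cmod w)"
        using norm_triangle_ineq4[of "psi m c w" "ppart m c N w"] psi_majorant[of m c w] gg_partial_majorant[where m = m and c = c and w = w and N = N]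
        unfolding ppart_def by linarith
      then have "(cmod (psi m c w - ppart m c N w))\<^sup>2 \<le> (2 * majorant m (cmod c) (cmod w))\<^sup>2" by (intro power_mono) auto
      then show "norm ((cmod (psi m c w - ppart m c N w))\<^sup>2) \<le> 4 * (cmod (complex_of_real (majorant m (cmod c) (cmod w))))\<^sup>2"
        by (simp add: power_mult_distrib)
    qed
  qed measurable
  then have "(\<lambda>N. (nrm (\<lambda>w. psi m c w - ppart m c N w))\<^sup>2) \<longlonglongrightarrow> 0" by (simp add: nrm_sq)
  then have "(\<lambda>N. sqrt ((nrm (\<lambda>w. psi m c w - ppart m c N w))\<^sup>2)) \<longlonglongrightarrow> sqrt 0" by (intro tendsto_real_sqrt)
  then show ?thesis by simp
qed

text \<open>Convergence in norm passes to inner products. As \<open>ip\<close> is conjugate linear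
  on the right, powers of \<open>cnj c\<close> become powers of \<open>c\<close>, so the pairing is
  an entire function of \<open>c\<close>.\<close>

lemma psi_ip_sums: assumes v: "v \<in> L2" shows "(\<lambda>j. c ^ j * ip v (gg m j)) sums ip v (psi m c)"
proof -
  have "ip v (psi m c) - ip v (ppart m c N) = ip v (\<lambda>w. psi m c w - ppart m c N w)" for N
    using v by (simp add: ip_diff_right psi_L2 ppart_L2)
  then have b: "cmod (ip v (psi m c) - ip v (ppart m c N)) \<le> nrm v * nrm (\<lambda>w. psi m c w - ppart m c N w)" for N
    using ip_bound[OF v L2_diff[OF psi_L2 ppart_L2]] by simp
  have "(\<lambda>N. ip v (psi m c) - ip v (ppart m c N)) \<longlonglongrightarrow> 0"
    by (rule Lim_null_comparison[OF always_eventually[OF allI[OF b]]]) (use tendsto_mult_left[OF psi_approx, of "nrm v"] in simp)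
  then have "(\<lambda>N. ip v (psi m c) - (ip v (psi m c) - ip v (ppart m c N))) \<longlonglongrightarrow> ip v (psi m c) - 0" by (intro tendsto_intros)
  moreover have "ip v (ppart m c N) = (\<Sum>j<N. c ^ j * ip v (gg m j))" for N
    unfolding ppart_def[abs_def] using v by (simp add: ip_sum_right gg_L2)
  ultimately show ?thesis by (simp add: sums_def)
qed

lemma power_series_zero:
  fixes c :: "nat \<Rightarrow> complex"
  assumes "\<And>z. (\<lambda>n. c n * z ^ n) sums 0"
  shows "c n = 0"
proof (rule power_series_zero_pos)
  fix R :: real assume R: "R \<ge> 0"
  have "summable (\<lambda>n. c n * (of_real (R + 1)) ^ n)" using assms sums_summable by blast
  then have "summable (\<lambda>n. norm (c n * (of_real R) ^ n))" by (rule powser_insidea) (use R in simp)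
  then show "summable (\<lambda>n. norm (c n) * R ^ n)" using R by (simp add: norm_mult norm_power)
qed (use assms sums_unique in \<open>metis\<close>)

lemma ip_gg_zero:
  assumes v: "v \<in> L2" and z: "\<And>c. ip v (psi m c) = 0"
  shows "ip v (gg m j) = 0"
  by (rule power_series_zero) (use psi_ip_sums[OF v, of _ m] z in \<open>simp add: mult.commute\<close>)

text \<open>Translations permute the functions \<open>psi m c\<close> up to scalars, so
  orthogonality to all of them is invariant under the Weyl operators.\<close>

lemma weyl_psi: "weyl a (psi m c) = (\<lambda>w. exp (- of_real ((cmod a)\<^sup>2 / 2) - a * cnj c) * psi m (a + c) w)"
proof
  fix w
  have "exp (w * cnj a - of_real ((cmod a)\<^sup>2 / 2)) * exp ((w - a) * cnj c) = exp (- of_real ((cmod a)\<^sup>2 / 2) - a * cnj c) * exp (w * cnj (a + c))"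
    unfolding exp_add[symmetric] by (simp add: algebra_simps)
  then show "weyl a (psi m c) w = exp (- of_real ((cmod a)\<^sup>2 / 2) - a * cnj c) * psi m (a + c) w"
    by (simp add: weyl_def psi_def diff_diff_eq mult_ac)
qed

section \<open>True Fock spaces\<close>

text \<open>The first level fits the general pattern because \<open>fock 0\<close> contains only the
  zero function, which makes the orthogonality void there.\<close>

lemma true_fock_iff: "f \<in> true_fock (Suc m) \<longleftrightarrow> f \<in> L2 \<and> polyan (Suc m) f \<and> (\<forall>g\<in>fock m. ip f g = 0)"
proof (cases "m = 0")
  case True
  have "g = (\<lambda>z. 0)" if "g \<in> fock 0" for g using that by (simp add: fock_iff polyan_0_iff)
  then have "ip f g = 0" if "g \<in> fock 0" for g using that by (metis ip_0_right)
  then show ?thesis using True by (simp add: true_fock_def fock_iff[of f])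
qed (simp add: true_fock_def fock_iff)

lemma true_fock_L2: "f \<in> true_fock (Suc m) \<Longrightarrow> f \<in> L2" by (simp add: true_fock_iff)
lemma fock_L2: "f \<in> fock m \<Longrightarrow> f \<in> L2" by (simp add: fock_iff)

lemma true_fock_scale: "f \<in> true_fock (Suc m) \<Longrightarrow> (\<lambda>z. c * f z) \<in> true_fock (Suc m)"
  by (simp add: true_fock_iff L2_scale polyan_scale ip_scale_left)
lemma true_fock_add: "f \<in> true_fock (Suc m) \<Longrightarrow> g \<in> true_fock (Suc m) \<Longrightarrow> (\<lambda>z. f z + g z) \<in> true_fock (Suc m)"
  by (simp add: true_fock_iff L2_add polyan_add ip_add_left fock_L2)
lemma true_fock_diff: "f \<in> true_fock (Suc m) \<Longrightarrow> g \<in> true_fock (Suc m) \<Longrightarrow> (\<lambda>z. f z - g z) \<in> true_fock (Suc m)"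
  by (simp add: true_fock_iff L2_diff polyan_diff ip_diff_left fock_L2)
lemma true_fock_0: "(\<lambda>z. 0) \<in> true_fock (Suc m)"
  by (simp add: true_fock_iff L2_0 polyan_0)
lemma true_fock_sum: "(\<And>i. i \<in> S \<Longrightarrow> f i \<in> true_fock (Suc m)) \<Longrightarrow> (\<lambda>z. \<Sum>i\<in>S. f i z) \<in> true_fock (Suc m)"
  by (induction S rule: infinite_finite_induct) (auto intro: true_fock_add true_fock_0)

lemma weyl_polyan: assumes "polyan n f" shows "polyan n (weyl a f)"
proof -
  have "polyan n (\<lambda>w. exp (w * cnj a - of_real ((cmod a)\<^sup>2 / 2)) * f (w + - a))"
    by (intro polyan_mult polyan_shift assms holomorphic_intros)
  then show ?thesis by (simp add: weyl_def[abs_def])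
qed

lemma weyl_fock: "f \<in> fock n \<Longrightarrow> weyl a f \<in> fock n"
  by (simp add: fock_iff weyl_L2 weyl_polyan)

lemma weyl_true_fock: "f \<in> true_fock (Suc m) \<Longrightarrow> weyl a f \<in> true_fock (Suc m)"
  using weyl_fock by (simp add: true_fock_iff weyl_L2 weyl_polyan ip_weyl_left L2_measurable fock_L2)

text \<open>By rotation invariance of \<open>gauss\<close> and Fubini an integrand may be replaced
  by its circle average. Pairings with radial functions thereby see only circle means.\<close>

lemma rotation_mean:
  fixes F :: "complex \<Rightarrow> complex"
  assumes F: "integrable gauss F"
  shows "integral\<^sup>L gauss F = (\<integral>w. (\<integral>t. F (ucis t * w) \<partial>circ) \<partial>gauss)"
    and "integrable gauss (\<lambda>w. \<integral>t. F (ucis t * w) \<partial>circ)"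
proof -
  interpret P: pair_sigma_finite circ gauss ..
  have [measurable]: "F \<in> borel_measurable borel" using borel_measurable_integrable[OF F] by simp
  have "integrable (circ \<Otimes>\<^sub>M gauss) (\<lambda>(t, w). F (ucis t * w))"
  proof (rule P.Fubini_integrable)
    show "(\<lambda>(t, w). F (ucis t * w)) \<in> borel_measurable (circ \<Otimes>\<^sub>M gauss)" by measurable
    show "integrable circ (\<lambda>t. \<integral>w. norm (case (t, w) of (t, w) \<Rightarrow> F (ucis t * w)) \<partial>gauss)"
      using integral_gauss_rotate[of "\<lambda>w. norm (F w)" "ucis t" for t] by simp
    show "AE t in circ. integrable gauss (\<lambda>w. case (t, w) of (t, w) \<Rightarrow> F (ucis t * w))"
      using integrable_gauss_rotate[of F "ucis t" for t] F by simp
  qed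
  from P.Fubini_integral[OF this] P.integrable_snd[OF this]
  show "integral\<^sup>L gauss F = (\<integral>w. (\<integral>t. F (ucis t * w) \<partial>circ) \<partial>gauss)"
    and "integrable gauss (\<lambda>w. \<integral>t. F (ucis t * w) \<partial>circ)"
    using integral_gauss_rotate[of F "ucis t" for t] by simp_all
qed

text \<open>A term \<open>cnj w ^ i * h i w\<close> of a function in \<open>fock m\<close>, paired
  with \<open>cnj w ^ m\<close>, has only the angular frequencies m - i + n with n \<ge> 0. These
  are positive because \<open>i < m\<close>, so the circle average kills the term.\<close>

lemma psi0_true_fock: "psi m 0 \<in> true_fock (Suc m)"
  unfolding true_fock_iff
proof (intro conjI ballI)
  have p: "psi m 0 = (\<lambda>w. cnj w ^ m * 1)" by (simp add: psi_def fun_eq_iff)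
  show "polyan (Suc m) (psi m 0)" unfolding p by (rule polyan_monomial) auto
  fix g assume g: "g \<in> fock m"
  then obtain h where h: "\<And>i. h i holomorphic_on UNIV" "g = (\<lambda>z. \<Sum>i<m. cnj z ^ i * h i z)"
    using polyanE fock_iff by metis
  have "ip g (psi m 0) = (\<integral>w. (\<integral>t. g (ucis t * w) * cnj (psi m 0 (ucis t * w)) \<partial>circ) \<partial>gauss)"
    unfolding ip_def by (rule rotation_mean(1)) (intro L2_ip_integrable fock_L2[OF g] psi_L2)
  also have "(\<lambda>w. \<integral>t. g (ucis t * w) * cnj (psi m 0 (ucis t * w)) \<partial>circ) = (\<lambda>w. 0)"
  proof
    fix w
    have "g (ucis t * w) * cnj (psi m 0 (ucis t * w)) = (\<Sum>i<m. cnj w ^ i * w ^ m * (ucis t ^ m * cnj (ucis t) ^ i * h i (ucis t * w)))" for t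
      unfolding h(2) p sum_distrib_right by (intro sum.cong refl) (simp add: power_mult_distrib mult_ac)
    then have "(\<integral>t. g (ucis t * w) * cnj (psi m 0 (ucis t * w)) \<partial>circ) = (\<integral>t. (\<Sum>i<m. cnj w ^ i * w ^ m * (ucis t ^ m * cnj (ucis t) ^ i * h i (ucis t * w))) \<partial>circ)" by simp
    also have "\<dots> = (\<Sum>i<m. cnj w ^ i * w ^ m * (\<integral>t. ucis t ^ m * cnj (ucis t) ^ i * h i (ucis t * w) \<partial>circ))"
    proof (subst Bochner_Integration.integral_sum)
      fix i
      show "integrable circ (\<lambda>t. cnj w ^ i * w ^ m * (ucis t ^ m * cnj (ucis t) ^ i * h i (ucis t * w)))"
        by (intro integrable_circ_continuous continuous_intros continuous_on_compose2[OF holomorphic_on_imp_continuous_on[OF h(1)]]) auto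
    qed simp
    also have "\<dots> = 0" using circ_integral_entire_0[OF h(1)] by simp
    finally show "(\<integral>t. g (ucis t * w) * cnj (psi m 0 (ucis t * w)) \<partial>circ) = 0" .
  qed
  finally have "ip g (psi m 0) = 0" by simp
  then show "ip (psi m 0) g = 0" using ip_cnj[of g "psi m 0"] by simp
qed (rule psi_L2)

lemma psi_true_fock: "psi m c \<in> true_fock (Suc m)"
proof -
  have "psi m c = (\<lambda>w. exp (of_real ((cmod c)\<^sup>2 / 2)) * weyl c (psi m 0) w)"
    unfolding weyl_psi by (simp add: mult.assoc[symmetric] exp_add[symmetric])
  then show ?thesis using true_fock_scale[OF weyl_true_fock[OF psi0_true_fock]] by metis
qed

lemma gg_true_fock: "gg m j \<in> true_fock (Suc m)"
  unfolding true_fock_iff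
proof (intro conjI ballI gg_L2)
  have "polyan (Suc m) (\<lambda>w. if i \<le> j then of_nat (m choose i) * (-1) ^ i * cnj w ^ (m - i) * w ^ (j - i) / fact (j - i) else 0)" for i
  proof (cases "i \<le> j")
    case True
    have "polyan (Suc m) (\<lambda>w. (of_nat (m choose i) * (-1) ^ i / fact (j - i)) * (cnj w ^ (m - i) * w ^ (j - i)))"
      by (intro polyan_scale polyan_monomial holomorphic_intros) auto
    then show ?thesis using True by (simp add: mult_ac)
  qed (simp add: polyan_0)
  then show "polyan (Suc m) (gg m j)" unfolding gg_def[abs_def] by (rule polyan_sum)
  fix g assume g: "g \<in> fock m"
  have "ip g (psi m c) = 0" for c
  proof -
    have "ip (psi m c) g = 0" using psi_true_fock[of m c] g by (simp add: true_fock_iff)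
    then show ?thesis using ip_cnj[of "psi m c" g] by simp
  qed
  then have "ip g (gg m j) = 0" by (rule ip_gg_zero[OF fock_L2[OF g]])
  then show "ip (gg m j) g = 0" using ip_cnj[of g "gg m j"] by simp
qed

section \<open>Reproducing kernels\<close>

definition lag :: "nat \<Rightarrow> complex \<Rightarrow> complex" where "lag m w = of_real (laguerre m ((cmod w)\<^sup>2))"

text \<open>Each term of \<open>gg m m\<close> has equal powers of \<open>w\<close> and
  \<open>cnj w\<close>, so the function is radial, and reversing the summation matches the Laguerre
  coefficients. Hence the reproducing kernels are, up to sign, Weyl translates of
  \<open>gg m m\<close>.\<close>

lemma lag_gg: "lag m w = (-1) ^ m * gg m m w"
proof -
  have "lag m w = (\<Sum>j\<le>m. (-1) ^ j * of_nat (m choose (m - j)) * (of_real ((cmod w)\<^sup>2) ^ j / fact j))"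
    by (simp add: lag_def laguerre_def atLeast0AtMost)
  also have "\<dots> = (\<Sum>i\<le>m. (-1) ^ (m - i) * of_nat (m choose i) * (of_real ((cmod w)\<^sup>2) ^ (m - i) / fact (m - i)))"
    by (rule sum.reindex_bij_witness[of _ "\<lambda>i. m - i" "\<lambda>i. m - i"]) auto
  also have "\<dots> = (-1) ^ m * gg m m w"
    unfolding gg_def sum_distrib_left
  proof (intro sum.cong refl)
    fix i assume i: "i \<in> {..m}"
    have "(-1) ^ (m - i) = (-1) ^ m * ((-1) ^ i :: complex)"
      using i by (simp add: power_diff minus_one_power_iff)
    moreover have "of_real ((cmod w)\<^sup>2) ^ (m - i) = cnj w ^ (m - i) * w ^ (m - i)"
      unfolding complex_norm_square by (simp add: power_mult_distrib mult.commute)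
    ultimately show "(-1) ^ (m - i) * of_nat (m choose i) * (of_real ((cmod w)\<^sup>2) ^ (m - i) / fact (m - i)) =
      (-1) ^ m * (if i \<le> m then of_nat (m choose i) * (-1) ^ i * cnj w ^ (m - i) * w ^ (m - i) / fact (m - i) else 0)"
      using i by simp
  qed
  finally show ?thesis .
qed

lemma lag_true_fock: "lag m \<in> true_fock (Suc m)"
  using true_fock_scale[OF gg_true_fock[of m m], of "(-1) ^ m"] by (simp add: lag_gg[abs_def])

lemma lag_0: "lag m 0 = 1"
proof -
  have "laguerre m 0 = (\<Sum>j\<in>{0..m}. if j = 0 then 1 else 0)"
    unfolding laguerre_def by (intro sum.cong refl) (auto simp: power_0_left)
  then show ?thesis by (simp add: lag_def)
qed

lemma nkernel_weyl: "nkernel (Suc m) z = weyl z (lag m)"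
  by (simp add: nkernel_def weyl_def lag_def fun_eq_iff mult.commute)

lemma nkernel_true_fock: "nkernel (Suc m) z \<in> true_fock (Suc m)"
  unfolding nkernel_weyl by (rule weyl_true_fock[OF lag_true_fock])

definition lagc :: "nat \<Rightarrow> real" where "lagc m = (nrm (lag m))\<^sup>2"

lemma ip_lag_lag: "ip (lag m) (lag m) = of_real (lagc m)" by (simp add: ip_self lagc_def)

lemma lagc_pos: "lagc m > 0"
proof (rule ccontr)
  assume "\<not> lagc m > 0"
  then have "(nrm (lag m))\<^sup>2 = 0" using zero_le_power2[of "nrm (lag m)"] unfolding lagc_def by linarith
  then have "(\<integral>z. (cmod (lag m z))\<^sup>2 \<partial>gauss) = 0" unfolding nrm_sq .
  then have "AE z in gauss. (cmod (lag m z))\<^sup>2 = 0"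
    by (subst (asm) integral_nonneg_eq_0_iff_AE) (auto intro: L2_integrable true_fock_L2 lag_true_fock)
  then have "AE z in lborel. lag m z = 0" by (simp add: AE_gauss_iff)
  moreover have "continuous_on UNIV (lag m)"
    using lag_true_fock[of m] polyan_continuous[of "Suc m" "lag m"] by (simp add: true_fock_iff)
  ultimately have "lag m 0 = 0" by (rule AE_zero_continuous[rotated])
  then show False by (simp add: lag_0)
qed

text \<open>Subtracting \<open>v 0 * lag m\<close> leaves a function \<open>z\<close> that vanishes
  at 0. Its circle mean is |w|^2 q, where \<open>q\<close> is radial and lies in
  \<open>fock m\<close>, hence is orthogonal to \<open>z\<close>; this says that the integral of
  |w|^2 |q|^2 is 0. So the circle mean vanishes almost everywhere, and with it the pairing with the
  radial function \<open>lag m\<close>.\<close>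

lemma reproducing_0:
  assumes v: "v \<in> true_fock (Suc m)"
  shows "ip v (lag m) = of_real (lagc m) * v 0"
proof -
  define z where "z = (\<lambda>w. v w - v 0 * lag m w)"
  have z: "z \<in> true_fock (Suc m)" unfolding z_def
    by (intro true_fock_diff v true_fock_scale lag_true_fock)
  have z0: "z 0 = 0" by (simp add: z_def lag_0)
  obtain h where h: "\<And>i. h i holomorphic_on UNIV" "z = (\<lambda>w. \<Sum>i<Suc m. cnj w ^ i * h i w)"
    using polyanE z true_fock_iff by metis
  define a where "a i = (deriv ^^ i) (h i) 0 / fact i" for i
  define q where "q w = (\<Sum>i<m. a (Suc i) * of_real ((cmod w)\<^sup>2) ^ i)" for w
  \<comment> \<open>The constant term of the circle mean is \<open>z 0\<close>; its vanishing splits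
    off the factor |w|^2 and lowers the degree enough for \<open>q\<close> to lie in
    \<open>fock m\<close>.\<close>
  have a0: "a 0 = 0" using z0 unfolding h(2) a_def by (subst (asm) sum.lessThan_Suc_shift) simp
  have mean: "(\<integral>t. z (ucis t * w) \<partial>circ) = of_real ((cmod w)\<^sup>2) * q w" for w
  proof -
    have "z (ucis t * w) = (\<Sum>i<Suc m. cnj w ^ i * (cnj (ucis t) ^ i * h i (ucis t * w)))" for t
      unfolding h(2) by (intro sum.cong refl) (simp add: power_mult_distrib mult_ac)
    then have "(\<integral>t. z (ucis t * w) \<partial>circ) = (\<integral>t. (\<Sum>i<Suc m. cnj w ^ i * (cnj (ucis t) ^ i * h i (ucis t * w))) \<partial>circ)" by simp
    also have "\<dots> = (\<Sum>i<Suc m. cnj w ^ i * (\<integral>t. cnj (ucis t) ^ i * h i (ucis t * w) \<partial>circ))"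
    proof (subst Bochner_Integration.integral_sum)
      fix i
      show "integrable circ (\<lambda>t. cnj w ^ i * (cnj (ucis t) ^ i * h i (ucis t * w)))"
        by (intro integrable_circ_continuous continuous_intros continuous_on_compose2[OF holomorphic_on_imp_continuous_on[OF h(1)]]) auto
    qed simp
    also have "\<dots> = (\<Sum>i<Suc m. a i * of_real ((cmod w)\<^sup>2) ^ i)"
      unfolding complex_norm_square
      by (intro sum.cong refl) (simp add: circ_integral_entire[OF h(1)] a_def power_mult_distrib)
    also have "\<dots> = of_real ((cmod w)\<^sup>2) * q w"
      by (subst sum.lessThan_Suc_shift) (simp add: a0 q_def sum_distrib_left mult_ac)
    finally show ?thesis .
  qed
  have rad: "ip z g = (\<integral>w. of_real ((cmod w)\<^sup>2) * q w * cnj (g w) \<partial>gauss)"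
    and rad_int: "integrable gauss (\<lambda>w. of_real ((cmod w)\<^sup>2) * q w * cnj (g w))"
    if g: "g \<in> L2" and gr: "\<And>t w. g (ucis t * w) = g w" for g
  proof -
    have i: "integrable gauss (\<lambda>w. z w * cnj (g w))" by (rule L2_ip_integrable[OF true_fock_L2[OF z] g])
    from rotation_mean[OF i] show "ip z g = (\<integral>w. of_real ((cmod w)\<^sup>2) * q w * cnj (g w) \<partial>gauss)"
      "integrable gauss (\<lambda>w. of_real ((cmod w)\<^sup>2) * q w * cnj (g w))"
      by (simp_all add: ip_def gr mean)
  qed
  have qf: "q \<in> fock m"
  proof -
    have e: "q = (\<lambda>w. \<Sum>i<m. a (Suc i) * (cnj w ^ i * w ^ i))"
      unfolding q_def[abs_def] complex_norm_square by (simp add: power_mult_distrib mult.commute)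
    have "egrow q" unfolding e by (intro egrow_sum egrow_mult egrow_power egrow_cnj) auto
    moreover have "polyan m q" unfolding e
      by (intro polyan_sum polyan_scale polyan_monomial holomorphic_intros) auto
    ultimately show ?thesis by (simp add: fock_iff egrow_L2)
  qed
  have qr: "q (ucis t * w) = q w" for t w by (simp add: q_def norm_mult)
  have "ip z q = 0" using z qf by (simp add: true_fock_iff)
  then have "(\<integral>w. complex_of_real ((cmod w)\<^sup>2 * (cmod (q w))\<^sup>2) \<partial>gauss) = 0"
    unfolding rad[OF fock_L2[OF qf] qr] of_real_mult complex_norm_square[of "q w" for w] by (simp add: mult.assoc)
  then have "(\<integral>w. (cmod w)\<^sup>2 * (cmod (q w))\<^sup>2 \<partial>gauss) = 0" by (simp only: integral_complex_of_real of_real_eq_0_iff)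
  moreover have "integrable gauss (\<lambda>w. (cmod w)\<^sup>2 * (cmod (q w))\<^sup>2)"
    using rad_int[OF fock_L2[OF qf] qr, THEN integrable_norm] by (simp add: norm_mult power2_eq_square mult_ac)
  ultimately have ae: "AE w in gauss. (cmod w)\<^sup>2 * (cmod (q w))\<^sup>2 = 0"
    by (subst (asm) integral_nonneg_eq_0_iff_AE) auto
  have lr: "lag m (ucis t * w) = lag m w" for t w by (simp add: lag_def norm_mult)
  have "ip z (lag m) = (\<integral>w. 0 \<partial>gauss)"
    unfolding rad[OF true_fock_L2[OF lag_true_fock] lr]
  proof (rule integral_cong_AE)
    show "AE w in gauss. of_real ((cmod w)\<^sup>2) * q w * cnj (lag m w) = 0"
      using ae by eventually_elim auto
  qed (use L2_measurable[OF fock_L2[OF qf]] L2_measurable[OF true_fock_L2[OF lag_true_fock]] in measurable)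
  then have "ip z (lag m) = 0" by simp
  moreover have "ip z (lag m) = ip v (lag m) - v 0 * of_real (lagc m)"
    unfolding z_def using true_fock_L2[OF v] true_fock_L2[OF lag_true_fock[of m]]
    by (simp add: ip_diff_left L2_scale ip_scale_left ip_lag_lag)
  ultimately show ?thesis by (simp add: mult.commute)
qed

lemma reproducing:
  assumes v: "v \<in> true_fock (Suc m)"
  shows "ip v (nkernel (Suc m) z) = of_real (lagc m * exp (- (cmod z)\<^sup>2 / 2)) * v z"
proof -
  have "ip v (nkernel (Suc m) z) = cnj (ip (weyl z (lag m)) v)" unfolding nkernel_weyl ip_cnj ..
  also have "\<dots> = cnj (ip (lag m) (weyl (- z) v))"
    by (subst ip_weyl_left) (auto intro: L2_measurable true_fock_L2 v lag_true_fock)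
  also have "\<dots> = ip (weyl (- z) v) (lag m)" by (rule ip_cnj)
  also have "\<dots> = of_real (lagc m) * weyl (- z) v 0" by (rule reproducing_0[OF weyl_true_fock[OF v]])
  also have "weyl (- z) v 0 = of_real (exp (- (cmod z)\<^sup>2 / 2)) * v z"
    by (simp add: weyl_def flip: exp_of_real)
  finally show ?thesis by simp
qed

section \<open>Zeros of Laguerre polynomials\<close>

text \<open>The Laguerre polynomial at -x: substituting \<open>lap\<close> for the variable then
  gives L_m(-\<Delta>/4).\<close>

definition lagpoly :: "nat \<Rightarrow> complex poly" where
  "lagpoly m = (\<Sum>n\<le>m. monom (of_nat (m choose n) / fact n) n)"

lemma coeff_lagpoly: "coeff (lagpoly m) n = (if n \<le> m then of_nat (m choose n) / fact n else 0)"
  by (simp add: lagpoly_def coeff_sum coeff_monom sum.delta)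

lemma degree_lagpoly: "degree (lagpoly m) = m"
proof (rule antisym)
  show "degree (lagpoly m) \<le> m" by (rule degree_le) (simp add: coeff_lagpoly)
  show "m \<le> degree (lagpoly m)" by (rule le_degree) (simp add: coeff_lagpoly)
qed

lemma lagpoly_nz: "lagpoly m \<noteq> 0"
  using coeff_lagpoly[of m m] by auto

lemma lag_lagpoly: "lag m w = poly (lagpoly m) (- of_real ((cmod w)\<^sup>2))"
proof -
  have "poly (lagpoly m) (- of_real ((cmod w)\<^sup>2)) = (\<Sum>n\<le>m. of_nat (m choose n) / fact n * (- of_real ((cmod w)\<^sup>2)) ^ n)"
    by (simp add: poly_altdef degree_lagpoly coeff_lagpoly)
  also have "\<dots> = (\<Sum>j\<le>m. (-1) ^ j * of_nat (m choose (m - j)) * (of_real ((cmod w)\<^sup>2) ^ j / fact j))"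
  proof (intro sum.cong refl)
    fix j assume j: "j \<in> {..m}"
    have "(- complex_of_real ((cmod w)\<^sup>2)) ^ j = (-1) ^ j * of_real ((cmod w)\<^sup>2) ^ j" by (rule power_minus)
    moreover have "m choose j = m choose (m - j)" using j binomial_symmetric[of j m] by simp
    ultimately show "of_nat (m choose j) / fact j * (- complex_of_real ((cmod w)\<^sup>2)) ^ j = (-1) ^ j * of_nat (m choose (m - j)) * (of_real ((cmod w)\<^sup>2) ^ j / fact j)"
      by simp
  qed
  also have "\<dots> = lag m w" by (simp add: lag_def laguerre_def atLeast0AtMost)
  finally show ?thesis ..
qed

text \<open>The classical argument on zeros of orthogonal polynomials. Dividing a linear factor out
  of \<open>lag m\<close> leaves a radial polynomial \<open>Q\<close> of lower degree, which lies in
  \<open>fock m\<close> and so is orthogonal to \<open>lag m\<close>. With the squared norms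
  \<open>X\<close> of \<open>w * Q w\<close> and \<open>Y\<close> of \<open>Q\<close>, both
  positive, this reads \<open>\<rho> * Y = - X\<close>.\<close>

lemma lagpoly_root:
  assumes r: "poly (lagpoly m) \<rho> = 0"
  shows "\<exists>l>0. \<rho> = - complex_of_real l"
proof -
  obtain q where q: "lagpoly m = [:- \<rho>, 1:] * q" using r by (auto simp: poly_eq_0_iff_dvd)
  have "q \<noteq> 0" using q lagpoly_nz[of m] by auto
  then have "degree (lagpoly m) = Suc (degree q)" unfolding q by (subst degree_mult_eq) auto
  then have dq: "degree q < m" by (simp add: degree_lagpoly)
  define Q where "Q w = poly q (- of_real ((cmod w)\<^sup>2))" for w
  have lQ: "lag m w = (- of_real ((cmod w)\<^sup>2) - \<rho>) * Q w" for w
    unfolding lag_lagpoly q by (simp add: Q_def algebra_simps)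
  have e: "Q = (\<lambda>w. \<Sum>i\<le>degree q. (coeff q i * (-1) ^ i) * (cnj w ^ i * w ^ i))"
  proof
    fix w
    have "(- complex_of_real ((cmod w)\<^sup>2)) ^ i = (-1) ^ i * (cnj w ^ i * w ^ i)" for i
      unfolding power_minus[of "complex_of_real ((cmod w)\<^sup>2)"] unfolding complex_norm_square by (simp add: power_mult_distrib mult.commute)
    then show "Q w = (\<Sum>i\<le>degree q. (coeff q i * (-1) ^ i) * (cnj w ^ i * w ^ i))"
      by (simp add: Q_def poly_altdef mult.assoc)
  qed
  have eQ: "egrow Q" unfolding e by (intro egrow_sum egrow_mult egrow_power egrow_cnj) auto
  have pQ: "polyan m Q" unfolding e
    using dq by (intro polyan_sum polyan_scale polyan_monomial holomorphic_intros) auto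
  have QL: "Q \<in> L2" by (rule egrow_L2[OF eQ])
  have Qf: "Q \<in> fock m" using pQ QL by (simp add: fock_iff)
  have Qm[measurable]: "Q \<in> borel_measurable borel" using QL by (rule L2_measurable)
  have i1: "integrable gauss (\<lambda>w. (cmod (Q w))\<^sup>2)" by (rule L2_integrable[OF QL])
  have i2: "integrable gauss (\<lambda>w. (cmod w * cmod (Q w))\<^sup>2)"
  proof -
    have "(\<lambda>w. w * Q w) \<in> L2" by (intro egrow_L2 egrow_mult eQ egrow_id)
    from L2_integrable[OF this] show ?thesis by (simp add: norm_mult)
  qed
  define X where "X = (\<integral>w. (cmod w * cmod (Q w))\<^sup>2 \<partial>gauss)"
  define Y where "Y = (\<integral>w. (cmod (Q w))\<^sup>2 \<partial>gauss)"
  have "0 = ip (lag m) Q" using lag_true_fock[of m] Qf by (simp add: true_fock_iff)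
  also have "\<dots> = (\<integral>w. - complex_of_real ((cmod w * cmod (Q w))\<^sup>2) - \<rho> * complex_of_real ((cmod (Q w))\<^sup>2) \<partial>gauss)"
    unfolding ip_def
  proof (rule Bochner_Integration.integral_cong[OF refl])
    fix w
    have "lag m w * cnj (Q w) = (- of_real ((cmod w)\<^sup>2) - \<rho>) * (Q w * cnj (Q w))" by (simp add: lQ)
    also have "Q w * cnj (Q w) = of_real ((cmod (Q w))\<^sup>2)" by (rule complex_norm_square[symmetric])
    finally show "lag m w * cnj (Q w) = - complex_of_real ((cmod w * cmod (Q w))\<^sup>2) - \<rho> * complex_of_real ((cmod (Q w))\<^sup>2)"
      by (simp add: power_mult_distrib algebra_simps)
  qed
  also have "\<dots> = - of_real X - \<rho> * of_real Y"
    unfolding X_def Y_def using i1 i2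
    by (subst Bochner_Integration.integral_diff)
       (auto simp only: integral_complex_of_real integral_mult_right_zero Bochner_Integration.integral_minus
         intro!: Bochner_Integration.integrable_minus integrable_mult_right integrable_of_real)
  finally have rel: "\<rho> * of_real Y = - of_real X" by (simp add: algebra_simps)
  have Y0: "Y \<noteq> 0"
  proof
    assume "Y = 0"
    then have "AE w in gauss. (cmod (Q w))\<^sup>2 = 0" unfolding Y_def
      using i1 by (subst (asm) integral_nonneg_eq_0_iff_AE) auto
    then have "AE w in lborel. Q w = 0" by (simp add: AE_gauss_iff)
    then have "Q 0 = 0" by (rule AE_zero_continuous[OF polyan_continuous[OF pQ]])
    then show False using lQ[of 0] lag_0[of m] by simp
  qed
  have X0: "X \<noteq> 0"
  proof
    assume "X = 0"
    then have "AE w in gauss. (cmod w * cmod (Q w))\<^sup>2 = 0" unfolding X_def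
      using i2 by (subst (asm) integral_nonneg_eq_0_iff_AE) auto
    moreover have "AE w in gauss. w \<noteq> 0" unfolding AE_gauss_iff by (rule AE_lborel_singleton)
    ultimately have "AE w in gauss. (cmod (Q w))\<^sup>2 = 0" by eventually_elim auto
    then have "Y = 0" unfolding Y_def by (subst integral_nonneg_eq_0_iff_AE[OF i1]) auto
    then show False using Y0 by simp
  qed
  have "X \<ge> 0" "Y \<ge> 0" unfolding X_def Y_def by auto
  then have "X / Y > 0" using X0 Y0 by simp
  moreover have "\<rho> = - complex_of_real (X / Y)" using rel Y0 by (simp add: field_simps)
  ultimately show ?thesis by blast
qed

lemma lagpoly_factor: "\<exists>c ls. (\<forall>l\<in>set ls. l > 0) \<and> c \<noteq> 0 \<and> lagpoly m = smult c (prod_list (map (\<lambda>l. [:complex_of_real l, 1:]) ls))"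
proof -
  obtain A where A: "lagpoly m = smult (lead_coeff (lagpoly m)) (\<Prod>x\<in>#A. [:-x, 1:])"
    using alg_closed_imp_factorization[OF lagpoly_nz] by blast
  obtain xs where xs: "mset xs = A" using ex_mset by blast
  have lc: "lead_coeff (lagpoly m) \<noteq> 0" using lagpoly_nz by simp
  have p: "lagpoly m = smult (lead_coeff (lagpoly m)) (prod_list (map (\<lambda>x. [:-x, 1:]) xs))"
    by (subst A) (simp add: xs[symmetric] prod_mset_prod_list flip: mset_map)
  have r: "\<exists>l>0. x = - complex_of_real l" if "x \<in> set xs" for x
  proof (rule lagpoly_root)
    have "poly (prod_list (map (\<lambda>x. [:-x, 1:]) xs)) x = 0"
      using that by (induction xs) auto
    then show "poly (lagpoly m) x = 0" by (subst p) simp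
  qed
  define ls where "ls = map (\<lambda>x. - Re x) xs"
  have "map (\<lambda>l. [:complex_of_real l, 1:]) ls = map (\<lambda>x. [:-x, 1:]) xs"
    unfolding ls_def using r by fastforce
  moreover have "\<forall>l\<in>set ls. l > 0" unfolding ls_def using r by fastforce
  ultimately show ?thesis using p lc by (intro exI[of _ "lead_coeff (lagpoly m)"] exI[of _ ls]) simp
qed

text \<open>The zeros of \<open>lagpoly m\<close> are negative, and each factor can be cancelled by the resonance
  lemma.\<close>

lemma radint_lagpoly_cancel:
  fixes \<phi> :: "complex \<Rightarrow> complex"
  assumes m: "\<phi> \<in> borel_measurable borel" and bd: "\<And>z. cmod (\<phi> z) \<le> C"
    and z: "\<And>a. radint (\<lambda>w. \<phi> (w + a)) (act (lagpoly m) (act (lagpoly m) P)) = 0"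
  shows "radint \<phi> (act (lagpoly m) P) = 0"
proof -
  obtain c ls where l: "\<forall>l\<in>set ls. l > 0" "c \<noteq> 0" "lagpoly m = smult c (prod_list (map (\<lambda>l. [:complex_of_real l, 1:]) ls))"
    using lagpoly_factor by blast
  define M where "M = prod_list (map (\<lambda>l. [:complex_of_real l, 1:]) ls)"
  have L: "act (lagpoly m) P = smult c (act M P)" for P unfolding l(3) M_def[symmetric] by (rule act_smult)
  have "radnull \<phi> (act (lagpoly m) (act (lagpoly m) P))" by (rule radnull_of_translates[OF m bd z])
  then have "radnull \<phi> (smult (c * c) (act M (act M P)))" by (simp add: L act_smult_right)
  then have "radnull \<phi> (act M (act M P))" using l(2) by (simp add: radnull_def[OF m bd] lapn_smult radint_smult[OF m bd])
  then have "radnull \<phi> (act M P)" unfolding M_def by (rule radnull_roots[OF m bd, rotated]) (use l(1) in simp)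
  then have "radint \<phi> ((lap ^^ 0) (act M P)) = 0" unfolding radnull_def[OF m bd] by blast
  then show ?thesis by (simp add: L radint_smult[OF m bd])
qed

section \<open>The projection onto the true Fock space\<close>

lemma coeff_eq_higher_deriv:
  assumes s: "\<And>z. (\<lambda>n. a n * z ^ n) sums f z" and h: "f holomorphic_on UNIV"
  shows "a n = (deriv ^^ n) f 0 / fact n"
proof -
  have "(\<lambda>n. (a n - (deriv ^^ n) f 0 / fact n) * z ^ n) sums 0" for z
    using sums_diff[OF s[of z] entire_power_series[OF h, of z]] by (simp add: left_diff_distrib)
  from power_series_zero[OF this, of n] show ?thesis by simp
qed

lemma entire_of_power_series:
  assumes s: "\<And>z. (\<lambda>n. a n * z ^ n) sums f z"
  shows "f holomorphic_on UNIV"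
  unfolding holomorphic_on_def
proof (intro ballI)
  fix z :: complex
  have "f holomorphic_on ball 0 (norm z + 1)"
    by (rule power_series_holomorphic[where a = a]) (use s in simp)
  then show "f field_differentiable at z within UNIV"
    using holomorphic_on_imp_differentiable_at[of f "ball 0 (norm z + 1)" z] by simp
qed

text \<open>The normalizing constant \<open>lagc m\<close> is in fact 1, but only its positivity matters.\<close>

definition fockproj :: "nat \<Rightarrow> (complex \<Rightarrow> complex) \<Rightarrow> complex \<Rightarrow> complex" where
  "fockproj m u z = of_real (exp ((cmod z)\<^sup>2 / 2) / lagc m) * ip u (nkernel (Suc m) z)"

text \<open>Up to constants, the pairing with the kernel at \<open>z\<close> is the m-th Taylor
  coefficient in \<open>d\<close> of the pairing of \<open>weyl (- z) u\<close> with
  \<open>psi m d\<close>. That function is \<open>exp (- cnj z * d) * H (z + d)\<close> times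
  exp(-|z|^2/2), with \<open>H\<close> entire, so the Leibniz rule yields a polynomial in
  \<open>cnj z\<close> of degree at most \<open>m\<close> whose coefficients are derivatives of
  \<open>H\<close>.\<close>

lemma fockproj_polyan:
  assumes u: "u \<in> L2"
  shows "polyan (Suc m) (fockproj m u)"
proof -
  define H where "H c = ip u (psi m c)" for c
  have Hs: "(\<lambda>n. ip u (gg m n) * z ^ n) sums H z" for z
    using psi_ip_sums[OF u, of z m] by (simp add: H_def mult.commute)
  have H: "H holomorphic_on UNIV" by (rule entire_of_power_series[OF Hs])
  have eq: "fockproj m u z = (\<Sum>i\<le>m. ((-1) ^ m / (fact m * of_real (lagc m)) * of_nat (m choose i) * (-1) ^ i) * (cnj z ^ i * (deriv ^^ (m - i)) H z))" for z
  proof -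
    define y where "y = weyl (- z) u"
    have y: "y \<in> L2" unfolding y_def by (rule weyl_L2[OF u])
    have um[measurable]: "u \<in> borel_measurable borel" using u by (rule L2_measurable)
    have tr: "ip u (weyl z v) = ip y v" if "v \<in> borel_measurable borel" for v
      unfolding y_def using ip_weyl_left[of u v "- z"] that um by simp
    define f where "f d = of_real (exp (- (cmod z)\<^sup>2 / 2)) * (exp (- cnj z * d) * H (z + d))" for d
    have yf: "ip y (psi m d) = f d" for d
    proof -
      have "ip y (psi m d) = ip u (weyl z (psi m d))" by (rule tr[symmetric]) (rule egrow_measurable[OF egrow_psi])
      also have "\<dots> = cnj (exp (- of_real ((cmod z)\<^sup>2 / 2) - z * cnj d)) * H (z + d)"
        unfolding weyl_psi ip_scale_right H_def ..
      also have "cnj (exp (- of_real ((cmod z)\<^sup>2 / 2) - z * cnj d)) = of_real (exp (- (cmod z)\<^sup>2 / 2)) * exp (- cnj z * d)"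
        by (simp add: exp_cnj exp_of_real[symmetric] exp_add[symmetric] del: exp_of_real)
      finally show ?thesis by (simp add: f_def)
    qed
    have g1: "(\<lambda>d. exp (- cnj z * d)) holomorphic_on UNIV" by (intro holomorphic_intros)
    have g2: "(\<lambda>d. H (z + d)) holomorphic_on UNIV"
    proof -
      have "(\<lambda>d. z + d) holomorphic_on UNIV" by (intro holomorphic_intros)
      moreover have "H holomorphic_on (\<lambda>d. z + d) ` UNIV" using H holomorphic_on_subset by blast
      ultimately show ?thesis using holomorphic_on_compose[of "\<lambda>d. z + d" UNIV H] by (simp add: o_def)
    qed
    have hf: "(\<lambda>d. exp (- cnj z * d) * H (z + d)) holomorphic_on UNIV" by (rule holomorphic_on_mult[OF g1 g2])
    have fh: "f holomorphic_on UNIV" unfolding f_def by (intro holomorphic_on_mult holomorphic_on_const hf)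
    have "ip y (gg m m) = (deriv ^^ m) f 0 / fact m"
      by (rule coeff_eq_higher_deriv[OF _ fh]) (use psi_ip_sums[OF y, of _ m] yf in \<open>simp add: mult.commute\<close>)
    also have "(deriv ^^ m) f 0 = of_real (exp (- (cmod z)\<^sup>2 / 2)) * (deriv ^^ m) (\<lambda>d. exp (- cnj z * d) * H (z + d)) 0"
      unfolding f_def by (rule higher_deriv_cmult[OF hf]) auto
    also have "(deriv ^^ m) (\<lambda>d. exp (- cnj z * d) * H (z + d)) 0 = (\<Sum>i = 0..m. of_nat (m choose i) * (deriv ^^ i) (\<lambda>d. exp (- cnj z * d)) 0 * (deriv ^^ (m - i)) (\<lambda>d. H (z + d)) 0)"
      by (rule higher_deriv_mult[OF g1 g2]) auto
    also have "\<dots> = (\<Sum>i\<le>m. of_nat (m choose i) * (- cnj z) ^ i * (deriv ^^ (m - i)) H z)"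
    proof (intro sum.cong)
      fix i
      have "(deriv ^^ i) (\<lambda>d. exp (- cnj z * d)) 0 = (- cnj z) ^ i"
      proof -
        have "(deriv ^^ i) (\<lambda>d. exp (- cnj z * d)) = (\<lambda>d. (- cnj z) ^ i * exp (- cnj z * d))"
        proof (induction i)
          case (Suc i)
          have "deriv (\<lambda>d. (- cnj z) ^ i * exp (- cnj z * d)) = (\<lambda>d. (- cnj z) ^ Suc i * exp (- cnj z * d))"
            by (rule ext, rule DERIV_imp_deriv) (auto intro!: derivative_eq_intros)
          then show ?case using Suc by simp
        qed simp
        then show ?thesis by simp
      qed
      moreover have "(deriv ^^ (m - i)) (\<lambda>d. H (z + d)) 0 = (deriv ^^ (m - i)) H z"
      proof -
        have "(deriv ^^ k) (\<lambda>d. H (z + d)) = (\<lambda>d. (deriv ^^ k) H (z + d))" for k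
        proof (induction k)
          case (Suc k)
          have "deriv (\<lambda>d. (deriv ^^ k) H (z + d)) = (\<lambda>d. deriv ((deriv ^^ k) H) (z + d))"
          proof
            fix d
            have "(deriv ^^ k) H holomorphic_on UNIV" by (rule holomorphic_higher_deriv[OF H]) simp
            then have "((deriv ^^ k) H has_field_derivative deriv ((deriv ^^ k) H) (z + d)) (at (z + d))"
              by (rule holomorphic_derivI) auto
            then have "((\<lambda>d. (deriv ^^ k) H (z + d)) has_field_derivative deriv ((deriv ^^ k) H) (z + d)) (at d)"
              using DERIV_shift[of "(deriv ^^ k) H" "deriv ((deriv ^^ k) H) (z + d)" d z] by (simp add: add.commute)
            then show "deriv (\<lambda>d. (deriv ^^ k) H (z + d)) d = deriv ((deriv ^^ k) H) (z + d)" by (rule DERIV_imp_deriv)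
          qed
          then show ?case using Suc by simp
        qed simp
        then show ?thesis by simp
      qed
      ultimately show "of_nat (m choose i) * (deriv ^^ i) (\<lambda>d. exp (- cnj z * d)) 0 * (deriv ^^ (m - i)) (\<lambda>d. H (z + d)) 0 = of_nat (m choose i) * (- cnj z) ^ i * (deriv ^^ (m - i)) H z"
        by simp
    qed auto
    finally have g: "ip y (gg m m) = of_real (exp (- (cmod z)\<^sup>2 / 2)) * (\<Sum>i\<le>m. of_nat (m choose i) * (- cnj z) ^ i * (deriv ^^ (m - i)) H z) / fact m" .
    have "ip u (nkernel (Suc m) z) = ip y (lag m)"
      unfolding nkernel_weyl by (rule tr) (rule L2_measurable[OF true_fock_L2[OF lag_true_fock]])
    also have "\<dots> = (-1) ^ m * ip y (gg m m)" unfolding lag_gg[abs_def] ip_scale_right by simp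
    finally have "fockproj m u z = of_real (exp ((cmod z)\<^sup>2 / 2) / lagc m) * ((-1) ^ m * (of_real (exp (- (cmod z)\<^sup>2 / 2)) * (\<Sum>i\<le>m. of_nat (m choose i) * (- cnj z) ^ i * (deriv ^^ (m - i)) H z) / fact m))"
      unfolding fockproj_def g by simp
    also have "\<dots> = (of_real (exp ((cmod z)\<^sup>2 / 2) * exp (- (cmod z)\<^sup>2 / 2)) * (-1) ^ m / (fact m * of_real (lagc m))) * (\<Sum>i\<le>m. of_nat (m choose i) * (- cnj z) ^ i * (deriv ^^ (m - i)) H z)"
      by (simp add: mult_ac)
    also have "exp ((cmod z)\<^sup>2 / 2) * exp (- (cmod z)\<^sup>2 / 2) = 1" unfolding exp_add[symmetric] by simp
    also have "complex_of_real 1 * (-1) ^ m / (fact m * of_real (lagc m)) * (\<Sum>i\<le>m. of_nat (m choose i) * (- cnj z) ^ i * (deriv ^^ (m - i)) H z)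
      = (\<Sum>i\<le>m. ((-1) ^ m / (fact m * of_real (lagc m)) * of_nat (m choose i) * (-1) ^ i) * (cnj z ^ i * (deriv ^^ (m - i)) H z))"
      unfolding sum_distrib_left power_minus[of "cnj z"] by (intro sum.cong refl) simp
    finally show ?thesis .
  qed
  show ?thesis unfolding eq[abs_def]
    by (intro polyan_sum polyan_scale polyan_monomial holomorphic_higher_deriv H) auto
qed

section \<open>Square integrability of the projection by Schur's test\<close>

definition rho :: "nat \<Rightarrow> complex \<Rightarrow> real" where
  "rho m t = cmod (lag m t) * exp (- (cmod t)\<^sup>2 / 2)"

lemma lag_measurable [measurable]: "lag m \<in> borel_measurable borel"
  by (rule L2_measurable[OF true_fock_L2[OF lag_true_fock]])

lemma rho_measurable [measurable]: "rho m \<in> borel_measurable borel"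
  unfolding rho_def[abs_def] by measurable

lemma rho_nonneg [simp]: "rho m t \<ge> 0" by (simp add: rho_def)

lemma rho_minus: "rho m (z - w) = rho m (w - z)"
  by (simp add: rho_def lag_def norm_minus_commute)

lemma rho_finite: "(\<integral>\<^sup>+t. ennreal (rho m t) \<partial>lborel) < \<infinity>"
proof -
  obtain A R where AR: "A \<ge> 0" "R \<ge> 0" "\<And>z. cmod (lag m z) \<le> A * exp (R * cmod z)"
    using egrowE[OF egrow_mult[OF egrow_const egrow_gg[of m m]], of "(-1) ^ m"] unfolding lag_gg by metis
  have "(\<integral>\<^sup>+t. ennreal (rho m t) \<partial>lborel) \<le> (\<integral>\<^sup>+t. ennreal (A * exp (R\<^sup>2) * exp (- (1/4) * (cmod t)\<^sup>2)) \<partial>lborel)"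
  proof (intro nn_integral_mono ennreal_leI)
    fix t :: complex
    have "A * exp (R * cmod t) \<le> A * (exp (R\<^sup>2) * exp ((1/4) * (cmod t)\<^sup>2))"
      using AR by (intro mult_left_mono exp_linear_le) auto
    then have "cmod (lag m t) \<le> A * (exp (R\<^sup>2) * exp ((1/4) * (cmod t)\<^sup>2))" using AR(3)[of t] by linarith
    then have "rho m t \<le> A * (exp (R\<^sup>2) * exp ((1/4) * (cmod t)\<^sup>2)) * exp (- (cmod t)\<^sup>2 / 2)"
      unfolding rho_def by (intro mult_right_mono) auto
    also have "\<dots> = A * exp (R\<^sup>2) * (exp ((1/4) * (cmod t)\<^sup>2) * exp (- (cmod t)\<^sup>2 / 2))" by simp
    also have "exp ((1/4) * (cmod t)\<^sup>2) * exp (- (cmod t)\<^sup>2 / 2) = exp (- (1/4) * (cmod t)\<^sup>2)"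
      unfolding exp_add[symmetric] by (simp add: algebra_simps)
    finally show "rho m t \<le> A * exp (R\<^sup>2) * exp (- (1/4) * (cmod t)\<^sup>2)" .
  qed
  also have "\<dots> < \<infinity>"
  proof -
    have "integrable lborel (\<lambda>t::complex. A * exp (R\<^sup>2) * exp (- (1/4) * (cmod t)\<^sup>2))"
      by (intro integrable_mult_right integrable_gaussian_complex) simp
    moreover have "norm (A * exp (R\<^sup>2) * exp (- (1/4) * (cmod t)\<^sup>2)) = A * exp (R\<^sup>2) * exp (- (1/4) * (cmod t)\<^sup>2)" for t :: complex
      using AR(1) by (simp add: abs_mult)
    ultimately show ?thesis unfolding integrable_iff_bounded by simp
  qed
  finally show ?thesis .
qed

text \<open>Once the Gaussian weight is shared evenly between the two variables, the modulus of the
  kernel depends on \<open>w - z\<close> only. The projection is thus dominated by a convolution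
  with the integrable function \<open>rho m\<close>.\<close>

lemma norm_nkernel: "exp (- (cmod w)\<^sup>2 / 2) * cmod (nkernel (Suc m) z w) = rho m (w - z)"
proof -
  have sq: "(exp (- (cmod w)\<^sup>2 / 2))\<^sup>2 = exp (- (cmod w)\<^sup>2)" "(exp (- (cmod (w - z))\<^sup>2 / 2))\<^sup>2 = exp (- (cmod (w - z))\<^sup>2)"
    unfolding exp_double[symmetric] by simp_all
  have "(exp (- (cmod w)\<^sup>2 / 2) * cmod (nkernel (Suc m) z w))\<^sup>2 = (rho m (w - z))\<^sup>2"
    unfolding nkernel_weyl weyl_def rho_def norm_mult power_mult_distrib sq
    using norm_exp_weyl[of w z] by (simp add: mult_ac)
  then show ?thesis by (simp add: power2_eq_iff_nonneg)
qed

definition UU :: "(complex \<Rightarrow> complex) \<Rightarrow> complex \<Rightarrow> ennreal" where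
  "UU u w = ennreal (cmod (u w) * exp (- (cmod w)\<^sup>2 / 2))"

lemma UU_measurable [measurable (raw)]:
  assumes [measurable]: "u \<in> borel_measurable borel"
  shows "UU u \<in> borel_measurable borel"
  unfolding UU_def[abs_def] by measurable

lemma UU_sq: assumes u: "u \<in> L2" shows "(\<integral>\<^sup>+w. (UU u w)\<^sup>2 \<partial>lborel) < \<infinity>"
proof -
  have [measurable]: "u \<in> borel_measurable borel" using u by (rule L2_measurable)
  have "integrable lborel (\<lambda>w. (exp (- (cmod w)\<^sup>2) / pi) *\<^sub>R (cmod (u w))\<^sup>2)"
    using L2_integrable[OF u] by (subst (asm) integrable_gauss_iff) auto
  from integrable_mult_right[OF this, of pi]
  have i: "integrable lborel (\<lambda>w. (cmod (u w))\<^sup>2 * exp (- (cmod w)\<^sup>2))" by (simp add: mult.commute)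
  have "(UU u w)\<^sup>2 = ennreal ((cmod (u w))\<^sup>2 * exp (- (cmod w)\<^sup>2))" for w
  proof -
    have "(exp (- (cmod w)\<^sup>2 / 2))\<^sup>2 = exp (- (cmod w)\<^sup>2)" unfolding exp_double[symmetric] by simp
    then show ?thesis by (simp add: UU_def ennreal_power power_mult_distrib)
  qed
  then show ?thesis using i by (simp add: integrable_iff_bounded)
qed

definition NZ :: "nat \<Rightarrow> (complex \<Rightarrow> complex) \<Rightarrow> complex \<Rightarrow> ennreal" where
  "NZ m u z = (\<integral>\<^sup>+w. UU u w * ennreal (rho m (w - z)) \<partial>lborel)"

lemma NZ_measurable [measurable (raw)]:
  assumes [measurable]: "u \<in> borel_measurable borel"
  shows "NZ m u \<in> borel_measurable borel"
proof -
  have [measurable]: "UU u \<in> borel_measurable borel" by (rule UU_measurable) fact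
  have "(\<lambda>z. \<integral>\<^sup>+w. UU u w * ennreal (rho m (w - z)) \<partial>lborel) \<in> borel_measurable borel"
    by (rule lborel.borel_measurable_nn_integral) measurable
  then show ?thesis by (simp add: NZ_def[abs_def])
qed

text \<open>Writing \<open>rho\<close> as a product of two square roots, Cauchy-Schwarz bounds the
  square of the convolution by a convolution of the square, and Fubini evaluates the integral of the
  latter.\<close>

lemma NZ_sq:
  assumes u: "u \<in> L2"
  shows "(\<integral>\<^sup>+z. (NZ m u z)\<^sup>2 \<partial>lborel) < \<infinity>"
proof -
  have [measurable]: "u \<in> borel_measurable borel" using u by (rule L2_measurable)
  have [measurable]: "UU u \<in> borel_measurable borel" by (rule UU_measurable) measurable
  define R where "R = (\<integral>\<^sup>+t. ennreal (rho m t) \<partial>lborel)"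
  have R: "R < \<infinity>" unfolding R_def by (rule rho_finite)
  have sh: "(\<integral>\<^sup>+w. ennreal (rho m (w - z)) \<partial>lborel) = R" for z
    using nn_integral_lborel_shift[of "\<lambda>t. ennreal (rho m t)" "- z"] by (simp add: R_def)
  have cs: "(NZ m u z)\<^sup>2 \<le> (\<integral>\<^sup>+w. (UU u w)\<^sup>2 * ennreal (rho m (w - z)) \<partial>lborel) * R" for z
  proof -
    have "NZ m u z = (\<integral>\<^sup>+w. (UU u w * ennreal (sqrt (rho m (w - z)))) * ennreal (sqrt (rho m (w - z))) \<partial>lborel)"
      unfolding NZ_def by (intro nn_integral_cong) (simp add: mult.assoc ennreal_mult[symmetric])
    then have "(NZ m u z)\<^sup>2 \<le> (\<integral>\<^sup>+w. (UU u w * ennreal (sqrt (rho m (w - z)))) ^ 2 \<partial>lborel) * (\<integral>\<^sup>+w. ennreal (sqrt (rho m (w - z))) ^ 2 \<partial>lborel)"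
      by (simp only:) (rule Cauchy_Schwarz_nn_integral; measurable)
    also have "(\<integral>\<^sup>+w. ennreal (sqrt (rho m (w - z))) ^ 2 \<partial>lborel) = R"
      unfolding sh[of z, symmetric] by (intro nn_integral_cong) (simp add: ennreal_power)
    also have "(\<integral>\<^sup>+w. (UU u w * ennreal (sqrt (rho m (w - z)))) ^ 2 \<partial>lborel) = (\<integral>\<^sup>+w. (UU u w)\<^sup>2 * ennreal (rho m (w - z)) \<partial>lborel)"
      by (intro nn_integral_cong) (simp add: ennreal_power power_mult_distrib)
    finally show ?thesis .
  qed
  have "(\<integral>\<^sup>+z. (NZ m u z)\<^sup>2 \<partial>lborel) \<le> (\<integral>\<^sup>+z. (\<integral>\<^sup>+w. (UU u w)\<^sup>2 * ennreal (rho m (w - z)) \<partial>lborel) * R \<partial>lborel)"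
    by (intro nn_integral_mono cs)
  also have "\<dots> = (\<integral>\<^sup>+z. (\<integral>\<^sup>+w. (UU u w)\<^sup>2 * ennreal (rho m (w - z)) \<partial>lborel) \<partial>lborel) * R"
    by (rule nn_integral_multc) measurable
  also have "(\<integral>\<^sup>+z. (\<integral>\<^sup>+w. (UU u w)\<^sup>2 * ennreal (rho m (w - z)) \<partial>lborel) \<partial>lborel) = (\<integral>\<^sup>+w. (\<integral>\<^sup>+z. (UU u w)\<^sup>2 * ennreal (rho m (w - z)) \<partial>lborel) \<partial>lborel)"
    by (rule lborel_pair.Fubini') measurable
  also have "\<dots> = (\<integral>\<^sup>+w. (UU u w)\<^sup>2 * R \<partial>lborel)"
  proof (rule nn_integral_cong)
    fix w
    have "(\<integral>\<^sup>+z. (UU u w)\<^sup>2 * ennreal (rho m (w - z)) \<partial>lborel) = (UU u w)\<^sup>2 * (\<integral>\<^sup>+z. ennreal (rho m (w - z)) \<partial>lborel)"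
      by (rule nn_integral_cmult) measurable
    also have "(\<integral>\<^sup>+z. ennreal (rho m (w - z)) \<partial>lborel) = R" unfolding rho_minus[of m w] by (rule sh)
    finally show "(\<integral>\<^sup>+z. (UU u w)\<^sup>2 * ennreal (rho m (w - z)) \<partial>lborel) = (UU u w)\<^sup>2 * R" .
  qed
  also have "\<dots> = (\<integral>\<^sup>+w. (UU u w)\<^sup>2 \<partial>lborel) * R" by (rule nn_integral_multc) measurable
  also have "(\<integral>\<^sup>+w. (UU u w)\<^sup>2 \<partial>lborel) * R * R < \<infinity>"
    using UU_sq[OF u] R by (simp add: ennreal_mult_less_top)
  finally show ?thesis .
qed

lemma nkernel_measurable [measurable]: "nkernel (Suc m) z \<in> borel_measurable borel"
  by (rule L2_measurable[OF true_fock_L2[OF nkernel_true_fock]])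

lemma nkernel_measurable2 [measurable]: "(\<lambda>(z, w). nkernel (Suc m) z w) \<in> borel_measurable (borel \<Otimes>\<^sub>M borel)"
  unfolding nkernel_weyl weyl_def by measurable

lemma nn_ip_nkernel:
  assumes [measurable]: "u \<in> borel_measurable borel"
  shows "(\<integral>\<^sup>+w. ennreal (cmod (u w * cnj (nkernel (Suc m) z w))) \<partial>gauss) = ennreal (1 / pi) * NZ m u z"
proof -
  have "(\<integral>\<^sup>+w. ennreal (cmod (u w * cnj (nkernel (Suc m) z w))) \<partial>gauss) = (\<integral>\<^sup>+w. ennreal (exp (- (cmod w)\<^sup>2) / pi) * ennreal (cmod (u w * cnj (nkernel (Suc m) z w))) \<partial>lborel)"
    by (rule nn_integral_gauss) measurable
  also have "\<dots> = (\<integral>\<^sup>+w. ennreal (1 / pi) * (UU u w * ennreal (rho m (w - z))) \<partial>lborel)"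
  proof (rule nn_integral_cong)
    fix w
    have e: "exp (- (cmod w)\<^sup>2) = exp (- (cmod w)\<^sup>2 / 2) * exp (- (cmod w)\<^sup>2 / 2)" unfolding exp_add[symmetric] by simp
    have "exp (- (cmod w)\<^sup>2) / pi * cmod (u w * cnj (nkernel (Suc m) z w)) = 1 / pi * (cmod (u w) * exp (- (cmod w)\<^sup>2 / 2) * rho m (w - z))"
      unfolding e norm_nkernel[symmetric] by (simp add: norm_mult)
    then show "ennreal (exp (- (cmod w)\<^sup>2) / pi) * ennreal (cmod (u w * cnj (nkernel (Suc m) z w))) = ennreal (1 / pi) * (UU u w * ennreal (rho m (w - z)))"
      unfolding UU_def by (simp only: ennreal_mult[symmetric] mult_nonneg_nonneg norm_ge_zero exp_ge_zero rho_nonneg divide_nonneg_nonneg pi_ge_zero zero_le_one)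
  qed
  also have "\<dots> = ennreal (1 / pi) * NZ m u z"
    unfolding NZ_def by (rule nn_integral_cmult) measurable
  finally show ?thesis .
qed

lemma fockproj_measurable: "u \<in> L2 \<Longrightarrow> fockproj m u \<in> borel_measurable borel"
  by (rule borel_measurable_continuous_onI[OF polyan_continuous[OF fockproj_polyan]])

lemma fockproj_L2: assumes u: "u \<in> L2" shows "fockproj m u \<in> L2"
proof -
  have um[measurable]: "u \<in> borel_measurable borel" using u by (rule L2_measurable)
  have [measurable]: "fockproj m u \<in> borel_measurable borel" by (rule fockproj_measurable[OF u])
  have b: "ennreal (cmod (ip u (nkernel (Suc m) z))) \<le> ennreal (1 / pi) * NZ m u z" for z
    unfolding nn_ip_nkernel[OF um, symmetric] ip_def
    by (rule integral_norm_bound_ennreal) (rule L2_ip_integrable[OF u true_fock_L2[OF nkernel_true_fock]])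
  have "(\<integral>\<^sup>+z. ennreal ((cmod (fockproj m u z))\<^sup>2) \<partial>gauss) = (\<integral>\<^sup>+z. ennreal (exp (- (cmod z)\<^sup>2) / pi) * ennreal ((cmod (fockproj m u z))\<^sup>2) \<partial>lborel)"
    by (rule nn_integral_gauss) measurable
  also have "\<dots> \<le> (\<integral>\<^sup>+z. ennreal (1 / (pi * (lagc m)\<^sup>2)) * (ennreal (1 / pi) * NZ m u z)\<^sup>2 \<partial>lborel)"
  proof (rule nn_integral_mono)
    fix z
    have e: "(exp ((cmod z)\<^sup>2 / 2))\<^sup>2 = exp ((cmod z)\<^sup>2)" unfolding exp_double[symmetric] by simp
    have "exp (- (cmod z)\<^sup>2) / pi * (cmod (fockproj m u z))\<^sup>2 = (exp (- (cmod z)\<^sup>2) * exp ((cmod z)\<^sup>2)) / (pi * (lagc m)\<^sup>2) * (cmod (ip u (nkernel (Suc m) z)))\<^sup>2"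
    proof -
      have n: "cmod (complex_of_real (exp ((cmod z)\<^sup>2 / 2) / lagc m)) = exp ((cmod z)\<^sup>2 / 2) / lagc m"
        using lagc_pos[of m] by (simp only: norm_of_real) simp
      show ?thesis unfolding fockproj_def norm_mult n power_mult_distrib power_divide e by simp
    qed
    also have "exp (- (cmod z)\<^sup>2) * exp ((cmod z)\<^sup>2) = 1" unfolding exp_add[symmetric] by simp
    finally have "ennreal (exp (- (cmod z)\<^sup>2) / pi) * ennreal ((cmod (fockproj m u z))\<^sup>2) = ennreal (1 / (pi * (lagc m)\<^sup>2)) * (ennreal (cmod (ip u (nkernel (Suc m) z))))\<^sup>2"
      by (simp add: ennreal_mult[symmetric] ennreal_power)
    also have "\<dots> \<le> ennreal (1 / (pi * (lagc m)\<^sup>2)) * (ennreal (1 / pi) * NZ m u z)\<^sup>2"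
      by (intro mult_left_mono power_mono b) auto
    finally show "ennreal (exp (- (cmod z)\<^sup>2) / pi) * ennreal ((cmod (fockproj m u z))\<^sup>2) \<le> ennreal (1 / (pi * (lagc m)\<^sup>2)) * (ennreal (1 / pi) * NZ m u z)\<^sup>2" .
  qed
  also have "\<dots> = (\<integral>\<^sup>+z. (ennreal (1 / (pi * (lagc m)\<^sup>2)) * (ennreal (1 / pi))\<^sup>2) * (NZ m u z)\<^sup>2 \<partial>lborel)"
    by (simp add: power_mult_distrib mult.assoc)
  also have "\<dots> = (ennreal (1 / (pi * (lagc m)\<^sup>2)) * (ennreal (1 / pi))\<^sup>2) * (\<integral>\<^sup>+z. (NZ m u z)\<^sup>2 \<partial>lborel)"
    by (rule nn_integral_cmult) measurable
  also have "\<dots> < \<infinity>" using NZ_sq[OF u, of m] by (simp add: ennreal_mult_less_top ennreal_power)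
  finally have "integrable gauss (\<lambda>z. (cmod (fockproj m u z))\<^sup>2)"
    by (intro integrableI_nonneg) auto
  then show ?thesis by (simp add: L2_def)
qed

text \<open>Multiplying by \<open>exp ((cmod z)\<^sup>2 / 2)\<close> undoes the normalisation of the
  kernel; what remains, L_m(|w - z|^2) exp(w cnj z), is Hermitian.\<close>

lemma nkernel_swap: "of_real (exp ((cmod z)\<^sup>2 / 2)) * cnj (nkernel (Suc m) z w) = of_real (exp ((cmod w)\<^sup>2 / 2)) * nkernel (Suc m) w z"
proof -
  have "lag m (w - z) = lag m (z - w)" "cnj (lag m (w - z)) = lag m (w - z)" by (simp_all add: lag_def norm_minus_commute)
  moreover have "of_real (exp ((cmod z)\<^sup>2 / 2)) * cnj (exp (w * cnj z - of_real ((cmod z)\<^sup>2 / 2))) = of_real (exp ((cmod w)\<^sup>2 / 2)) * exp (z * cnj w - of_real ((cmod w)\<^sup>2 / 2))"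
    unfolding exp_of_real[symmetric] exp_cnj exp_add[symmetric] by (simp add: mult.commute)
  ultimately show ?thesis unfolding nkernel_weyl weyl_def by (simp add: mult.assoc[symmetric])
qed

text \<open>Hermitian symmetry of the kernel and Fubini. The double integral converges absolutely by
  Cauchy-Schwarz for \<open>UU v\<close> and \<open>NZ m u\<close>.\<close>

lemma fockproj_symmetric:
  assumes u: "u \<in> L2" and v: "v \<in> L2"
  shows "ip (fockproj m u) v = ip u (fockproj m v)"
proof -
  interpret P: pair_sigma_finite gauss gauss ..
  have um[measurable]: "u \<in> borel_measurable borel" and vm[measurable]: "v \<in> borel_measurable borel"
    using u v by (auto intro: L2_measurable)
  define f where "f = (\<lambda>(z, w). of_real (exp ((cmod z)\<^sup>2 / 2)) * (u w * cnj (nkernel (Suc m) z w)) * cnj (v z))"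
  have fm[measurable]: "f \<in> borel_measurable (gauss \<Otimes>\<^sub>M gauss)" unfolding f_def by measurable
  have "integrable (gauss \<Otimes>\<^sub>M gauss) f"
  proof (rule integrableI_bounded[OF fm])
    have "(\<integral>\<^sup>+x. ennreal (norm (f x)) \<partial>(gauss \<Otimes>\<^sub>M gauss)) = (\<integral>\<^sup>+z. (\<integral>\<^sup>+w. ennreal (norm (f (z, w))) \<partial>gauss) \<partial>gauss)"
      by (rule gauss.nn_integral_fst[symmetric]) measurable
    also have "\<dots> = (\<integral>\<^sup>+z. ennreal (exp ((cmod z)\<^sup>2 / 2) * cmod (v z)) * (ennreal (1 / pi) * NZ m u z) \<partial>gauss)"
    proof (rule nn_integral_cong)
      fix z
      have "(\<integral>\<^sup>+w. ennreal (norm (f (z, w))) \<partial>gauss) = (\<integral>\<^sup>+w. ennreal (exp ((cmod z)\<^sup>2 / 2) * cmod (v z)) * ennreal (cmod (u w * cnj (nkernel (Suc m) z w))) \<partial>gauss)"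
        by (intro nn_integral_cong) (simp add: f_def norm_mult ennreal_mult[symmetric] mult_ac)
      also have "\<dots> = ennreal (exp ((cmod z)\<^sup>2 / 2) * cmod (v z)) * (\<integral>\<^sup>+w. ennreal (cmod (u w * cnj (nkernel (Suc m) z w))) \<partial>gauss)"
        by (rule nn_integral_cmult) measurable
      finally show "(\<integral>\<^sup>+w. ennreal (norm (f (z, w))) \<partial>gauss) = ennreal (exp ((cmod z)\<^sup>2 / 2) * cmod (v z)) * (ennreal (1 / pi) * NZ m u z)"
        unfolding nn_ip_nkernel[OF um] .
    qed
    also have "\<dots> = (\<integral>\<^sup>+z. ennreal (exp (- (cmod z)\<^sup>2) / pi) * (ennreal (exp ((cmod z)\<^sup>2 / 2) * cmod (v z)) * (ennreal (1 / pi) * NZ m u z)) \<partial>lborel)"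
      by (rule nn_integral_gauss) measurable
    also have "\<dots> = (\<integral>\<^sup>+z. ennreal (1 / pi\<^sup>2) * (UU v z * NZ m u z) \<partial>lborel)"
    proof (rule nn_integral_cong)
      fix z
      have e: "exp (- (cmod z)\<^sup>2) * exp ((cmod z)\<^sup>2 / 2) = exp (- (cmod z)\<^sup>2 / 2)" unfolding exp_add[symmetric] by simp
      have "exp (- (cmod z)\<^sup>2) / pi * (exp ((cmod z)\<^sup>2 / 2) * cmod (v z)) * (1 / pi) = (exp (- (cmod z)\<^sup>2) * exp ((cmod z)\<^sup>2 / 2)) * cmod (v z) / pi\<^sup>2"
        by (simp add: power2_eq_square)
      also have "\<dots> = 1 / pi\<^sup>2 * (cmod (v z) * exp (- (cmod z)\<^sup>2 / 2))" unfolding e by simp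
      finally have "ennreal (exp (- (cmod z)\<^sup>2) / pi) * ennreal (exp ((cmod z)\<^sup>2 / 2) * cmod (v z)) * ennreal (1 / pi) = ennreal (1 / pi\<^sup>2) * UU v z"
        unfolding UU_def by (simp add: ennreal_mult[symmetric])
      then show "ennreal (exp (- (cmod z)\<^sup>2) / pi) * (ennreal (exp ((cmod z)\<^sup>2 / 2) * cmod (v z)) * (ennreal (1 / pi) * NZ m u z)) = ennreal (1 / pi\<^sup>2) * (UU v z * NZ m u z)"
        by (metis mult.assoc)
    qed
    also have "\<dots> = ennreal (1 / pi\<^sup>2) * (\<integral>\<^sup>+z. UU v z * NZ m u z \<partial>lborel)" by (rule nn_integral_cmult) measurable
    also have "\<dots> < \<infinity>"
    proof -
      have "(\<integral>\<^sup>+z. UU v z * NZ m u z \<partial>lborel)\<^sup>2 \<le> (\<integral>\<^sup>+z. (UU v z)\<^sup>2 \<partial>lborel) * (\<integral>\<^sup>+z. (NZ m u z)\<^sup>2 \<partial>lborel)"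
        by (rule Cauchy_Schwarz_nn_integral) measurable
      also have "\<dots> < \<infinity>" using UU_sq[OF v] NZ_sq[OF u, of m] by (simp add: ennreal_mult_less_top)
      finally have "(\<integral>\<^sup>+z. UU v z * NZ m u z \<partial>lborel) < \<infinity>"
        by (simp add: power2_eq_square ennreal_mult_less_top less_top[symmetric] ennreal_mult_eq_top_iff)
      then show ?thesis by (simp add: ennreal_mult_less_top)
    qed
    finally show "(\<integral>\<^sup>+x. ennreal (norm (f x)) \<partial>(gauss \<Otimes>\<^sub>M gauss)) < \<infinity>" .
  qed
  then have i: "integrable (gauss \<Otimes>\<^sub>M gauss) (\<lambda>(z, w). f (z, w))" by simp
  have "ip (fockproj m u) v = (\<integral>z. (1 / of_real (lagc m)) * (\<integral>w. f (z, w) \<partial>gauss) \<partial>gauss)"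
    unfolding ip_def[of "fockproj m u"]
  proof (rule Bochner_Integration.integral_cong[OF refl])
    fix z
    have "(\<integral>w. f (z, w) \<partial>gauss) = of_real (exp ((cmod z)\<^sup>2 / 2)) * ip u (nkernel (Suc m) z) * cnj (v z)"
      unfolding f_def ip_def by simp
    then show "fockproj m u z * cnj (v z) = (1 / of_real (lagc m)) * (\<integral>w. f (z, w) \<partial>gauss)"
      by (simp add: fockproj_def)
  qed
  also have "\<dots> = (1 / of_real (lagc m)) * (\<integral>z. (\<integral>w. f (z, w) \<partial>gauss) \<partial>gauss)" by (rule integral_mult_right_zero)
  also have "(\<integral>z. (\<integral>w. f (z, w) \<partial>gauss) \<partial>gauss) = (\<integral>w. (\<integral>z. f (z, w) \<partial>gauss) \<partial>gauss)"
    by (rule P.Fubini_integral[OF i, symmetric])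
  also have "(1 / of_real (lagc m)) * (\<integral>w. (\<integral>z. f (z, w) \<partial>gauss) \<partial>gauss) = (\<integral>w. (1 / of_real (lagc m)) * (\<integral>z. f (z, w) \<partial>gauss) \<partial>gauss)"
    by (rule integral_mult_right_zero[symmetric])
  also have "\<dots> = ip u (fockproj m v)"
    unfolding ip_def[of u]
  proof (rule Bochner_Integration.integral_cong[OF refl])
    fix w
    have "f (z, w) = (u w * of_real (exp ((cmod w)\<^sup>2 / 2))) * cnj (v z * cnj (nkernel (Suc m) w z))" for z
    proof -
      have "f (z, w) = u w * cnj (v z) * (of_real (exp ((cmod z)\<^sup>2 / 2)) * cnj (nkernel (Suc m) z w))"
        by (simp add: f_def mult_ac)
      then show ?thesis unfolding nkernel_swap by (simp add: mult_ac)
    qed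
    then have "(\<integral>z. f (z, w) \<partial>gauss) = (u w * of_real (exp ((cmod w)\<^sup>2 / 2))) * cnj (ip v (nkernel (Suc m) w))"
      by (simp only: ip_def integral_mult_right_zero Bochner_Integration.integral_cnj)
    then show "(1 / of_real (lagc m)) * (\<integral>z. f (z, w) \<partial>gauss) = u w * cnj (fockproj m v w)"
      by (simp add: fockproj_def)
  qed
  finally show ?thesis .
qed

lemma fockproj_true_fock_id: assumes "v \<in> true_fock (Suc m)" shows "fockproj m v = v"
proof
  fix z
  have "exp ((cmod z)\<^sup>2 / 2) / lagc m * (lagc m * exp (- (cmod z)\<^sup>2 / 2)) = 1"
    using lagc_pos[of m] by (simp add: exp_add[symmetric])
  then have "of_real (exp ((cmod z)\<^sup>2 / 2) / lagc m) * complex_of_real (lagc m * exp (- (cmod z)\<^sup>2 / 2)) = 1"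
    by (simp only: of_real_mult[symmetric] of_real_1)
  then show "fockproj m v z = v z"
    unfolding fockproj_def reproducing[OF assms] mult.assoc[symmetric] by simp
qed

lemma fockproj_fock_0: assumes "v \<in> fock m" shows "fockproj m v = (\<lambda>z. 0)"
proof
  fix z
  have "ip (nkernel (Suc m) z) v = 0" using nkernel_true_fock[of m z] assms by (simp add: true_fock_iff)
  then have "ip v (nkernel (Suc m) z) = 0" using ip_cnj[of "nkernel (Suc m) z" v] by simp
  then show "fockproj m v z = 0" by (simp add: fockproj_def)
qed

lemma fockproj_true_fock: assumes u: "u \<in> L2" shows "fockproj m u \<in> true_fock (Suc m)"
  unfolding true_fock_iff using fockproj_L2[OF u] fockproj_polyan[OF u] fockproj_symmetric[OF u] fock_L2 fockproj_fock_0 by simp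

lemma fockproj_ip: assumes u: "u \<in> L2" and v: "v \<in> true_fock (Suc m)" shows "ip (fockproj m u) v = ip u v"
  using fockproj_symmetric[OF u true_fock_L2[OF v]] fockproj_true_fock_id[OF v] by simp

text \<open>For uniqueness in the definite description: a candidate has the same pairings with the
  kernels as \<open>u\<close>, and by the reproducing property these determine it.\<close>

lemma proj_eq: assumes u: "u \<in> L2" shows "proj (Suc m) u = fockproj m u"
  unfolding proj_def
proof (rule the_equality)
  show "fockproj m u \<in> true_fock (Suc m) \<and> (\<forall>v\<in>true_fock (Suc m). ip (\<lambda>z. u z - fockproj m u z) v = 0)"
    using fockproj_true_fock[OF u] fockproj_ip[OF u] ip_diff_left[OF u fockproj_L2[OF u] true_fock_L2] by auto
  fix h assume h: "h \<in> true_fock (Suc m) \<and> (\<forall>v\<in>true_fock (Suc m). ip (\<lambda>z. u z - h z) v = 0)"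
  have "ip h (nkernel (Suc m) z) = ip u (nkernel (Suc m) z)" for z
  proof -
    have "ip (\<lambda>w. u w - h w) (nkernel (Suc m) z) = 0" using h nkernel_true_fock by blast
    then show ?thesis using u h true_fock_L2[of h m] true_fock_L2[OF nkernel_true_fock[of m z]] by (simp add: ip_diff_left)
  qed
  then have "fockproj m h = fockproj m u" by (simp add: fockproj_def fun_eq_iff)
  then show "h = fockproj m u" using fockproj_true_fock_id h by metis
qed

text \<open>Orthogonality to the Taylor coefficients gives orthogonality to all
  \<open>psi m c\<close> and, by \<open>weyl_psi\<close>, to their translates; hence to the
  translates of \<open>gg m m\<close>, which are the kernels. So the projection of \<open>y\<close>
  is zero. This is the totality of the functions \<open>gg m j\<close>.\<close>

lemma true_fock_ortho:
  assumes y: "y \<in> L2" and z: "\<And>j. ip y (gg m j) = 0" and v: "v \<in> true_fock (Suc m)"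
  shows "ip y v = 0"
proof -
  have yL: "ip (weyl (- z) y) (gg m m) = 0" for z
  proof (rule ip_gg_zero[OF weyl_L2[OF y]])
    fix c
    have "ip y (psi m d) = 0" for d
      using psi_ip_sums[OF y, of d m] z sums_unique2[OF _ sums_zero] by simp
    then have "ip y (weyl z (psi m c)) = 0" unfolding weyl_psi ip_scale_right by simp
    moreover have "ip (weyl (- z) y) (psi m c) = ip y (weyl z (psi m c))"
      using ip_weyl_left[of y "psi m c" "- z"] L2_measurable[OF y] egrow_measurable[OF egrow_psi] by simp
    ultimately show "ip (weyl (- z) y) (psi m c) = 0" by simp
  qed
  have "ip y (nkernel (Suc m) z) = 0" for z
  proof -
    have "ip y (nkernel (Suc m) z) = ip (weyl (- z) y) (lag m)"
      unfolding nkernel_weyl using ip_weyl_left[of y "lag m" "- z"] L2_measurable[OF y] by simp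
    also have "\<dots> = 0" unfolding lag_gg[abs_def] ip_scale_right yL by simp
    finally show ?thesis .
  qed
  then have "fockproj m y = (\<lambda>z. 0)" by (simp add: fockproj_def fun_eq_iff)
  then show ?thesis using fockproj_ip[OF y v] by simp
qed

lemma nrm_mono:
  assumes "f \<in> L2" "g \<in> L2" "\<And>w. cmod (f w) \<le> cmod (g w)"
  shows "nrm f \<le> nrm g"
  unfolding nrm_def
  by (intro real_sqrt_le_mono integral_mono L2_integrable assms power_mono) auto

text \<open>Strong continuity of the Weyl operators on functions of exponential growth: a convergent
  sequence of shifts is bounded by some \<open>K\<close>, which gives one dominating function for
  all the translates.\<close>

lemma weyl_tendsto:
  assumes g: "egrow g" and gc: "continuous_on UNIV g" and c: "X \<longlonglongrightarrow> c"
  shows "(\<lambda>n. nrm (\<lambda>w. weyl (X n) g w - weyl c g w)) \<longlonglongrightarrow> 0"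
proof -
  have [measurable]: "g \<in> borel_measurable borel" by (rule egrow_measurable[OF g])
  have [measurable]: "weyl a g \<in> borel_measurable borel" for a by measurable
  obtain K where K: "\<And>n. cmod (X n) \<le> K" using c convergentI convergent_imp_Bseq BseqE by (metis (no_types, lifting))
  have Kc: "cmod c \<le> K" using c K by (intro tendsto_upperbound[OF tendsto_norm[OF c]]) auto
  have K0: "K \<ge> 0" using Kc norm_ge_zero order_trans by blast
  obtain A R where AR: "A \<ge> 0" "R \<ge> 0" "\<And>z. cmod (g z) \<le> A * exp (R * cmod z)" using egrowE[OF g] by metis
  define b where "b w = A * exp (R * K) * exp ((K + R) * cmod w)" for w :: complex
  have wb: "cmod (weyl a g w) \<le> b w" if a: "cmod a \<le> K" for a w
  proof -
    have "cmod (exp (w * cnj a - of_real ((cmod a)\<^sup>2 / 2))) \<le> exp (K * cmod w)"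
    proof -
      have "Re (w * cnj a - of_real ((cmod a)\<^sup>2 / 2)) \<le> Re (w * cnj a)" by simp
      also have "\<dots> \<le> cmod w * cmod a" using complex_Re_le_cmod[of "w * cnj a"] by (simp add: norm_mult)
      also have "\<dots> \<le> cmod w * K" using a by (intro mult_left_mono) auto
      finally show ?thesis unfolding norm_exp_eq_Re exp_le_cancel_iff by (simp add: mult.commute)
    qed
    moreover have "cmod (g (w - a)) \<le> A * exp (R * K) * exp (R * cmod w)"
    proof -
      have "R * cmod (w - a) \<le> R * K + R * cmod w"
        unfolding distrib_left[symmetric] using AR a norm_triangle_ineq4[of w a] by (intro mult_left_mono) linarith+
      then have "A * exp (R * cmod (w - a)) \<le> A * exp (R * K + R * cmod w)" using AR by (intro mult_left_mono) auto
      then show ?thesis using AR(3)[of "w - a"] by (simp add: exp_add mult.assoc)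
    qed
    ultimately have "cmod (weyl a g w) \<le> exp (K * cmod w) * (A * exp (R * K) * exp (R * cmod w))"
      unfolding weyl_def norm_mult by (intro mult_mono) auto
    also have "\<dots> = b w" unfolding b_def distrib_right exp_add by (simp add: mult_ac)
    finally show ?thesis .
  qed
  have bE: "egrow (\<lambda>w. complex_of_real (b w))"
    by (rule egrowI[where A = "A * exp (R * K)" and R = "K + R"]) (use AR in \<open>auto simp: b_def norm_mult\<close>)
  have "(\<lambda>n. \<integral>w. (cmod (weyl (X n) g w - weyl c g w))\<^sup>2 \<partial>gauss) \<longlonglongrightarrow> (\<integral>w. 0 \<partial>gauss)"
  proof (rule integral_dominated_convergence)
    show "integrable gauss (\<lambda>w. 4 * (cmod (complex_of_real (b w)))\<^sup>2)"
      by (intro integrable_mult_right L2_integrable egrow_L2 bE)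
    show "AE w in gauss. (\<lambda>n. (cmod (weyl (X n) g w - weyl c g w))\<^sup>2) \<longlonglongrightarrow> 0"
    proof (rule AE_I2)
      fix w
      have "(\<lambda>n. g (w - X n)) \<longlonglongrightarrow> g (w - c)"
        by (rule continuous_on_tendsto_compose[OF gc]) (auto intro: tendsto_intros c)
      then have "(\<lambda>n. (cmod (weyl (X n) g w - weyl c g w))\<^sup>2) \<longlonglongrightarrow> (cmod (weyl c g w - weyl c g w))\<^sup>2"
        unfolding weyl_def by (intro tendsto_intros c) auto
      then show "(\<lambda>n. (cmod (weyl (X n) g w - weyl c g w))\<^sup>2) \<longlonglongrightarrow> 0" by simp
    qed
    show "AE w in gauss. norm ((cmod (weyl (X n) g w - weyl c g w))\<^sup>2) \<le> 4 * (cmod (complex_of_real (b w)))\<^sup>2" for n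
    proof (rule AE_I2)
      fix w
      have "cmod (weyl (X n) g w - weyl c g w) \<le> 2 * b w"
        using norm_triangle_ineq4[of "weyl (X n) g w" "weyl c g w"] wb[OF K[of n], of w] wb[OF Kc, of w] by linarith
      then have "(cmod (weyl (X n) g w - weyl c g w))\<^sup>2 \<le> (2 * b w)\<^sup>2" by (intro power_mono) auto
      then show "norm ((cmod (weyl (X n) g w - weyl c g w))\<^sup>2) \<le> 4 * (cmod (complex_of_real (b w)))\<^sup>2"
        by (simp add: power_mult_distrib)
    qed
  qed measurable
  then have "(\<lambda>n. (nrm (\<lambda>w. weyl (X n) g w - weyl c g w))\<^sup>2) \<longlonglongrightarrow> 0" by (simp add: nrm_sq)
  then have "(\<lambda>n. sqrt ((nrm (\<lambda>w. weyl (X n) g w - weyl c g w))\<^sup>2)) \<longlonglongrightarrow> sqrt 0" by (intro tendsto_real_sqrt)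
  then show ?thesis by simp
qed

lemma continuous_gg: "continuous_on UNIV (gg m j)"
  using gg_true_fock[of m j] polyan_continuous[of "Suc m" "gg m j"] by (simp add: true_fock_iff)

lemma gg_0: "gg m 0 = psi m 0"
  by (auto simp: gg_def psi_def fun_eq_iff sum.delta' split: if_splits cong: sum.cong if_cong)

text \<open>Compare coefficients in the Cauchy product of the series of \<open>X\<close> with the
  exponential series. The factor exp(r^2) comes from the normalisation of
  \<open>psi\<close>.\<close>

lemma power_series_coeff_transfer:
  fixes u v :: "nat \<Rightarrow> complex"
  assumes u: "\<And>r. r \<ge> 0 \<Longrightarrow> (\<lambda>j. u j / fact j * of_real (r\<^sup>2) ^ j) sums (of_real (exp (r\<^sup>2)) * X r)"
    and v: "\<And>r. r \<ge> 0 \<Longrightarrow> (\<lambda>n. v n * of_real (r\<^sup>2) ^ n) sums X r"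
  shows "u k = (\<Sum>n\<le>k. fact k / fact (k - n) * v n)"
proof -
  have norms: "summable (\<lambda>n. norm (a n) * R ^ n)" if "R \<ge> 0" and a: "\<And>r::real. r \<ge> 0 \<Longrightarrow> summable (\<lambda>n. a n * of_real (r\<^sup>2) ^ n)" for a :: "nat \<Rightarrow> complex" and R
  proof -
    have "summable (\<lambda>n. a n * (of_real (R + 1)) ^ n)" using a[of "sqrt (R + 1)"] that by simp
    then have "summable (\<lambda>n. norm (a n * (of_real R) ^ n))" by (rule powser_insidea) (use that in simp)
    then show ?thesis using that by (simp add: norm_mult norm_power)
  qed
  have nv: "summable (\<lambda>n. norm (v n) * R ^ n)" if "R \<ge> 0" for R
    by (rule norms[OF that]) (use v sums_summable in blast)
  have nu: "summable (\<lambda>n. norm (u n / fact n) * R ^ n)" if "R \<ge> 0" for R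
    by (rule norms[OF that]) (use u sums_summable in blast)
  define d where "d k = (\<Sum>n\<le>k. v n * (1 / fact (k - n)))" for k
  have ds: "(\<lambda>k. d k * of_real (r\<^sup>2) ^ k) sums (of_real (exp (r\<^sup>2)) * X r)" if r: "r \<ge> 0" for r
  proof -
    have "summable (\<lambda>n. norm (v n * of_real (r\<^sup>2) ^ n))" using nv[of "r\<^sup>2"] by (simp add: norm_mult norm_power)
    moreover have "summable (\<lambda>n. norm (complex_of_real (r\<^sup>2) ^ n /\<^sub>R fact n))" by (rule summable_norm_exp)
    ultimately have "(\<lambda>k. \<Sum>i\<le>k. (v i * of_real (r\<^sup>2) ^ i) * (complex_of_real (r\<^sup>2) ^ (k - i) /\<^sub>R fact (k - i))) sums
       ((\<Sum>n. v n * of_real (r\<^sup>2) ^ n) * (\<Sum>n. complex_of_real (r\<^sup>2) ^ n /\<^sub>R fact n))"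
      by (rule Cauchy_product_sums)
    moreover have "(\<Sum>n. v n * of_real (r\<^sup>2) ^ n) = X r" using sums_unique[OF v[OF r]] ..
    moreover have "(\<Sum>n. complex_of_real (r\<^sup>2) ^ n /\<^sub>R fact n) = of_real (exp (r\<^sup>2))"
      using sums_unique[OF exp_converges[of "complex_of_real (r\<^sup>2)"]] by (simp only: exp_of_real)
    moreover have "(\<Sum>i\<le>k. (v i * of_real (r\<^sup>2) ^ i) * (complex_of_real (r\<^sup>2) ^ (k - i) /\<^sub>R fact (k - i))) = d k * of_real (r\<^sup>2) ^ k" for k
      unfolding d_def sum_distrib_right
    proof (intro sum.cong refl)
      fix i assume "i \<in> {..k}"
      then have "complex_of_real (r\<^sup>2) ^ k = of_real (r\<^sup>2) ^ i * of_real (r\<^sup>2) ^ (k - i)" by (simp flip: power_add)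
      then show "v i * of_real (r\<^sup>2) ^ i * (complex_of_real (r\<^sup>2) ^ (k - i) /\<^sub>R fact (k - i)) = v i * (1 / fact (k - i)) * of_real (r\<^sup>2) ^ k"
        by (simp add: scaleR_conv_of_real divide_inverse)
    qed
    ultimately show ?thesis by (simp add: mult.commute)
  qed
  have nd: "summable (\<lambda>n. norm (d n) * R ^ n)" if "R \<ge> 0" for R
    by (rule norms[OF that]) (use ds sums_summable in blast)
  have "u k / fact k - d k = 0"
  proof (rule power_series_zero_pos[of "\<lambda>k. u k / fact k - d k"])
    fix R :: real assume R: "R \<ge> 0"
    show "summable (\<lambda>n. norm (u n / fact n - d n) * R ^ n)"
    proof (rule summable_comparison_test'[OF summable_add[OF nu[OF R] nd[OF R]]])
      fix n
      have "norm (u n / fact n - d n) * R ^ n \<le> (norm (u n / fact n) + norm (d n)) * R ^ n"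
        using R by (intro mult_right_mono norm_triangle_ineq4) auto
      then show "norm (norm (u n / fact n - d n) * R ^ n) \<le> norm (u n / fact n) * R ^ n + norm (d n) * R ^ n"
        using R by (simp add: distrib_right)
    qed
  next
    fix s :: real assume s: "s > 0"
    have "(\<lambda>n. u n / fact n * of_real ((sqrt s)\<^sup>2) ^ n - d n * of_real ((sqrt s)\<^sup>2) ^ n) sums 0"
      using sums_diff[OF u[of "sqrt s"] ds[of "sqrt s"]] s by simp
    then have "(\<lambda>n. (u n / fact n - d n) * of_real s ^ n) sums 0" using s by (simp add: left_diff_distrib)
    then show "(\<Sum>n. (u n / fact n - d n) * of_real s ^ n) = 0" by (rule sums_unique[symmetric])
  qed
  then show ?thesis by (simp add: d_def sum_distrib_left field_simps)
qed

section \<open>Bounded sesquilinear forms on the true Fock space\<close>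

text \<open>Forms instead of operators: for a Toeplitz operator the form is an integral against the
  symbol in which the projection has disappeared, and the difference of two bounded operators is
  covered as well.\<close>

locale fock_form =
  fixes m :: nat and B :: "(complex \<Rightarrow> complex) \<Rightarrow> (complex \<Rightarrow> complex) \<Rightarrow> complex" and C :: real
  assumes add_left: "\<And>u v w. u \<in> true_fock (Suc m) \<Longrightarrow> v \<in> true_fock (Suc m) \<Longrightarrow> w \<in> true_fock (Suc m) \<Longrightarrow>
      B (\<lambda>z. u z + v z) w = B u w + B v w"
    and scale_left: "\<And>c u w. u \<in> true_fock (Suc m) \<Longrightarrow> w \<in> true_fock (Suc m) \<Longrightarrow> B (\<lambda>z. c * u z) w = c * B u w"
    and add_right: "\<And>u v w. u \<in> true_fock (Suc m) \<Longrightarrow> v \<in> true_fock (Suc m) \<Longrightarrow> w \<in> true_fock (Suc m) \<Longrightarrow>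
      B w (\<lambda>z. u z + v z) = B w u + B w v"
    and scale_right: "\<And>c u w. u \<in> true_fock (Suc m) \<Longrightarrow> w \<in> true_fock (Suc m) \<Longrightarrow> B w (\<lambda>z. c * u z) = cnj c * B w u"
    and bound: "\<And>u v. u \<in> true_fock (Suc m) \<Longrightarrow> v \<in> true_fock (Suc m) \<Longrightarrow> cmod (B u v) \<le> C * (nrm u * nrm v)"
    and C_nonneg: "C \<ge> 0"
begin

lemma zero_left: "w \<in> true_fock (Suc m) \<Longrightarrow> B (\<lambda>z. 0) w = 0"
  using scale_left[of "\<lambda>z. 0" w 0] true_fock_0 by simp
lemma zero_right: "w \<in> true_fock (Suc m) \<Longrightarrow> B w (\<lambda>z. 0) = 0"
  using scale_right[of "\<lambda>z. 0" w 0] true_fock_0 by simp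

lemma diff_left: "u \<in> true_fock (Suc m) \<Longrightarrow> v \<in> true_fock (Suc m) \<Longrightarrow> w \<in> true_fock (Suc m) \<Longrightarrow>
      B (\<lambda>z. u z - v z) w = B u w - B v w"
  using add_left[of u "\<lambda>z. (-1) * v z" w] scale_left[of v w "-1"] true_fock_scale[of v m "-1"] by simp
lemma diff_right: "u \<in> true_fock (Suc m) \<Longrightarrow> v \<in> true_fock (Suc m) \<Longrightarrow> w \<in> true_fock (Suc m) \<Longrightarrow>
      B w (\<lambda>z. u z - v z) = B w u - B w v"
  using add_right[of u "\<lambda>z. (-1) * v z" w] scale_right[of v w "-1"] true_fock_scale[of v m "-1"] by simp

lemma sum_left: "(\<And>i. i \<in> S \<Longrightarrow> f i \<in> true_fock (Suc m)) \<Longrightarrow> w \<in> true_fock (Suc m) \<Longrightarrow>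
   B (\<lambda>z. \<Sum>i\<in>S. c i * f i z) w = (\<Sum>i\<in>S. c i * B (f i) w)"
  by (induction S rule: infinite_finite_induct)
    (auto simp: zero_left add_left scale_left true_fock_scale true_fock_sum)
lemma sum_right: "(\<And>i. i \<in> S \<Longrightarrow> f i \<in> true_fock (Suc m)) \<Longrightarrow> w \<in> true_fock (Suc m) \<Longrightarrow>
   B w (\<lambda>z. \<Sum>i\<in>S. c i * f i z) = (\<Sum>i\<in>S. cnj (c i) * B w (f i))"
  by (induction S rule: infinite_finite_induct)
    (auto simp: zero_right add_right scale_right true_fock_scale true_fock_sum)

lemma form_tendsto:
  assumes u: "\<And>n. u n \<in> true_fock (Suc m)" "u' \<in> true_fock (Suc m)" "(\<lambda>n. nrm (\<lambda>z. u n z - u' z)) \<longlonglongrightarrow> 0"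
    and v: "\<And>n. v n \<in> true_fock (Suc m)" "v' \<in> true_fock (Suc m)" "(\<lambda>n. nrm (\<lambda>z. v n z - v' z)) \<longlonglongrightarrow> 0"
  shows "(\<lambda>n. B (u n) (v n)) \<longlonglongrightarrow> B u' v'"
proof -
  let ?e = "\<lambda>n. nrm (\<lambda>z. u n z - u' z)" and ?d = "\<lambda>n. nrm (\<lambda>z. v n z - v' z)"
  have bnd: "cmod (B (u n) (v n) - B u' v') \<le> C * (?e n * ?d n) + C * (?e n * nrm v') + C * (nrm u' * ?d n)" for n
  proof -
    have eq: "B (u n) (v n) - B u' v' = B (\<lambda>z. u n z - u' z) (\<lambda>z. v n z - v' z) + B (\<lambda>z. u n z - u' z) v' + B u' (\<lambda>z. v n z - v' z)"
      using u v by (simp add: diff_left diff_right true_fock_diff algebra_simps)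
    have "cmod (B (u n) (v n) - B u' v') \<le> cmod (B (\<lambda>z. u n z - u' z) (\<lambda>z. v n z - v' z)) + cmod (B (\<lambda>z. u n z - u' z) v') + cmod (B u' (\<lambda>z. v n z - v' z))"
    proof -
      have "cmod (x + y + z) \<le> cmod x + cmod y + cmod z" for x y z
        using norm_triangle_ineq[of "x + y" z] norm_triangle_ineq[of x y] by linarith
      then show ?thesis unfolding eq .
    qed
    also have "\<dots> \<le> C * (?e n * ?d n) + C * (?e n * nrm v') + C * (nrm u' * ?d n)"
      using u v by (intro add_mono bound true_fock_diff) auto
    finally show ?thesis .
  qed
  have "(\<lambda>n. C * (?e n * ?d n) + C * (?e n * nrm v') + C * (nrm u' * ?d n)) \<longlonglongrightarrow> C * (0 * 0) + C * (0 * nrm v') + C * (nrm u' * 0)"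
    using u(3) v(3) by (intro tendsto_intros)
  then have lim: "(\<lambda>n. C * (?e n * ?d n) + C * (?e n * nrm v') + C * (nrm u' * ?d n)) \<longlonglongrightarrow> 0" by simp
  have "(\<lambda>n. B (u n) (v n) - B u' v') \<longlonglongrightarrow> 0"
    by (rule Lim_null_comparison[OF always_eventually[OF allI[OF bnd]] lim])
  then show ?thesis by (simp add: LIM_zero_iff)
qed

lemma ppart_true_fock: "ppart m c N \<in> true_fock (Suc m)"
  unfolding ppart_def[abs_def] by (intro true_fock_sum true_fock_scale gg_true_fock)

lemma form_ppart: "B (ppart m c N) (ppart m c N) = (\<Sum>j<N. \<Sum>i<N. cnj c ^ j * c ^ i * B (gg m j) (gg m i))"
proof -
  have "B (ppart m c N) (ppart m c N) = (\<Sum>j<N. cnj c ^ j * B (gg m j) (ppart m c N))"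
    by (subst (1) ppart_def[abs_def]) (rule sum_left[OF gg_true_fock ppart_true_fock])
  also have "\<dots> = (\<Sum>j<N. cnj c ^ j * (\<Sum>i<N. cnj (cnj c ^ i) * B (gg m j) (gg m i)))"
    unfolding ppart_def[abs_def] by (subst sum_right[OF gg_true_fock gg_true_fock]) simp
  finally show ?thesis by (simp add: sum_distrib_left mult_ac)
qed

text \<open>The n-th Fourier coefficient over a circle isolates the n-th off-diagonal of the matrix
  \<open>B (gg m j) (gg m i)\<close>. The majorant bounds the truncated forms uniformly, so
  dominated convergence removes the truncation.\<close>

lemma twisted_mean:
  assumes r: "r \<ge> 0"
  shows "(\<lambda>j. of_real r ^ (2 * j + n) * B (gg m j) (gg m (j + n))) sums
     (\<integral>t. cnj (ucis t) ^ n * B (psi m (of_real r * ucis t)) (psi m (of_real r * ucis t)) \<partial>circ)"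
proof -
  define S where "S N t = B (ppart m (of_real r * ucis t) N) (ppart m (of_real r * ucis t) N)" for N t
  define D where "D = nrm (\<lambda>w. complex_of_real (majorant m r (cmod w)))"
  have lim: "(\<lambda>N. cnj (ucis t) ^ n * S N t) \<longlonglongrightarrow> cnj (ucis t) ^ n * B (psi m (of_real r * ucis t)) (psi m (of_real r * ucis t))" for t
  proof -
    have "(\<lambda>N. nrm (\<lambda>w. ppart m c N w - psi m c w)) \<longlonglongrightarrow> 0" for c
    proof -
      have "nrm (\<lambda>w. ppart m c N w - psi m c w) = nrm (\<lambda>w. psi m c w - ppart m c N w)" for N
        by (simp add: nrm_def norm_minus_commute)
      then show ?thesis using psi_approx[of m c] by simp
    qed
    then show ?thesis unfolding S_def
      by (intro tendsto_mult tendsto_const form_tendsto ppart_true_fock psi_true_fock)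
  qed
  have Sc: "continuous_on UNIV (\<lambda>t. cnj (ucis t) ^ n * S N t)" for N
    unfolding S_def form_ppart by (intro continuous_intros)
  have Sm: "(\<lambda>t. cnj (ucis t) ^ n * S N t) \<in> borel_measurable borel" for N
    by (rule borel_measurable_continuous_onI[OF Sc])
  have Sb: "norm (cnj (ucis t) ^ n * S N t) \<le> C * (D * D)" for N t
  proof -
    have nb: "nrm (ppart m (of_real r * ucis t) N) \<le> D"
      unfolding D_def
    proof (rule nrm_mono[OF ppart_L2 egrow_L2[OF egrow_majorant[OF r]]])
      fix w
      show "cmod (ppart m (of_real r * ucis t) N w) \<le> cmod (complex_of_real (majorant m r (cmod w)))"
        using gg_partial_majorant[of "of_real r * ucis t" m w N] r majorant_nonneg[OF r, of "cmod w" m]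
        by (simp add: ppart_def norm_mult)
    qed
    have "norm (cnj (ucis t) ^ n * S N t) = cmod (S N t)" by (simp add: norm_mult norm_power)
    also have "\<dots> \<le> C * (nrm (ppart m (of_real r * ucis t) N) * nrm (ppart m (of_real r * ucis t) N))"
      unfolding S_def by (intro bound ppart_true_fock)
    also have "\<dots> \<le> C * (D * D)" using C_nonneg nb by (intro mult_left_mono mult_mono) (auto simp: D_def)
    finally show ?thesis .
  qed
  have "(\<lambda>N. \<integral>t. cnj (ucis t) ^ n * S N t \<partial>circ) \<longlonglongrightarrow> (\<integral>t. cnj (ucis t) ^ n * B (psi m (of_real r * ucis t)) (psi m (of_real r * ucis t)) \<partial>circ)"
  proof (rule integral_dominated_convergence[where w = "\<lambda>t. C * (D * D)"])
    show "(\<lambda>t. cnj (ucis t) ^ n * B (psi m (of_real r * ucis t)) (psi m (of_real r * ucis t))) \<in> borel_measurable circ"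
      using borel_measurable_LIMSEQ_metric[OF Sm lim] by simp
  qed (use Sm Sb lim in auto)
  \<comment> \<open>Truncation at \<open>N + n\<close> makes the surviving index
    \<open>i = j + n\<close> available exactly for \<open>j < N\<close>.\<close>
  moreover have "(\<integral>t. cnj (ucis t) ^ n * S (N + n) t \<partial>circ) = (\<Sum>j<N. of_real r ^ (2 * j + n) * B (gg m j) (gg m (j + n)))" for N
  proof -
    have "cnj (ucis t) ^ n * S (N + n) t = (\<Sum>j<N + n. \<Sum>i<N + n. (of_real r ^ (j + i) * B (gg m j) (gg m i)) * (ucis t ^ i * cnj (ucis t) ^ (j + n)))" for t
      unfolding S_def form_ppart sum_distrib_left
      by (intro sum.cong refl) (simp add: power_mult_distrib power_add mult_ac)
    then have "(\<integral>t. cnj (ucis t) ^ n * S (N + n) t \<partial>circ) = (\<integral>t. (\<Sum>j<N + n. \<Sum>i<N + n. (of_real r ^ (j + i) * B (gg m j) (gg m i)) * (ucis t ^ i * cnj (ucis t) ^ (j + n))) \<partial>circ)"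
      by simp
    also have "\<dots> = (\<Sum>j<N + n. \<Sum>i<N + n. (of_real r ^ (j + i) * B (gg m j) (gg m i)) * (\<integral>t. ucis t ^ i * cnj (ucis t) ^ (j + n) \<partial>circ))"
      by (simp add: Bochner_Integration.integral_sum integrable_circ_continuous continuous_intros)
    also have "\<dots> = (\<Sum>j<N + n. \<Sum>i<N + n. if i = j + n then of_real r ^ (j + i) * B (gg m j) (gg m i) else 0)"
      by (intro sum.cong refl) (simp add: circ_integral_ucis)
    also have "\<dots> = (\<Sum>j<N + n. if j < N then of_real r ^ (2 * j + n) * B (gg m j) (gg m (j + n)) else 0)"
    proof (intro sum.cong refl)
      fix j
      have "(\<Sum>i<N + n. if i = j + n then of_real r ^ (j + i) * B (gg m j) (gg m i) else 0) =
        (if j + n < N + n then of_real r ^ (j + (j + n)) * B (gg m j) (gg m (j + n)) else 0)"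
        by (subst sum.delta) auto
      also have "j + (j + n) = 2 * j + n" by simp
      finally show "(\<Sum>i<N + n. if i = j + n then of_real r ^ (j + i) * B (gg m j) (gg m i) else 0) =
        (if j < N then of_real r ^ (2 * j + n) * B (gg m j) (gg m (j + n)) else 0)" by simp
    qed
    also have "\<dots> = (\<Sum>j<N. of_real r ^ (2 * j + n) * B (gg m j) (gg m (j + n)))"
      by (rule sum.mono_neutral_cong_right) auto
    finally show ?thesis .
  qed
  ultimately show ?thesis unfolding sums_def using LIMSEQ_ignore_initial_segment[of "\<lambda>N. \<integral>t. cnj (ucis t) ^ n * S N t \<partial>circ" _ n] by simp
qed

text \<open>Expanding \<open>B\<close> on generating functions around a circle produces all \<open>symb j\<close> from the circular
  means of \<open>symb 0\<close>; the factor is chosen to match those Taylor coefficients. The Berezin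
  transform is \<open>symb m\<close>.\<close>

definition symb :: "nat \<Rightarrow> complex \<Rightarrow> complex" where
  "symb j c = fact j / fact m * B (weyl c (gg m j)) (weyl c (gg m j))"

lemma symb_continuous: "continuous_on UNIV (symb j)"
  unfolding continuous_on_sequentially
proof (intro allI ballI impI)
  fix X :: "nat \<Rightarrow> complex" and c assume X: "(\<forall>n. X n \<in> UNIV) \<and> X \<longlonglongrightarrow> c"
  have "(\<lambda>n. nrm (\<lambda>w. weyl (X n) (gg m j) w - weyl c (gg m j) w)) \<longlonglongrightarrow> 0"
    by (rule weyl_tendsto[OF egrow_gg continuous_gg]) (use X in simp)
  then have "(\<lambda>n. B (weyl (X n) (gg m j)) (weyl (X n) (gg m j))) \<longlonglongrightarrow> B (weyl c (gg m j)) (weyl c (gg m j))"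
    by (intro form_tendsto weyl_true_fock gg_true_fock)
  then show "(symb j \<circ> X) \<longlonglongrightarrow> symb j c" unfolding symb_def o_def by (intro tendsto_mult tendsto_const)
qed

lemma symb_measurable [measurable]: "symb j \<in> borel_measurable borel"
  by (rule borel_measurable_continuous_onI[OF symb_continuous])

lemma symb_bound: "cmod (symb j c) \<le> fact j / fact m * (C * (nrm (gg m j) * nrm (gg m j)))"
proof -
  have "cmod (symb j c) = fact j / fact m * cmod (B (weyl c (gg m j)) (weyl c (gg m j)))"
    by (simp add: symb_def norm_mult norm_divide)
  also have "\<dots> \<le> fact j / fact m * (C * (nrm (weyl c (gg m j)) * nrm (weyl c (gg m j))))"
    by (intro mult_left_mono bound weyl_true_fock gg_true_fock) auto
  also have "nrm (weyl c (gg m j)) = nrm (gg m j)" by (rule nrm_weyl[OF egrow_measurable[OF egrow_gg]])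
  finally show ?thesis .
qed

lemma psi_weyl: "psi m c = (\<lambda>w. of_real (exp ((cmod c)\<^sup>2 / 2)) * weyl c (gg m 0) w)"
  unfolding gg_0 weyl_psi by (simp add: mult.assoc[symmetric] exp_add[symmetric] flip: exp_of_real)

lemma form_psi: "B (psi m c) (psi m c) = fact m * of_real (exp ((cmod c)\<^sup>2)) * symb 0 c"
proof -
  have H: "weyl c (gg m 0) \<in> true_fock (Suc m)" by (intro weyl_true_fock gg_true_fock)
  have "B (psi m c) (psi m c) = of_real (exp ((cmod c)\<^sup>2 / 2)) * (of_real (exp ((cmod c)\<^sup>2 / 2)) * B (weyl c (gg m 0)) (weyl c (gg m 0)))"
    unfolding psi_weyl by (simp only: scale_left[OF H true_fock_scale[OF H]] scale_right[OF H H] complex_cnj_complex_of_real)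
  also have "\<dots> = of_real (exp ((cmod c)\<^sup>2 / 2) * exp ((cmod c)\<^sup>2 / 2)) * B (weyl c (gg m 0)) (weyl c (gg m 0))" by simp
  also have "exp ((cmod c)\<^sup>2 / 2) * exp ((cmod c)\<^sup>2 / 2) = exp ((cmod c)\<^sup>2)" unfolding exp_add[symmetric] by simp
  finally show ?thesis by (simp add: symb_def)
qed

lemma translate: "fock_form m (\<lambda>u v. B (weyl a u) (weyl a v)) C"
proof
  fix u v w :: "complex \<Rightarrow> complex" and c
  assume u: "u \<in> true_fock (Suc m)" and w: "w \<in> true_fock (Suc m)"
  have s: "weyl a (\<lambda>z. c * u z) = (\<lambda>z. c * weyl a u z)" by (simp add: weyl_def fun_eq_iff)
  show "B (weyl a (\<lambda>z. c * u z)) (weyl a w) = c * B (weyl a u) (weyl a w)"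
    unfolding s by (intro scale_left weyl_true_fock u w)
  show "B (weyl a w) (weyl a (\<lambda>z. c * u z)) = cnj c * B (weyl a w) (weyl a u)"
    unfolding s by (intro scale_right weyl_true_fock u w)
  show "cmod (B (weyl a u) (weyl a w)) \<le> C * (nrm u * nrm w)"
    using bound[OF weyl_true_fock[OF u, of a] weyl_true_fock[OF w, of a]] u w
    by (simp add: nrm_weyl L2_measurable true_fock_L2)
  assume v: "v \<in> true_fock (Suc m)"
  have s: "weyl a (\<lambda>z. u z + v z) = (\<lambda>z. weyl a u z + weyl a v z)" by (simp add: weyl_def fun_eq_iff distrib_left)
  show "B (weyl a (\<lambda>z. u z + v z)) (weyl a w) = B (weyl a u) (weyl a w) + B (weyl a v) (weyl a w)"
    unfolding s by (intro add_left weyl_true_fock u v w)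
  show "B (weyl a w) (weyl a (\<lambda>z. u z + v z)) = B (weyl a w) (weyl a u) + B (weyl a w) (weyl a v)"
    unfolding s by (intro add_right weyl_true_fock u v w)
qed (rule C_nonneg)

text \<open>The phase of \<open>weyl_weyl\<close> cancels between the two arguments. Facts proved
  around the origin thus carry over to every centre \<open>a\<close>.\<close>

lemma translate_symb: "fock_form.symb m (\<lambda>u v. B (weyl a u) (weyl a v)) j c = symb j (a + c)"
proof -
  interpret T: fock_form m "\<lambda>u v. B (weyl a u) (weyl a v)" C by (rule translate)
  define e where "e = exp (- \<i> * complex_of_real (Im (a * cnj c)))"
  have e: "e * cnj e = 1"
    unfolding complex_norm_square[symmetric] by (simp add: e_def norm_exp_eq_Re)
  have w: "weyl a (weyl c (gg m j)) = (\<lambda>w. e * weyl (a + c) (gg m j) w)" by (simp add: weyl_weyl e_def fun_eq_iff)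
  have H: "weyl (a + c) (gg m j) \<in> true_fock (Suc m)" by (intro weyl_true_fock gg_true_fock)
  have "B (weyl a (weyl c (gg m j))) (weyl a (weyl c (gg m j))) = (e * cnj e) * B (weyl (a + c) (gg m j)) (weyl (a + c) (gg m j))"
    unfolding w by (simp only: scale_left[OF H true_fock_scale[OF H]] scale_right[OF H H] mult.assoc)
  then show ?thesis unfolding T.symb_def symb_def e by simp
qed

text \<open>The case \<open>n = 0\<close> of \<open>twisted_mean\<close> for the translated form; by
  \<open>form_psi\<close> its diagonal on \<open>psi\<close> is exp(r^2) times
  \<open>symb 0\<close>, up to \<open>fact m\<close>.\<close>

lemma mean_symb:
  assumes r: "r \<ge> 0"
  shows "(\<lambda>j. symb j a / fact j * of_real (r\<^sup>2) ^ j) sums (of_real (exp (r\<^sup>2)) * (\<integral>t. symb 0 (a + of_real r * ucis t) \<partial>circ))"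
proof -
  interpret T: fock_form m "\<lambda>u v. B (weyl a u) (weyl a v)" C by (rule translate)
  have "(\<lambda>j. (1 / fact m) * (of_real r ^ (2 * j + 0) * B (weyl a (gg m j)) (weyl a (gg m (j + 0))))) sums
    ((1 / fact m) * (\<integral>t. cnj (ucis t) ^ 0 * B (weyl a (psi m (of_real r * ucis t))) (weyl a (psi m (of_real r * ucis t))) \<partial>circ))"
    by (intro sums_mult T.twisted_mean r)
  moreover have "(1 / fact m) * (of_real r ^ (2 * j + 0) * B (weyl a (gg m j)) (weyl a (gg m (j + 0)))) = symb j a / fact j * of_real (r\<^sup>2) ^ j" for j
    by (simp add: symb_def power_mult)
  moreover have "(\<integral>t. cnj (ucis t) ^ 0 * B (weyl a (psi m (of_real r * ucis t))) (weyl a (psi m (of_real r * ucis t))) \<partial>circ)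
     = (\<integral>t. (fact m * of_real (exp (r\<^sup>2))) * symb 0 (a + of_real r * ucis t) \<partial>circ)"
    using r by (intro Bochner_Integration.integral_cong refl) (simp add: T.form_psi translate_symb norm_mult)
  ultimately show ?thesis by simp
qed

lemma symb_mean_transfer:
  assumes v: "\<And>r. r \<ge> 0 \<Longrightarrow> (\<lambda>n. v n * of_real (r\<^sup>2) ^ n) sums (\<integral>t. symb 0 (a + of_real r * ucis t) \<partial>circ)"
  shows "symb k a = (\<Sum>n\<le>k. fact k / fact (k - n) * v n)"
  by (rule power_series_coeff_transfer[OF mean_symb v])

end

text \<open>Divided by (n!)^2, the weights k!/(k - n)! of the coefficient transfer are
  binom(k,n)/n!, the coefficients of \<open>lagpoly k\<close>. This is where the Laguerre polynomial
  of the Laplacian appears.\<close>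

lemma radint_act_lagpoly:
  assumes m: "\<phi> \<in> borel_measurable borel" and b: "\<And>z. cmod (\<phi> z) \<le> C"
  shows "radint \<phi> (act (lagpoly k) P) = (\<Sum>n\<le>k. fact k / fact (k - n) * (radint \<phi> ((lap ^^ n) P) / (fact n)\<^sup>2))"
proof -
  have "radint \<phi> (act (lagpoly k) P) = (\<Sum>n\<le>k. coeff (lagpoly k) n * radint \<phi> ((lap ^^ n) P))"
    unfolding act_eq[OF eq_refl[OF degree_lagpoly]] radint_sum[OF m b] radint_smult[OF m b] ..
  also have "\<dots> = (\<Sum>n\<le>k. fact k / fact (k - n) * (radint \<phi> ((lap ^^ n) P) / (fact n)\<^sup>2))"
    by (intro sum.cong refl) (simp add: coeff_lagpoly binomial_fact power2_eq_square mult_ac)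
  finally show ?thesis .
qed

context fock_form
begin

text \<open>A Cauchy estimate: the majorant at the larger radius \<open>r + 1\<close> bounds
  \<open>nrm (gg m j)\<close> by D/(r + 1)^j, which leaves a geometric series.\<close>

lemma gg_norm_summable:
  assumes r: "r \<ge> 0"
  shows "summable (\<lambda>j. nrm (gg m j) * nrm (gg m j) * (r\<^sup>2) ^ j)"
proof -
  define D where "D = nrm (\<lambda>w. complex_of_real (majorant m (r + 1) (cmod w)))"
  have g: "(r + 1) ^ j * nrm (gg m j) \<le> D" for j
  proof -
    have "(r + 1) ^ j * nrm (gg m j) = nrm (\<lambda>w. of_real ((r + 1) ^ j) * gg m j w)"
      using r by (simp add: nrm_scale norm_power flip: of_real_power)
    also have "\<dots> \<le> D" unfolding D_def
    proof (rule nrm_mono[OF L2_scale[OF gg_L2] egrow_L2[OF egrow_majorant]])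
      fix w
      show "cmod (of_real ((r + 1) ^ j) * gg m j w) \<le> cmod (complex_of_real (majorant m (r + 1) (cmod w)))"
        using gg_single_majorant[of "r + 1" j m w] r majorant_nonneg[of "r + 1" "cmod w" m] by (simp add: norm_mult norm_power)
    qed (use r in simp)
    finally show ?thesis .
  qed
  have q: "(r\<^sup>2 / (r + 1)\<^sup>2) < 1" using r by (simp add: power2_eq_square algebra_simps add_pos_nonneg)
  have "summable (\<lambda>j. D * D * (r\<^sup>2 / (r + 1)\<^sup>2) ^ j)"
    by (intro summable_mult summable_geometric) (use q r in simp)
  then show ?thesis
  proof (rule summable_comparison_test')
    fix j
    have p: "(r + 1) ^ j > 0" using r by simp
    have "nrm (gg m j) \<le> D / (r + 1) ^ j" using g[of j] p by (simp add: field_simps)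
    then have "nrm (gg m j) * nrm (gg m j) * (r\<^sup>2) ^ j \<le> D / (r + 1) ^ j * (D / (r + 1) ^ j) * (r\<^sup>2) ^ j"
      by (intro mult_right_mono mult_mono) (auto intro: order_trans[OF nrm_nonneg])
    also have "\<dots> = D * D * (r\<^sup>2 / (r + 1)\<^sup>2) ^ j"
      by (simp add: power_divide power2_eq_square power_mult_distrib)
    finally show "norm (nrm (gg m j) * nrm (gg m j) * (r\<^sup>2) ^ j) \<le> D * D * (r\<^sup>2 / (r + 1)\<^sup>2) ^ j" by simp
  qed
qed

text \<open>The weak form of the equation between \<open>symb m\<close> and L_m(-\<Delta>/4) of
  \<open>symb 0\<close>, with the Laplacian on the weight. The circle means of
  \<open>symb 0\<close>, integrated against the weight, have two expansions in r^2, one from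
  \<open>mean_symb\<close> and one from Pizzetti's formula; comparing coefficients proves
  it.\<close>

lemma radint_symb: "radint (symb m) P = radint (symb 0) (act (lagpoly m) P)"
proof -
  define X where "X r = (\<integral>t. radint (\<lambda>w. symb 0 (w + of_real r * ucis t)) P \<partial>circ)" for r :: real
  have v: "(\<lambda>n. radint (symb 0) ((lap ^^ n) P) / (fact n)\<^sup>2 * of_real (r\<^sup>2) ^ n) sums X r" for r
    unfolding X_def by (rule circle_mean_radint[OF symb_measurable symb_bound])
  have u: "(\<lambda>j. radint (symb j) P / fact j * of_real (r\<^sup>2) ^ j) sums (of_real (exp (r\<^sup>2)) * X r)" if r: "r \<ge> 0" for r
  proof -
    interpret P: pair_sigma_finite circ gauss ..
    define g where "g j w = (of_real (r\<^sup>2) ^ j / fact j) * (symb j w * rp P w)" for j w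
    have gi: "integrable gauss (g j)" for j
      unfolding g_def by (intro integrable_mult_right radint_integrable[OF symb_measurable symb_bound])
    have gI: "(\<integral>w. g j w \<partial>gauss) = radint (symb j) P / fact j * of_real (r\<^sup>2) ^ j" for j
      unfolding g_def integral_mult_right_zero radint_def by simp
    have gs: "(\<lambda>j. g j w) sums (of_real (exp (r\<^sup>2)) * ((\<integral>t. symb 0 (w + of_real r * ucis t) \<partial>circ) * rp P w))" for w
      using sums_mult2[OF mean_symb[OF r, of w], of "rp P w"] by (simp add: g_def mult_ac)
    define K where "K j = (C / fact m) * (nrm (gg m j) * nrm (gg m j) * (r\<^sup>2) ^ j)" for j
    have sK: "summable K" unfolding K_def by (intro summable_mult gg_norm_summable r)
    have gb: "norm (g j w) \<le> K j * cmod (rp P w)" for j w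
    proof -
      have "norm (g j w) = (r\<^sup>2) ^ j / fact j * (cmod (symb j w) * cmod (rp P w))"
        by (simp add: g_def norm_mult norm_divide norm_power)
      also have "\<dots> \<le> (r\<^sup>2) ^ j / fact j * ((fact j / fact m * (C * (nrm (gg m j) * nrm (gg m j)))) * cmod (rp P w))"
        by (intro mult_left_mono mult_right_mono symb_bound) auto
      also have "\<dots> = K j * cmod (rp P w)" by (simp add: K_def)
      finally show ?thesis .
    qed
    have "(\<lambda>j. \<integral>w. g j w \<partial>gauss) sums (\<integral>w. (\<Sum>j. g j w) \<partial>gauss)"
    proof (rule sums_integral[OF gi])
      show "AE w in gauss. summable (\<lambda>j. norm (g j w))"
      proof (rule AE_I2)
        fix w
        show "summable (\<lambda>j. norm (g j w))"
          by (rule summable_comparison_test'[OF summable_mult2[OF sK, of "cmod (rp P w)"], of 0]) (simp add: gb)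
      qed
      show "summable (\<lambda>j. \<integral>w. norm (g j w) \<partial>gauss)"
      proof (rule summable_comparison_test'[OF summable_mult2[OF sK, of "radnorm P"]])
        fix j
        have "(\<integral>w. norm (g j w) \<partial>gauss) \<le> (\<integral>w. K j * cmod (rp P w) \<partial>gauss)"
          by (intro integral_mono integrable_norm gi integrable_mult_right integrable_rp gb)
        then show "norm (\<integral>w. norm (g j w) \<partial>gauss) \<le> K j * radnorm P" by (simp add: radnorm_def)
      qed
    qed
    moreover have "(\<integral>w. (\<Sum>j. g j w) \<partial>gauss) = of_real (exp (r\<^sup>2)) * X r"
    proof -
      have "(\<integral>w. (\<Sum>j. g j w) \<partial>gauss) = (\<integral>w. of_real (exp (r\<^sup>2)) * ((\<integral>t. symb 0 (w + of_real r * ucis t) \<partial>circ) * rp P w) \<partial>gauss)"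
        by (intro Bochner_Integration.integral_cong refl sums_unique[OF gs, symmetric])
      also have "\<dots> = of_real (exp (r\<^sup>2)) * (\<integral>w. (\<integral>t. symb 0 (w + of_real r * ucis t) * rp P w \<partial>circ) \<partial>gauss)"
        unfolding integral_mult_right_zero integral_mult_left_zero ..
      also have "(\<integral>w. (\<integral>t. symb 0 (w + of_real r * ucis t) * rp P w \<partial>circ) \<partial>gauss) = (\<integral>t. (\<integral>w. symb 0 (w + of_real r * ucis t) * rp P w \<partial>gauss) \<partial>circ)"
      proof (rule P.Fubini_integral)
        define K0 where "K0 = fact 0 / fact m * (C * (nrm (gg m 0) * nrm (gg m 0)))"
        have k0: "cmod (symb 0 x) \<le> K0" for x unfolding K0_def by (rule symb_bound)
        have i: "integrable gauss (\<lambda>w. symb 0 (w + a) * rp P w)" for a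
        proof (rule integrable_bounded_mult[OF integrable_rp])
          show "cmod (symb 0 (w + a)) \<le> K0" for w unfolding K0_def by (rule symb_bound)
        qed measurable
        show "integrable (circ \<Otimes>\<^sub>M gauss) (\<lambda>(t, w). symb 0 (w + of_real r * ucis t) * rp P w)"
        proof (rule P.Fubini_integrable)
          show "(\<lambda>(t, w). symb 0 (w + of_real r * ucis t) * rp P w) \<in> borel_measurable (circ \<Otimes>\<^sub>M gauss)" by measurable
          show "AE t in circ. integrable gauss (\<lambda>w. case (t, w) of (t, w) \<Rightarrow> symb 0 (w + of_real r * ucis t) * rp P w)"
            by (intro AE_I2) (simp add: i)
          show "integrable circ (\<lambda>t. \<integral>w. norm (case (t, w) of (t, w) \<Rightarrow> symb 0 (w + of_real r * ucis t) * rp P w) \<partial>gauss)"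
          proof (rule integrable_circ[where C = "K0 * radnorm P"])
            show "(\<lambda>t. \<integral>w. norm (case (t, w) of (t, w) \<Rightarrow> symb 0 (w + of_real r * ucis t) * rp P w) \<partial>gauss) \<in> borel_measurable borel"
              by measurable
            fix t
            have "(\<integral>w. norm (symb 0 (w + of_real r * ucis t) * rp P w) \<partial>gauss) \<le> (\<integral>w. K0 * cmod (rp P w) \<partial>gauss)"
              by (intro integral_mono integrable_norm[OF i] integrable_mult_right integrable_norm[OF integrable_rp])
                 (auto simp: norm_mult intro!: mult_right_mono k0)
            then show "norm (\<integral>w. norm (case (t, w) of (t, w) \<Rightarrow> symb 0 (w + of_real r * ucis t) * rp P w) \<partial>gauss) \<le> K0 * radnorm P"
              by (simp add: radnorm_def)
          qed
        qed
      qed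
      finally show ?thesis unfolding X_def radint_def .
    qed
    ultimately show ?thesis unfolding gI by simp
  qed
  have "radint (symb m) P = (\<Sum>n\<le>m. fact m / fact (m - n) * (radint (symb 0) ((lap ^^ n) P) / (fact n)\<^sup>2))"
    by (rule power_series_coeff_transfer[OF u v])
  also have "\<dots> = radint (symb 0) (act (lagpoly m) P)" by (rule radint_act_lagpoly[OF symb_measurable symb_bound, symmetric])
  finally show ?thesis .
qed

end

text \<open>The three-term recurrence of the Laguerre polynomials at -x. Its coefficients mirror
  those of \<open>lap_monom\<close>, on which the induction in \<open>act_lagpoly_1\<close>
  relies.\<close>

lemma lagpoly_rec: "smult (of_nat (m + 2)) (lagpoly (m + 2)) = [:of_nat (2 * m + 3), 1:] * lagpoly (m + 1) - smult (of_nat (m + 1)) (lagpoly m)"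
proof (rule poly_eqI)
  fix n
  show "coeff (smult (of_nat (m + 2)) (lagpoly (m + 2))) n = coeff ([:of_nat (2 * m + 3), 1:] * lagpoly (m + 1) - smult (of_nat (m + 1)) (lagpoly m)) n"
  proof (cases n)
    case 0
    then show ?thesis by (simp add: coeff_lagpoly)
  next
    case (Suc k)
    have cL: "coeff (lagpoly m) n = of_nat (m choose n) / fact n" for m n
      by (simp add: coeff_lagpoly binomial_eq_0)
    define b where "b = complex_of_nat (m choose k)"
    define a where "a = complex_of_nat (m choose Suc k)"
    define d where "d = (if k = 0 then 0 else complex_of_nat (m choose (k - 1)))"
    have e1: "complex_of_nat (Suc m choose Suc k) = a + b" by (simp add: a_def b_def)
    have e2: "complex_of_nat (Suc m choose k) = b + d" by (cases k) (simp_all add: b_def d_def)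
    have e3: "complex_of_nat (Suc (Suc m) choose Suc k) = a + 2 * b + d"
      unfolding binomial_Suc_Suc[of "Suc m" k] of_nat_add e1 e2 by simp
    \<comment> \<open>The absorption identity for binomials; setting \<open>d\<close> to 0 at
      \<open>k = 0\<close> keeps it valid there.\<close>
    have absorb: "of_nat k * b = (of_nat (m + 1) - of_nat k) * d"
    proof (cases k)
      case (Suc i)
      show ?thesis
      proof (cases "Suc i \<le> m")
        case True
        have "Suc i * (m choose Suc i) = (m - i) * (m choose i)"
          by (metis binomial_absorption binomial_absorb_comp mult.commute Suc_diff_Suc Suc_le_lessD True diff_Suc_Suc)
        then have "complex_of_nat (Suc i) * of_nat (m choose Suc i) = of_nat (m - i) * of_nat (m choose i)"
          by (metis of_nat_mult)
        moreover have "complex_of_nat (m - i) = of_nat (m + 1) - of_nat (Suc i)" using True by (simp add: of_nat_diff)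
        ultimately show ?thesis by (simp only: Suc b_def d_def) simp
      next
        case False
        then have "m choose Suc i = 0" by (simp add: binomial_eq_0)
        moreover have "i = m \<or> m choose i = 0" using False by (auto simp: binomial_eq_0)
        ultimately show ?thesis by (auto simp: Suc b_def d_def binomial_eq_0)
      qed
    qed (simp add: d_def)
    have f: "fact (Suc k) = (of_nat k + 1) * (fact k :: complex)" by simp
    have nz: "of_nat k + 1 \<noteq> (0::complex)" by (metis of_nat_Suc of_nat_eq_0_iff add.commute nat.distinct(1))
    have main: "(of_nat m + 2) * (a + 2 * b + d) = (2 * of_nat m + 3) * (a + b) + (of_nat k + 1) * (b + d) - (of_nat m + 1) * a"
      using absorb by (simp add: algebra_simps)
    have "coeff (smult (of_nat (m + 2)) (lagpoly (m + 2))) n * fact (Suc k) = (of_nat m + 2) * (a + 2 * b + d)"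
    proof -
      have "coeff (smult (of_nat (m + 2)) (lagpoly (m + 2))) n = of_nat (m + 2) * (of_nat (Suc (Suc m) choose Suc k) / fact (Suc k))"
        by (simp add: cL Suc del: fact_Suc binomial_Suc_Suc)
      then show ?thesis unfolding e3 by (simp del: fact_Suc)
    qed
    moreover have "coeff ([:of_nat (2 * m + 3), 1:] * lagpoly (m + 1) - smult (of_nat (m + 1)) (lagpoly m)) n * fact (Suc k)
      = (2 * of_nat m + 3) * (a + b) + (of_nat k + 1) * (b + d) - (of_nat m + 1) * a"
    proof -
      have "coeff ([:of_nat (2 * m + 3), 1:] * lagpoly (m + 1) - smult (of_nat (m + 1)) (lagpoly m)) n
         = of_nat (2 * m + 3) * ((a + b) / fact (Suc k)) + (b + d) / fact k - of_nat (m + 1) * (a / fact (Suc k))"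
        using e1 e2 by (simp add: cL Suc a_def del: fact_Suc binomial_Suc_Suc)
      moreover have "(x * (y / F) + z / G - u * (v / F)) * F = x * y + c * z - u * v" if "F \<noteq> 0" "G \<noteq> 0" "F = c * G"
        for x y z u v c F G :: complex
        using that by (simp add: field_simps)
      from this[of "fact (Suc k)" "fact k" "of_nat k + 1"] have "(x * (y / fact (Suc k)) + z / fact k - u * (v / fact (Suc k))) * fact (Suc k) = x * y + (of_nat k + 1) * z - u * v"
        for x y z u v :: complex using f nz by (simp del: fact_Suc)
      ultimately show ?thesis by (simp only: of_nat_add of_nat_mult of_nat_numeral of_nat_1)
    qed
    ultimately have "coeff (smult (of_nat (m + 2)) (lagpoly (m + 2))) n * fact (Suc k) = coeff ([:of_nat (2 * m + 3), 1:] * lagpoly (m + 1) - smult (of_nat (m + 1)) (lagpoly m)) n * fact (Suc k)"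
      using main by simp
    then show ?thesis by (simp del: fact_Suc)
  qed
qed

text \<open>In the recurrence \<open>2 * k + 3\<close> cancels the diagonal entry of
  \<open>lap\<close> on the monomial of degree \<open>k + 1\<close>, and the entry
  \<open>(k + 1)\<^sup>2\<close> below it cancels the term with \<open>lagpoly k\<close>; only the
  raised monomial survives. So |w|^(2m) exp(-|w|^2)/m! is L_m(-\<Delta>/4) of the Gaussian.\<close>

lemma act_lagpoly_1: "act (lagpoly m) 1 = monom (1 / fact m) m"
proof (induction m rule: less_induct)
  case (less m)
  consider "m = 0" | "m = 1" | k where "m = k + 2"
    by (metis One_nat_def Suc_1 add_2_eq_Suc' not0_implies_Suc)
  then show ?case
  proof cases
    case 1
    have "lagpoly 0 = 1" by (rule poly_eqI) (simp add: coeff_lagpoly)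
    then show ?thesis by (simp add: 1)
  next
    case 2
    have "lagpoly 1 = [:1, 1:]" by (rule poly_eqI) (auto simp: coeff_lagpoly coeff_pCons split: nat.splits)
    then show ?thesis
      using lap_monom[of 0] by (simp add: 2 act_pCons)
  next
    case 3
    have IH: "act (lagpoly (k + 1)) 1 = smult (1 / fact (k + 1)) (monom 1 (k + 1))" "act (lagpoly k) 1 = smult (1 / fact k) (monom 1 k)"
      using less[of "k + 1"] less[of k] 3 by (simp_all add: smult_monom)
    define M where "M = monom (1::complex) (k + 1)"
    define f where "f = (1 / fact (k + 1) :: complex)"
    have fact_step: "1 / fact i = of_nat (i + 1) * (1 / fact (i + 1) :: complex)" for i
    proof -
      have "N \<noteq> 0 \<Longrightarrow> 1 / x = N * (1 / (N * x))" for N x :: complex by simp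
      moreover have "of_nat (i + 1) \<noteq> (0 :: complex)" by (simp only: of_nat_eq_0_iff)
      moreover have "fact (i + 1) = of_nat (i + 1) * (fact i :: complex)" by simp
      ultimately show ?thesis by metis
    qed
    have fk: "1 / fact k = of_nat (k + 1) * f" unfolding f_def by (rule fact_step)
    have "smult (of_nat (k + 2)) (act (lagpoly (k + 2)) 1) = act (smult (of_nat (k + 2)) (lagpoly (k + 2)) + smult (of_nat (k + 1)) (lagpoly k)) 1 - smult (of_nat (k + 1)) (act (lagpoly k) 1)"
      by (simp add: act_add act_smult)
    also have "smult (of_nat (k + 2)) (lagpoly (k + 2)) + smult (of_nat (k + 1)) (lagpoly k) = [:of_nat (2 * k + 3), 1:] * lagpoly (k + 1)"
      unfolding lagpoly_rec by simp
    also have "act ([:of_nat (2 * k + 3), 1:] * lagpoly (k + 1)) 1 = smult f (smult (of_nat (2 * k + 3)) M + lap M)"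
      unfolding act_mult IH M_def[symmetric] f_def[symmetric] by (simp add: act_pCons lap_smult smult_add_right mult.commute)
    also have "lap M = smult ((of_nat (k + 1))\<^sup>2) (monom 1 k) + smult (- of_nat (2 * k + 3)) M + monom 1 (k + 2)"
      unfolding M_def lap_monom by (simp add: algebra_simps)
    also have "smult f (smult (of_nat (2 * k + 3)) M + (smult ((of_nat (k + 1))\<^sup>2) (monom 1 k) + smult (- of_nat (2 * k + 3)) M + monom 1 (k + 2))) - smult (of_nat (k + 1)) (act (lagpoly k) 1)
      = smult f (monom 1 (k + 2))"
      unfolding IH(2) fk smult_minus_left by (simp add: smult_add_right power2_eq_square mult_ac)
    finally have "smult (of_nat (k + 2)) (act (lagpoly (k + 2)) 1) = smult (of_nat (k + 2)) (smult (1 / fact (k + 2)) (monom 1 (k + 2)))"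
      unfolding f_def using fact_step[of "k + 1"] by (simp only: smult_smult add.assoc one_add_one)
    moreover have "of_nat (k + 2) \<noteq> (0::complex)" by (metis of_nat_eq_0_iff add_2_eq_Suc' nat.distinct(1))
    ultimately show ?thesis unfolding 3 by (metis smult_cancel smult_monom mult.right_neutral)
  qed
qed

section \<open>Gaussian averages\<close>

text \<open>The leading coefficient 1 makes the passage from the iterates of \<open>lap\<close> on 1
  to the monomials triangular.\<close>

lemma coeff_lapn_1: "coeff ((lap ^^ n) 1) n = 1 \<and> (\<forall>i>n. coeff ((lap ^^ n) 1) i = 0)"
proof (induction n)
  case (Suc n)
  then show ?case by (auto simp: coeff_lap)
qed (auto simp: coeff_1)

text \<open>Expand exp((t0 - t)|w|^2) into moments at \<open>t0\<close>. For
  \<open>\<bar>t - t0\<bar> \<le> t0 / 2\<close> half of the exponent survives the expansion; one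
  half of that absorbs the power of |w|, and the rest keeps the dominating function
  integrable.\<close>

lemma gaussian_moments_zero_near:
  fixes \<phi> :: "complex \<Rightarrow> complex"
  assumes m[measurable]: "\<phi> \<in> borel_measurable borel" and bd: "\<And>z. cmod (\<phi> z) \<le> C"
    and t0: "t0 > 0" and t: "\<bar>t - t0\<bar> \<le> t0 / 2"
    and z: "\<And>j. (\<integral>w. \<phi> w * of_real ((cmod w)\<^sup>2 ^ j * exp (- t0 * (cmod w)\<^sup>2)) \<partial>lborel) = 0"
  shows "(\<integral>w. \<phi> w * of_real ((cmod w)\<^sup>2 ^ j * exp (- t * (cmod w)\<^sup>2)) \<partial>lborel) = 0"
proof -
  have C0: "C \<ge> 0" using bd[of 0] norm_ge_zero order_trans by blast
  define bb where "bb w = C * (fact j * (4 / t0) ^ j) * exp (- (t0 / 4) * (cmod w)\<^sup>2)" for w :: complex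
  have bbi: "integrable lborel bb"
    unfolding bb_def[abs_def] using t0 by (intro integrable_mult_right integrable_gaussian_complex) auto
  define S where "S N w = \<phi> w * of_real ((cmod w)\<^sup>2 ^ j * exp (- t0 * (cmod w)\<^sup>2) * (\<Sum>n<N. ((t0 - t) * (cmod w)\<^sup>2) ^ n /\<^sub>R fact n))" for N w
  have pd: "(cmod w)\<^sup>2 ^ j * exp (- t0 * (cmod w)\<^sup>2) * exp (\<bar>t0 - t\<bar> * (cmod w)\<^sup>2) \<le> (fact j * (4 / t0) ^ j) * exp (- (t0 / 4) * (cmod w)\<^sup>2)" for w
  proof -
    have "(t0 / 4 * (cmod w)\<^sup>2) ^ j / fact j \<le> exp (t0 / 4 * (cmod w)\<^sup>2)" using t0 by (intro power_fact_le_exp) auto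
    then have "(t0 / 4) ^ j * (cmod w)\<^sup>2 ^ j \<le> fact j * exp (t0 / 4 * (cmod w)\<^sup>2)" by (simp add: power_mult_distrib field_simps)
    then have "(4 / t0) ^ j * ((t0 / 4) ^ j * (cmod w)\<^sup>2 ^ j) \<le> (4 / t0) ^ j * (fact j * exp (t0 / 4 * (cmod w)\<^sup>2))"
      using t0 by (intro mult_left_mono) auto
    moreover have "(4 / t0) ^ j * ((t0 / 4) ^ j * (cmod w)\<^sup>2 ^ j) = (cmod w)\<^sup>2 ^ j"
      unfolding mult.assoc[symmetric] power_mult_distrib[symmetric] using t0 by simp
    ultimately have 1: "(cmod w)\<^sup>2 ^ j \<le> (4 / t0) ^ j * (fact j * exp (t0 / 4 * (cmod w)\<^sup>2))" by simp
    have 2: "exp (- t0 * (cmod w)\<^sup>2) * exp (\<bar>t0 - t\<bar> * (cmod w)\<^sup>2) \<le> exp (- (t0 / 2) * (cmod w)\<^sup>2)"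
      unfolding exp_add[symmetric] distrib_right[symmetric] exp_le_cancel_iff
      using t by (intro mult_right_mono) (auto simp: abs_if split: if_splits)
    have "(cmod w)\<^sup>2 ^ j * (exp (- t0 * (cmod w)\<^sup>2) * exp (\<bar>t0 - t\<bar> * (cmod w)\<^sup>2)) \<le> (4 / t0) ^ j * (fact j * exp (t0 / 4 * (cmod w)\<^sup>2)) * exp (- (t0 / 2) * (cmod w)\<^sup>2)"
      using 1 2 t0 by (intro mult_mono) auto
    also have "\<dots> = (fact j * (4 / t0) ^ j) * (exp (t0 / 4 * (cmod w)\<^sup>2) * exp (- (t0 / 2) * (cmod w)\<^sup>2))" by simp
    also have "exp (t0 / 4 * (cmod w)\<^sup>2) * exp (- (t0 / 2) * (cmod w)\<^sup>2) = exp (- (t0 / 4) * (cmod w)\<^sup>2)"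
      unfolding exp_add[symmetric] by (simp add: algebra_simps)
    finally show ?thesis by (simp add: mult.assoc)
  qed
  have es: "(\<lambda>n. x ^ n /\<^sub>R fact n) sums exp x" for x :: real by (rule exp_converges)
  have "(\<lambda>N. \<integral>w. S N w \<partial>lborel) \<longlonglongrightarrow> (\<integral>w. \<phi> w * of_real ((cmod w)\<^sup>2 ^ j * exp (- t * (cmod w)\<^sup>2)) \<partial>lborel)"
  proof (rule integral_dominated_convergence[OF _ _ bbi])
    show "AE w in lborel. (\<lambda>N. S N w) \<longlonglongrightarrow> \<phi> w * of_real ((cmod w)\<^sup>2 ^ j * exp (- t * (cmod w)\<^sup>2))"
    proof (rule AE_I2)
      fix w
      have "(\<lambda>N. S N w) \<longlonglongrightarrow> \<phi> w * of_real ((cmod w)\<^sup>2 ^ j * exp (- t0 * (cmod w)\<^sup>2) * exp ((t0 - t) * (cmod w)\<^sup>2))"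
        unfolding S_def using es[of "(t0 - t) * (cmod w)\<^sup>2"] unfolding sums_def by (intro tendsto_intros)
      also have "(cmod w)\<^sup>2 ^ j * exp (- t0 * (cmod w)\<^sup>2) * exp ((t0 - t) * (cmod w)\<^sup>2) = (cmod w)\<^sup>2 ^ j * exp (- t * (cmod w)\<^sup>2)"
        unfolding mult.assoc exp_add[symmetric] by (simp add: algebra_simps)
      finally show "(\<lambda>N. S N w) \<longlonglongrightarrow> \<phi> w * of_real ((cmod w)\<^sup>2 ^ j * exp (- t * (cmod w)\<^sup>2))" .
    qed
    show "AE w in lborel. norm (S N w) \<le> bb w" for N
    proof (rule AE_I2)
      fix w
      define x where "x = (t0 - t) * (cmod w)\<^sup>2"
      have "\<bar>\<Sum>n<N. x ^ n /\<^sub>R fact n\<bar> \<le> (\<Sum>n<N. \<bar>x\<bar> ^ n /\<^sub>R fact n)"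
        by (rule order_trans[OF sum_abs]) (simp add: power_abs abs_mult)
      also have "\<dots> \<le> exp \<bar>x\<bar>"
        unfolding sums_unique[OF es[of "\<bar>x\<bar>"]] by (rule sum_le_suminf[OF sums_summable[OF es]]) auto
      finally have e: "\<bar>\<Sum>n<N. x ^ n /\<^sub>R fact n\<bar> \<le> exp (\<bar>t0 - t\<bar> * (cmod w)\<^sup>2)" by (simp add: x_def abs_mult)
      have "norm (S N w) = cmod (\<phi> w) * ((cmod w)\<^sup>2 ^ j * exp (- t0 * (cmod w)\<^sup>2) * \<bar>\<Sum>n<N. x ^ n /\<^sub>R fact n\<bar>)"
        unfolding S_def x_def[symmetric] norm_mult norm_of_real abs_mult by simp
      also have "\<dots> \<le> C * ((fact j * (4 / t0) ^ j) * exp (- (t0 / 4) * (cmod w)\<^sup>2))"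
      proof (rule mult_mono[OF bd])
        have "(cmod w)\<^sup>2 ^ j * exp (- t0 * (cmod w)\<^sup>2) * \<bar>\<Sum>n<N. x ^ n /\<^sub>R fact n\<bar> \<le> (cmod w)\<^sup>2 ^ j * exp (- t0 * (cmod w)\<^sup>2) * exp (\<bar>t0 - t\<bar> * (cmod w)\<^sup>2)"
          using e by (intro mult_left_mono) auto
        then show "(cmod w)\<^sup>2 ^ j * exp (- t0 * (cmod w)\<^sup>2) * \<bar>\<Sum>n<N. x ^ n /\<^sub>R fact n\<bar> \<le> fact j * (4 / t0) ^ j * exp (- (t0 / 4) * (cmod w)\<^sup>2)"
          using pd[of w] by linarith
      qed (use C0 in auto)
      finally show "norm (S N w) \<le> bb w" by (simp add: bb_def mult.assoc)
    qed
    show "S N \<in> borel_measurable lborel" for N unfolding S_def[abs_def] by measurable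
  qed measurable
  moreover have "(\<integral>w. S N w \<partial>lborel) = 0" for N
  proof -
    have ii: "integrable lborel (\<lambda>w. \<phi> w * of_real ((cmod w)\<^sup>2 ^ i * exp (- t0 * (cmod w)\<^sup>2)))" for i
    proof (rule integrable_bounded_mult[OF _ _ bd])
      show "integrable lborel (\<lambda>w::complex. complex_of_real ((cmod w)\<^sup>2 ^ i * exp (- t0 * (cmod w)\<^sup>2)))"
      proof (rule integrable_of_real, rule Bochner_Integration.integrable_bound)
        show "integrable lborel (\<lambda>w::complex. (fact i * (2 / t0) ^ i) * exp (- (t0 / 2) * (cmod w)\<^sup>2))"
          using t0 by (intro integrable_mult_right integrable_gaussian_complex) auto
        show "AE w::complex in lborel. norm ((cmod w)\<^sup>2 ^ i * exp (- t0 * (cmod w)\<^sup>2)) \<le> norm ((fact i * (2 / t0) ^ i) * exp (- (t0 / 2) * (cmod w)\<^sup>2))"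
        proof (rule AE_I2)
          fix w :: complex
          have "(t0 / 2 * (cmod w)\<^sup>2) ^ i / fact i \<le> exp (t0 / 2 * (cmod w)\<^sup>2)" using t0 by (intro power_fact_le_exp) auto
          then have "(2 / t0) ^ i * ((t0 / 2) ^ i * (cmod w)\<^sup>2 ^ i) \<le> (2 / t0) ^ i * (fact i * exp (t0 / 2 * (cmod w)\<^sup>2))"
            using t0 by (intro mult_left_mono) (auto simp: power_mult_distrib field_simps)
          moreover have "(2 / t0) ^ i * ((t0 / 2) ^ i * (cmod w)\<^sup>2 ^ i) = (cmod w)\<^sup>2 ^ i"
            unfolding mult.assoc[symmetric] power_mult_distrib[symmetric] using t0 by simp
          ultimately have "(cmod w)\<^sup>2 ^ i * exp (- t0 * (cmod w)\<^sup>2) \<le> (2 / t0) ^ i * (fact i * exp (t0 / 2 * (cmod w)\<^sup>2)) * exp (- t0 * (cmod w)\<^sup>2)"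
            by (intro mult_right_mono) auto
          also have "\<dots> = (fact i * (2 / t0) ^ i) * (exp (t0 / 2 * (cmod w)\<^sup>2) * exp (- t0 * (cmod w)\<^sup>2))" by simp
          also have "exp (t0 / 2 * (cmod w)\<^sup>2) * exp (- t0 * (cmod w)\<^sup>2) = exp (- (t0 / 2) * (cmod w)\<^sup>2)"
            unfolding exp_add[symmetric] by (simp add: algebra_simps)
          finally show "norm ((cmod w)\<^sup>2 ^ i * exp (- t0 * (cmod w)\<^sup>2)) \<le> norm ((fact i * (2 / t0) ^ i) * exp (- (t0 / 2) * (cmod w)\<^sup>2))"
            using t0 by (simp add: abs_mult)
        qed
      qed measurable
    qed measurable
    have "S N w = (\<Sum>n<N. of_real ((t0 - t) ^ n / fact n) * (\<phi> w * of_real ((cmod w)\<^sup>2 ^ (j + n) * exp (- t0 * (cmod w)\<^sup>2))))" for w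
    proof -
      have "(cmod w)\<^sup>2 ^ j * exp (- t0 * (cmod w)\<^sup>2) * (\<Sum>n<N. ((t0 - t) * (cmod w)\<^sup>2) ^ n /\<^sub>R fact n) =
         (\<Sum>n<N. ((t0 - t) ^ n / fact n) * ((cmod w)\<^sup>2 ^ (j + n) * exp (- t0 * (cmod w)\<^sup>2)))"
        unfolding sum_distrib_left
        by (intro sum.cong refl) (simp add: power_add power_mult_distrib divide_inverse mult_ac)
      then show ?thesis unfolding S_def by (simp only: of_real_sum of_real_mult sum_distrib_left mult.left_commute[of "\<phi> w"])
    qed
    then have "(\<integral>w. S N w \<partial>lborel) = (\<Sum>n<N. of_real ((t0 - t) ^ n / fact n) * (\<integral>w. \<phi> w * of_real ((cmod w)\<^sup>2 ^ (j + n) * exp (- t0 * (cmod w)\<^sup>2)) \<partial>lborel))"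
      by (simp only:) (subst Bochner_Integration.integral_sum, intro integrable_mult_right ii, simp only: integral_mult_right_zero)
    then show ?thesis unfolding z by simp
  qed
  ultimately show ?thesis by (simp add: LIMSEQ_const_iff)
qed

lemma integral_lborel_scale:
  fixes g :: "complex \<Rightarrow> complex"
  assumes [measurable]: "g \<in> borel_measurable borel" and c: "c > 0"
  shows "(\<integral>w. g w \<partial>lborel) = of_real (c\<^sup>2) * (\<integral>w. g (of_real c * w) \<partial>lborel)"
proof -
  have "lborel = density (distr lborel borel (\<lambda>x::complex. 0 + c *\<^sub>R x)) (\<lambda>_. ennreal (\<bar>c\<bar> ^ DIM(complex)))"
    by (rule lborel_affine) (use c in simp)
  then have l: "lborel = density (distr lborel borel (\<lambda>x::complex. of_real c * x)) (\<lambda>_. ennreal (c\<^sup>2))"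
    using c by (simp add: scaleR_conv_of_real)
  have "(\<integral>w. g w \<partial>lborel) = (\<integral>w. g w \<partial>density (distr lborel borel (\<lambda>x::complex. of_real c * x)) (\<lambda>_. ennreal (c\<^sup>2)))"
    using l by simp
  also have "\<dots> = (\<integral>w. c\<^sup>2 *\<^sub>R g w \<partial>distr lborel borel (\<lambda>x::complex. of_real c * x))"
    by (rule integral_density) (use c in auto)
  also have "\<dots> = (\<integral>w. c\<^sup>2 *\<^sub>R g (of_real c * w) \<partial>lborel)"
    by (rule integral_distr) measurable
  finally show ?thesis by (simp add: scaleR_conv_of_real)
qed

text \<open>The vanishing of all moments spreads from the Gaussian of inverse variance 1 to those of inverse
  variance \<open>(3/2) ^ n\<close>, which concentrate at the origin.\<close>

lemma gauss_injective:
  fixes \<phi> :: "complex \<Rightarrow> complex"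
  assumes cont: "continuous_on UNIV \<phi>" and bd: "\<And>z. cmod (\<phi> z) \<le> C"
    and z: "\<And>a. radint (\<lambda>w. \<phi> (w + a)) 1 = 0"
  shows "\<phi> 0 = 0"
proof -
  have m[measurable]: "\<phi> \<in> borel_measurable borel" by (rule borel_measurable_continuous_onI[OF cont])
  have "radnull \<phi> 1" by (rule radnull_of_translates[OF m bd z])
  then have Z: "radint \<phi> ((lap ^^ n) 1) = 0" for n by (simp add: radnull_def[OF m bd])
  have mono: "radint \<phi> (monom 1 n) = 0" for n
  proof (induction n rule: less_induct)
    case (less n)
    let ?P = "(lap ^^ n) 1 :: complex poly"
    have "degree ?P \<le> n" using coeff_lapn_1[of n] by (intro degree_le) auto
    then have "?P = (\<Sum>i\<le>n. monom (coeff ?P i) i)"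
      by (intro poly_eqI) (auto simp: coeff_sum coeff_monom sum.delta coeff_eq_0)
    then have "0 = radint \<phi> (\<Sum>i\<le>n. smult (coeff ?P i) (monom 1 i))" using Z[of n] by (simp add: smult_monom)
    also have "\<dots> = (\<Sum>i\<le>n. coeff ?P i * radint \<phi> (monom 1 i))" by (simp only: radint_sum[OF m bd] radint_smult[OF m bd])
    also have "\<dots> = coeff ?P n * radint \<phi> (monom 1 n)"
      by (rule sum.remove[of _ n, THEN trans]) (auto intro!: sum.neutral less)
    finally show ?case using coeff_lapn_1[of n] by simp
  qed
  have base: "(\<integral>w. \<phi> w * of_real ((cmod w)\<^sup>2 ^ j * exp (- 1 * (cmod w)\<^sup>2)) \<partial>lborel) = 0" for j
  proof -
    have "0 = (\<integral>w. \<phi> w * rp (monom 1 j) w \<partial>gauss)" using mono[of j] by (simp add: radint_def)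
    also have "\<dots> = (\<integral>w. (exp (- (cmod w)\<^sup>2) / pi) *\<^sub>R (\<phi> w * rp (monom 1 j) w) \<partial>lborel)" by (rule integral_gauss) measurable
    also have "\<dots> = (\<integral>w. (1 / of_real pi) * (\<phi> w * of_real ((cmod w)\<^sup>2 ^ j * exp (- 1 * (cmod w)\<^sup>2))) \<partial>lborel)"
      by (intro Bochner_Integration.integral_cong refl) (simp add: rp_def poly_monom scaleR_conv_of_real)
    finally show ?thesis unfolding integral_mult_right_zero by simp
  qed
  \<comment> \<open>The ratio 3/2 is the largest step upwards that
    \<open>gaussian_moments_zero_near\<close> permits.\<close>
  have pw: "(\<integral>w. \<phi> w * of_real ((cmod w)\<^sup>2 ^ j * exp (- ((3/2) ^ n) * (cmod w)\<^sup>2)) \<partial>lborel) = 0" for n j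
  proof (induction n arbitrary: j)
    case 0
    then show ?case using base[of j] by simp
  next
    case (Suc n)
    show ?case
      by (rule gaussian_moments_zero_near[OF m bd, where ?t0.0 = "(3/2) ^ n"]) (use Suc in auto)
  qed
  \<comment> \<open>Substituting \<open>c n * w\<close> turns each of these Gaussians back into the
    one of \<open>gauss\<close> and moves the concentration into the argument of
    \<open>\<phi>\<close>.\<close>
  define c where "c n = sqrt (1 / (3/2) ^ n)" for n :: nat
  have c0: "c n > 0" for n by (simp add: c_def)
  have csq: "(c n)\<^sup>2 = 1 / (3/2) ^ n" for n by (simp add: c_def)
  have sc: "(\<integral>w. \<phi> (of_real (c n) * w) \<partial>gauss) = 0" for n
  proof -
    have "0 = of_real ((c n)\<^sup>2) * (\<integral>w. \<phi> (of_real (c n) * w) * of_real (exp (- ((3/2) ^ n) * (cmod (of_real (c n) * w))\<^sup>2)) \<partial>lborel)"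
      using pw[of 0 n] integral_lborel_scale[OF _ c0[of n], of "\<lambda>w. \<phi> w * of_real (exp (- ((3/2) ^ n) * (cmod w)\<^sup>2))"] by simp
    then have "0 = (\<integral>w. \<phi> (of_real (c n) * w) * of_real (exp (- ((3/2) ^ n) * (cmod (of_real (c n) * w))\<^sup>2)) \<partial>lborel)"
      using c0[of n] by simp
    also have "(3/2) ^ n * (cmod (of_real (c n) * w))\<^sup>2 = (cmod w)\<^sup>2" for w
      unfolding norm_mult power_mult_distrib by (simp add: csq)
    then have "(\<integral>w. \<phi> (of_real (c n) * w) * of_real (exp (- ((3/2) ^ n) * (cmod (of_real (c n) * w))\<^sup>2)) \<partial>lborel) = (\<integral>w. \<phi> (of_real (c n) * w) * of_real (exp (- (cmod w)\<^sup>2)) \<partial>lborel)"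
      by (simp only: mult_minus_left)
    finally have e: "(\<integral>w. \<phi> (of_real (c n) * w) * of_real (exp (- (cmod w)\<^sup>2)) \<partial>lborel) = 0" ..
    have "(\<integral>w. \<phi> (of_real (c n) * w) \<partial>gauss) = (\<integral>w. (exp (- (cmod w)\<^sup>2) / pi) *\<^sub>R \<phi> (of_real (c n) * w) \<partial>lborel)"
      by (rule integral_gauss) measurable
    also have "\<dots> = (\<integral>w. (1 / of_real pi) * (\<phi> (of_real (c n) * w) * of_real (exp (- (cmod w)\<^sup>2))) \<partial>lborel)"
      by (intro Bochner_Integration.integral_cong refl) (simp add: scaleR_conv_of_real)
    also have "\<dots> = 0" unfolding integral_mult_right_zero e by simp
    finally show ?thesis .
  qed
  have cl: "c \<longlonglongrightarrow> 0"
  proof -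
    have "(\<lambda>n. (2/3::real) ^ n) \<longlonglongrightarrow> 0" by (rule LIMSEQ_realpow_zero) auto
    then have "(\<lambda>n. sqrt ((2/3) ^ n)) \<longlonglongrightarrow> sqrt 0" by (rule tendsto_real_sqrt)
    moreover have "c n = sqrt ((2/3) ^ n)" for n by (simp add: c_def power_divide)
    ultimately show ?thesis by (simp add: c_def[abs_def] power_divide)
  qed
  have "(\<lambda>n. \<integral>w. \<phi> (of_real (c n) * w) \<partial>gauss) \<longlonglongrightarrow> (\<integral>w. \<phi> 0 \<partial>gauss)"
  proof (rule integral_dominated_convergence[where w = "\<lambda>_. C"])
    show "AE w in gauss. (\<lambda>n. \<phi> (of_real (c n) * w)) \<longlonglongrightarrow> \<phi> 0"
    proof (rule AE_I2)
      fix w :: complex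
      have "(\<lambda>n. of_real (c n) * w) \<longlonglongrightarrow> of_real 0 * w" by (intro tendsto_intros cl)
      then show "(\<lambda>n. \<phi> (of_real (c n) * w)) \<longlonglongrightarrow> \<phi> 0"
        by (intro continuous_on_tendsto_compose[OF cont]) auto
    qed
  qed (use bd in auto)
  then have "(\<integral>w. \<phi> 0 \<partial>gauss) = 0" unfolding sc by (simp add: LIMSEQ_const_iff)
  moreover have "measure gauss UNIV \<noteq> 0"
  proof
    assume "measure gauss UNIV = 0"
    then have "emeasure gauss (space gauss) = 0" by (simp add: gauss.emeasure_eq_measure)
    then have "AE z in gauss. (1::complex) = 0" by (intro AE_I[of _ _ UNIV]) auto
    then have "(1::complex) = 0" unfolding AE_gauss_iff by (intro AE_zero_continuous[of "\<lambda>_. 1" 0]) auto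
    then show False by simp
  qed
  ultimately show ?thesis by (simp add: scaleR_conv_of_real)
qed

section \<open>Injectivity of the Berezin transform and of the quantization\<close>

lemma ip_mult_weyl:
  assumes [measurable]: "\<phi> \<in> borel_measurable borel" "f \<in> borel_measurable borel" "g \<in> borel_measurable borel"
  shows "ip (\<lambda>w. \<phi> w * weyl a f w) (weyl a g) = ip (\<lambda>w. \<phi> (w + a) * f w) g"
proof -
  have "(\<lambda>w. \<phi> w * weyl a f w) = weyl a (\<lambda>w. \<phi> (w + a) * f w)" by (simp add: weyl_def fun_eq_iff)
  then show ?thesis by (simp add: ip_weyl)
qed

text \<open>The squared modulus of \<open>gg m 0\<close> is |w|^(2m), so this entry is a radial
  integral of the symbol; the weight is normalised to match \<open>act_lagpoly_1\<close>.\<close>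

lemma ip_mult_psi0: "ip (\<lambda>w. \<phi> w * gg m 0 w) (gg m 0) = fact m * radint \<phi> (monom (1 / fact m) m)"
proof -
  have "\<phi> w * gg m 0 w * cnj (gg m 0 w) = fact m * (\<phi> w * rp (monom (1 / fact m) m) w)" for w
  proof -
    have "gg m 0 w * cnj (gg m 0 w) = of_real ((cmod w)\<^sup>2) ^ m"
      unfolding gg_0 complex_norm_square by (simp add: psi_def power_mult_distrib)
    then show ?thesis by (simp add: rp_def poly_monom)
  qed
  then show ?thesis unfolding ip_def radint_def by (simp only: integral_mult_right_zero)
qed

lemma nkernel_gg: "nkernel (Suc m) z = (\<lambda>w. (-1) ^ m * weyl z (gg m m) w)"
  unfolding nkernel_weyl lag_gg[abs_def] by (simp add: weyl_def fun_eq_iff)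

lemma toeplitz_form:
  assumes m: "\<phi> \<in> borel_measurable borel" and bd: "\<And>z. cmod (\<phi> z) \<le> C"
  shows "fock_form k (\<lambda>u v. ip (\<lambda>z. \<phi> z * u z) v) C"
proof
  have L: "(\<lambda>z. \<phi> z * u z) \<in> L2" if "u \<in> true_fock (Suc k)" for u
    using true_fock_L2[OF that] m by (rule L2_mult_bounded) (use bd in auto)
  show C: "C \<ge> 0" using bd[of 0] norm_ge_zero order_trans by blast
  fix u v w :: "complex \<Rightarrow> complex" and c
  assume u: "u \<in> true_fock (Suc k)" and w: "w \<in> true_fock (Suc k)"
  show "ip (\<lambda>z. \<phi> z * (c * u z)) w = c * ip (\<lambda>z. \<phi> z * u z) w"
    using ip_scale_left[of c "\<lambda>z. \<phi> z * u z" w] by (simp add: mult.left_commute)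
  show "ip (\<lambda>z. \<phi> z * w z) (\<lambda>z. c * u z) = cnj c * ip (\<lambda>z. \<phi> z * w z) u" by (rule ip_scale_right)
  show "cmod (ip (\<lambda>z. \<phi> z * u z) w) \<le> C * (nrm u * nrm w)"
  proof -
    have "nrm (\<lambda>z. \<phi> z * u z) \<le> nrm (\<lambda>z. of_real C * u z)"
      using bd C by (intro nrm_mono L[OF u] L2_scale true_fock_L2[OF u]) (simp add: norm_mult mult_right_mono)
    also have "\<dots> = C * nrm u" using C by (simp add: nrm_scale)
    finally have "nrm (\<lambda>z. \<phi> z * u z) * nrm w \<le> (C * nrm u) * nrm w" by (intro mult_right_mono) auto
    then show ?thesis using ip_bound[OF L[OF u] true_fock_L2[OF w]] by simp
  qed
  assume v: "v \<in> true_fock (Suc k)"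
  show "ip (\<lambda>z. \<phi> z * (u z + v z)) w = ip (\<lambda>z. \<phi> z * u z) w + ip (\<lambda>z. \<phi> z * v z) w"
    unfolding distrib_left by (intro ip_add_left L u v true_fock_L2[OF w])
  show "ip (\<lambda>z. \<phi> z * w z) (\<lambda>z. u z + v z) = ip (\<lambda>z. \<phi> z * w z) u + ip (\<lambda>z. \<phi> z * w z) v"
    by (intro ip_add_right L w true_fock_L2[OF u] true_fock_L2[OF v])
qed

text \<open>By \<open>twisted_mean\<close> each off-diagonal is the coefficient sequence of a
  vanishing power series. As \<open>n\<close> is a natural number, this reaches the diagonal and one
  side of it.\<close>

lemma (in fock_form) matrix_zero:
  assumes "\<And>c. B (psi m c) (psi m c) = 0"
  shows "B (gg m j) (gg m (j + n)) = 0"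
proof -
  define a where "a j = (B (gg m j) (gg m (j + n)))" for j
  have s: "(\<lambda>j. of_real r ^ (2 * j + n) * a j) sums 0" if "r \<ge> 0" for r
    using twisted_mean[OF that, of n] assms by (simp add: a_def)
  have s': "(\<lambda>j. a j * of_real (r\<^sup>2) ^ j) sums 0" if "r > 0" for r
  proof -
    have "(\<lambda>j. (1 / of_real r ^ n) * (of_real r ^ (2 * j + n) * a j)) sums ((1 / of_real r ^ n) * 0)"
      using that by (intro sums_mult s) simp
    then show ?thesis using that by (simp add: power_add power_mult[symmetric] mult.commute)
  qed
  have "a j = 0"
  proof (rule power_series_zero_pos)
    fix R :: real assume R: "R \<ge> 0"
    have "summable (\<lambda>n. a n * (of_real (R + 1)) ^ n)" using sums_summable[OF s'[of "sqrt (R + 1)"]] R by simp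
    then have "summable (\<lambda>n. norm (a n * (of_real R) ^ n))" by (rule powser_insidea) (use R in simp)
    then show "summable (\<lambda>n. norm (a n) * R ^ n)" using R by (simp add: norm_mult norm_power)
  next
    fix s :: real assume "s > 0"
    then show "(\<Sum>n. a n * of_real s ^ n) = 0" using sums_unique[OF s'[of "sqrt s"]] by simp
  qed
  then show ?thesis by (simp add: a_def)
qed

lemma (in fock_form) form_nkernel: "B (nkernel (Suc m) z) (nkernel (Suc m) z) = symb m z"
proof -
  have W: "weyl z (gg m m) \<in> true_fock (Suc m)" by (intro weyl_true_fock gg_true_fock)
  have "(-1) ^ m * ((-1) ^ m * x) = (x :: complex)" for x
    by (simp add: mult.assoc[symmetric] power_mult_distrib[symmetric])
  then show ?thesis unfolding nkernel_gg
    by (simp add: scale_left[OF W true_fock_scale[OF W]] scale_right[OF W W] symb_def)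
qed

lemma form_diff:
  assumes "fock_form m B C" and "fock_form m B' C'"
  shows "fock_form m (\<lambda>u v. B u v - B' u v) (C + C')"
proof -
  interpret F: fock_form m B C by fact
  interpret G: fock_form m B' C' by fact
  show ?thesis
  proof
    fix u v w :: "complex \<Rightarrow> complex" and c
    assume u: "u \<in> true_fock (Suc m)" and w: "w \<in> true_fock (Suc m)"
    show "B (\<lambda>z. c * u z) w - B' (\<lambda>z. c * u z) w = c * (B u w - B' u w)"
      by (simp add: F.scale_left G.scale_left u w right_diff_distrib)
    show "B w (\<lambda>z. c * u z) - B' w (\<lambda>z. c * u z) = cnj c * (B w u - B' w u)"
      by (simp add: F.scale_right G.scale_right u w right_diff_distrib)
    show "cmod (B u w - B' u w) \<le> (C + C') * (nrm u * nrm w)"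
      using norm_triangle_ineq4[of "B u w" "B' u w"] F.bound[OF u w] G.bound[OF u w] by (simp add: distrib_right)
    assume v: "v \<in> true_fock (Suc m)"
    show "B (\<lambda>z. u z + v z) w - B' (\<lambda>z. u z + v z) w = B u w - B' u w + (B v w - B' v w)"
      by (simp add: F.add_left G.add_left u v w)
    show "B w (\<lambda>z. u z + v z) - B' w (\<lambda>z. u z + v z) = B w u - B' w u + (B w v - B' w v)"
      by (simp add: F.add_right G.add_right u v w)
  qed (use F.C_nonneg G.C_nonneg in simp)
qed

lemma operator_form:
  assumes A: "A \<in> bounded_ops (true_fock (Suc m))"
  shows "\<exists>C. fock_form m (\<lambda>u v. ip (A u) v) C"
proof -
  obtain C where C: "\<And>f. f \<in> true_fock (Suc m) \<Longrightarrow> nrm (A f) \<le> C * nrm f"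
    using A unfolding bounded_ops_def by blast
  have H: "A u \<in> true_fock (Suc m)" if "u \<in> true_fock (Suc m)" for u
    using A that by (auto simp: bounded_ops_def)
  have L: "A u \<in> L2" if "u \<in> true_fock (Suc m)" for u by (rule true_fock_L2[OF H[OF that]])
  have "fock_form m (\<lambda>u v. ip (A u) v) (max C 0)"
  proof
    fix u v w :: "complex \<Rightarrow> complex" and c
    assume u: "u \<in> true_fock (Suc m)" and w: "w \<in> true_fock (Suc m)"
    have "A (\<lambda>z. c * u z) = (\<lambda>z. c * A u z)" using A u by (auto simp: bounded_ops_def)
    then show "ip (A (\<lambda>z. c * u z)) w = c * ip (A u) w" by (simp add: ip_scale_left)
    show "ip (A w) (\<lambda>z. c * u z) = cnj c * ip (A w) u" by (rule ip_scale_right)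
    have "nrm (A u) \<le> max C 0 * nrm u"
      using C[OF u] mult_right_mono[of C "max C 0" "nrm u"] by simp
    then have "nrm (A u) * nrm w \<le> max C 0 * nrm u * nrm w" by (intro mult_right_mono) auto
    then show "cmod (ip (A u) w) \<le> max C 0 * (nrm u * nrm w)"
      using ip_bound[OF L[OF u] true_fock_L2[OF w]] by (simp add: mult.assoc)
    assume v: "v \<in> true_fock (Suc m)"
    have "A (\<lambda>z. u z + v z) = (\<lambda>z. A u z + A v z)" using A u v by (auto simp: bounded_ops_def)
    then show "ip (A (\<lambda>z. u z + v z)) w = ip (A u) w + ip (A v) w"
      by (simp add: ip_add_left L u v true_fock_L2[OF w])
    show "ip (A w) (\<lambda>z. u z + v z) = ip (A w) u + ip (A w) v"
      by (intro ip_add_right L w true_fock_L2[OF u] true_fock_L2[OF v])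
  qed simp
  then show ?thesis ..
qed

lemma ip_cnj_mult: "ip (\<lambda>z. cnj (\<phi> z) * u z) v = cnj (ip (\<lambda>z. \<phi> z * v z) u)"
  unfolding ip_def Bochner_Integration.integral_cnj[symmetric] by (simp add: mult_ac)

text \<open>For the Toeplitz form \<open>symb 0\<close> averages \<open>\<phi>\<close> against
  L_m(-\<Delta>/4) of the Gaussian, so \<open>symb m\<close>, its Berezin transform, carries the
  factor twice. Cancelling one copy makes the form vanish at every pair of equal
  \<open>psi m c\<close>, hence on all pairs of \<open>gg m j\<close>, which are total.\<close>

lemma toeplitz_form_zero:
  assumes m[measurable]: "\<phi> \<in> borel_measurable borel" and bd: "\<And>z. cmod (\<phi> z) \<le> C"
    and z: "\<And>c. ip (\<lambda>w. \<phi> w * nkernel (Suc m) c w) (nkernel (Suc m) c) = 0"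
    and u: "u \<in> true_fock (Suc m)" and v: "v \<in> true_fock (Suc m)"
  shows "ip (\<lambda>w. \<phi> w * u w) v = 0"
proof -
  interpret F: fock_form m "\<lambda>u v. ip (\<lambda>z. \<phi> z * u z) v" C by (rule toeplitz_form[OF m bd])
  have cb: "cmod (cnj (\<phi> z)) \<le> C" for z using bd by simp
  have cm[measurable]: "(\<lambda>z. cnj (\<phi> z)) \<in> borel_measurable borel" by measurable
  \<comment> \<open>The conjugate symbol gives the adjoint form, whose \<open>matrix_zero\<close>
    covers the other side of the diagonal.\<close>
  interpret G: fock_form m "\<lambda>u v. ip (\<lambda>z. cnj (\<phi> z) * u z) v" C by (rule toeplitz_form[OF cm cb])
  define P where "P = monom (1 / fact m :: complex) m"
  have P: "P = act (lagpoly m) 1" by (simp add: P_def act_lagpoly_1)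
  have u0: "F.symb 0 c = radint (\<lambda>w. \<phi> (w + c)) P" for c
  proof -
    have "F.symb 0 c = 1 / fact m * ip (\<lambda>w. \<phi> (w + c) * gg m 0 w) (gg m 0)"
      unfolding F.symb_def by (subst ip_mult_weyl) (auto intro: egrow_measurable egrow_gg)
    then show ?thesis unfolding ip_mult_psi0 P_def by simp
  qed
  have L: "radint (\<lambda>w. \<phi> (w + a)) (act (lagpoly m) P) = 0" for a
  proof -
    have m': "(\<lambda>w. \<phi> (w + a)) \<in> borel_measurable borel" by measurable
    have b': "cmod (\<phi> (w + a)) \<le> C" for w by (rule bd)
    have "F.symb m a = (\<Sum>n\<le>m. fact m / fact (m - n) * (radint (\<lambda>w. \<phi> (w + a)) ((lap ^^ n) P) / (fact n)\<^sup>2))"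
    proof (rule F.symb_mean_transfer)
      fix r :: real
      show "(\<lambda>n. radint (\<lambda>w. \<phi> (w + a)) ((lap ^^ n) P) / (fact n)\<^sup>2 * of_real (r\<^sup>2) ^ n) sums
          (\<integral>t. F.symb 0 (a + of_real r * ucis t) \<partial>circ)"
        using circle_mean_radint[OF m' b', of P r] unfolding u0 by (simp add: add_ac)
    qed
    also have "\<dots> = radint (\<lambda>w. \<phi> (w + a)) (act (lagpoly m) P)" by (rule radint_act_lagpoly[OF m' b', symmetric])
    finally show ?thesis using z[of a] F.form_nkernel[of a] by simp
  qed
  have "radint (\<lambda>w. \<phi> (w + a)) P = 0" for a
    unfolding P
  proof (rule radint_lagpoly_cancel)
    show "radint (\<lambda>w. \<phi> (w + b + a)) (act (lagpoly m) (act (lagpoly m) 1)) = 0" for b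
      using L[of "b + a"] by (simp add: P add_ac)
    show "cmod (\<phi> (w + a)) \<le> C" for w by (rule bd)
  qed measurable
  then have Z: "ip (\<lambda>w. \<phi> w * psi m c w) (psi m c) = 0" for c
    unfolding F.form_psi u0 by simp
  then have Zc: "ip (\<lambda>w. cnj (\<phi> w) * psi m c w) (psi m c) = 0" for c
    unfolding ip_cnj_mult by simp
  have gz: "ip (\<lambda>w. \<phi> w * gg m j w) (gg m i) = 0" for i j
  proof (cases "j \<le> i")
    case True
    then show ?thesis using F.matrix_zero[OF Z, of j "i - j"] by simp
  next
    case False
    then have "ip (\<lambda>w. cnj (\<phi> w) * gg m i w) (gg m j) = 0" using G.matrix_zero[OF Zc, of i "j - i"] by simp
    then show ?thesis unfolding ip_cnj_mult by simp
  qed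
  have L2': "(\<lambda>w. \<phi> w * f w) \<in> L2" "(\<lambda>w. cnj (\<phi> w) * f w) \<in> L2" if "f \<in> true_fock (Suc m)" for f
    by (rule L2_mult_bounded[OF true_fock_L2[OF that], of _ C]; use bd in simp)+
  \<comment> \<open>Totality is used once in each argument; conjugating the symbol exchanges the
    arguments.\<close>
  have "ip (\<lambda>w. cnj (\<phi> w) * v w) u = 0"
  proof (rule true_fock_ortho[OF L2'(2)[OF v] _ u])
    show "ip (\<lambda>w. cnj (\<phi> w) * v w) (gg m j) = 0" for j
      unfolding ip_cnj_mult using true_fock_ortho[OF L2'(1)[OF gg_true_fock] gz v] by simp
  qed
  then show ?thesis unfolding ip_cnj_mult by simp
qed

text \<open>The hypothesis says that \<open>symb m\<close>, with one factor on the Gaussian,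
  averages to zero around every point. As \<open>symb m\<close> is weakly L_m(-\<Delta>/4) of
  \<open>symb 0\<close>, this puts two factors on \<open>symb 0\<close>. Cancelling one leaves
  vanishing Gaussian averages of \<open>symb m\<close>, to which \<open>gauss_injective\<close>
  applies.\<close>

lemma (in fock_form) symb_zero:
  assumes z: "\<And>c. ip (\<lambda>w. symb m w * psi m c w) (psi m c) = 0"
  shows "symb m a = 0"
proof -
  have conv: "radint (\<lambda>w. symb m (w + c)) P = radint (\<lambda>w. symb 0 (w + c)) (act (lagpoly m) P)" for c P
  proof -
    interpret T: fock_form m "\<lambda>u v. B (weyl c u) (weyl c v)" C by (rule translate)
    have "T.symb j = (\<lambda>w. symb j (w + c))" for j unfolding translate_symb[of c j, abs_def] by (simp add: translate_symb add.commute fun_eq_iff)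
    then show ?thesis using T.radint_symb[of P] by simp
  qed
  have "radint (\<lambda>w. symb m (w + c)) (act (lagpoly m) 1) = 0" for c
  proof -
    define K where "K = complex_of_real (exp ((cmod c)\<^sup>2 / 2))"
    have p: "psi m c = (\<lambda>w. K * weyl c (gg m 0) w)" unfolding K_def by (rule psi_weyl)
    have "0 = ip (\<lambda>w. K * (symb m w * weyl c (gg m 0) w)) (\<lambda>w. K * weyl c (gg m 0) w)"
      using z[of c] unfolding p by (simp add: mult.left_commute)
    also have "\<dots> = K * (cnj K * ip (\<lambda>w. symb m w * weyl c (gg m 0) w) (weyl c (gg m 0)))"
      by (simp only: ip_scale_left ip_scale_right)
    also have "ip (\<lambda>w. symb m w * weyl c (gg m 0) w) (weyl c (gg m 0)) = ip (\<lambda>w. symb m (w + c) * gg m 0 w) (gg m 0)"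
      by (rule ip_mult_weyl) (auto intro: egrow_measurable egrow_gg)
    finally show ?thesis unfolding ip_mult_psi0 act_lagpoly_1 by (simp add: K_def)
  qed
  then have cc: "radint (\<lambda>w. symb 0 (w + c)) (act (lagpoly m) (act (lagpoly m) 1)) = 0" for c by (simp add: conv)
  have "radint (\<lambda>w. symb 0 (w + c)) (act (lagpoly m) 1) = 0" for c
  proof (rule radint_lagpoly_cancel)
    show "radint (\<lambda>w. symb 0 (w + b + c)) (act (lagpoly m) (act (lagpoly m) 1)) = 0" for b using cc[of "b + c"] by (simp add: add_ac)
    show "cmod (symb 0 (w + c)) \<le> fact 0 / fact m * (C * (nrm (gg m 0) * nrm (gg m 0)))" for w by (rule symb_bound)
  qed measurable
  then have II1: "radint (\<lambda>w. symb m (w + c)) 1 = 0" for c by (simp add: conv)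
  have "symb m (0 + a) = 0"
  proof (rule gauss_injective[where \<phi> = "\<lambda>w. symb m (w + a)"])
    show "continuous_on UNIV (\<lambda>w. symb m (w + a))"
      by (rule continuous_on_compose2[OF symb_continuous]) (auto intro: continuous_intros)
    show "cmod (symb m (w + a)) \<le> fact m / fact m * (C * (nrm (gg m m) * nrm (gg m m)))" for w by (rule symb_bound)
    show "radint (\<lambda>w. symb m (w + b + a)) 1 = 0" for b using II1[of "b + a"] by (simp add: add_ac)
  qed
  then show ?thesis by simp
qed

lemma toeplitz_eq_fockproj:
  assumes "f \<in> Linf" and "u \<in> true_fock (Suc m)"
  shows "(\<lambda>z. f z * u z) \<in> L2" and "toeplitz (Suc m) f u = fockproj m (\<lambda>z. f z * u z)"
proof -
  obtain C where "AE z in lborel. cmod (f z) \<le> C" using assms(1) by (auto simp: Linf_def)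
  then show L: "(\<lambda>z. f z * u z) \<in> L2"
    using assms by (intro L2_mult_bounded true_fock_L2[OF assms(2)]) (auto simp: Linf_def)
  show "toeplitz (Suc m) f u = fockproj m (\<lambda>z. f z * u z)"
    using assms(2) by (simp add: toeplitz_def proj_eq[OF L])
qed

lemma ip_toeplitz:
  assumes f: "f \<in> Linf" and u: "u \<in> true_fock (Suc m)" and v: "v \<in> true_fock (Suc m)"
  shows "ip (toeplitz (Suc m) f u) v = ip (\<lambda>z. f z * u z) v"
  unfolding toeplitz_eq_fockproj(2)[OF f u] by (rule fockproj_ip[OF toeplitz_eq_fockproj(1)[OF f u] v])

lemma berezin_injective_on_toeplitz: "inj_on (berezin (Suc m)) {toeplitz (Suc m) f | f. f \<in> Linf}"
proof (rule inj_onI, clarsimp)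
  fix f g
  assume f: "f \<in> Linf" and g: "g \<in> Linf" and eq: "berezin (Suc m) (toeplitz (Suc m) f) = berezin (Suc m) (toeplitz (Suc m) g)"
  have [measurable]: "f \<in> borel_measurable borel" "g \<in> borel_measurable borel" using f g by (auto simp: Linf_def)
  obtain C D where "AE z in lborel. cmod (f z) \<le> C" "AE z in lborel. cmod (g z) \<le> D" using f g by (auto simp: Linf_def)
  then have CD: "AE z in lborel. cmod (f z - g z) \<le> C + D"
  proof eventually_elim
    case (elim z)
    then show ?case using norm_triangle_ineq4[of "f z" "g z"] by linarith
  qed
  \<comment> \<open>The difference of the symbols is bounded only almost everywhere, while forms ask
    for a pointwise bound; the cut-off changes it on a null set.\<close>
  define \<phi> where "\<phi> z = (if cmod (f z - g z) \<le> C + D then f z - g z else 0)" for z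
  have [measurable]: "\<phi> \<in> borel_measurable borel" unfolding \<phi>_def[abs_def] by measurable
  have sub: "ip (\<lambda>z. \<phi> z * u z) v = ip (\<lambda>z. f z * u z) v - ip (\<lambda>z. g z * u z) v"
    if u: "u \<in> true_fock (Suc m)" and v: "v \<in> true_fock (Suc m)" for u v
  proof -
    have [measurable]: "u \<in> borel_measurable borel" "v \<in> borel_measurable borel"
      using u v by (auto intro: L2_measurable true_fock_L2)
    have "ip (\<lambda>z. \<phi> z * u z) v = ip (\<lambda>z. f z * u z - g z * u z) v"
      unfolding ip_def
    proof (rule integral_cong_AE)
      show "AE z in gauss. \<phi> z * u z * cnj (v z) = (f z * u z - g z * u z) * cnj (v z)"
        unfolding AE_gauss_iff using CD by eventually_elim (simp add: \<phi>_def left_diff_distrib)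
    qed measurable
    then show ?thesis by (simp add: ip_diff_left toeplitz_eq_fockproj(1)[OF f u] toeplitz_eq_fockproj(1)[OF g u] true_fock_L2[OF v])
  qed
  have zero: "ip (\<lambda>z. \<phi> z * u z) v = 0" if "u \<in> true_fock (Suc m)" "v \<in> true_fock (Suc m)" for u v
  proof (rule toeplitz_form_zero[of \<phi> "max 0 (C + D)", OF _ _ _ that])
    show "cmod (\<phi> z) \<le> max 0 (C + D)" for z by (auto simp: \<phi>_def)
    show "ip (\<lambda>w. \<phi> w * nkernel (Suc m) c w) (nkernel (Suc m) c) = 0" for c
      using fun_cong[OF eq, of c] by (simp add: sub berezin_def ip_toeplitz f g nkernel_true_fock)
  qed measurable
  show "toeplitz (Suc m) f = toeplitz (Suc m) g"
  \<comment> \<open>Both operators are extensional, so they are compared on the true Fock space,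
    where a projection is given by its kernel pairings.\<close>
  proof (rule extensionalityI[of _ "true_fock (Suc m)"])
    fix u assume u: "u \<in> true_fock (Suc m)"
    then have "ip (\<lambda>z. f z * u z) (nkernel (Suc m) c) = ip (\<lambda>z. g z * u z) (nkernel (Suc m) c)" for c
      using sub[OF u nkernel_true_fock, of c] zero[OF u nkernel_true_fock, of c] by simp
    then show "toeplitz (Suc m) f u = toeplitz (Suc m) g u"
      by (simp add: toeplitz_eq_fockproj(2) f g u fockproj_def fun_eq_iff)
  qed (auto simp: toeplitz_def)
qed

lemma toeplitz_injective_on_berezin: "inj_on (toeplitz (Suc m)) {berezin (Suc m) A | A. A \<in> bounded_ops (true_fock (Suc m))}"
proof (rule inj_onI, clarsimp)
  fix A A'
  assume A: "A \<in> bounded_ops (true_fock (Suc m))" and A': "A' \<in> bounded_ops (true_fock (Suc m))"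
    and eq: "toeplitz (Suc m) (berezin (Suc m) A) = toeplitz (Suc m) (berezin (Suc m) A')"
  \<comment> \<open>Berezin transforms must be bounded symbols before the integral formula
    \<open>ip_toeplitz\<close> applies to them.\<close>
  have linf: "berezin (Suc m) X \<in> Linf" if X: "X \<in> bounded_ops (true_fock (Suc m))" for X
  proof -
    obtain C where "fock_form m (\<lambda>u v. ip (X u) v) C" using operator_form[OF X] by blast
    then interpret F: fock_form m "\<lambda>u v. ip (X u) v" C .
    have "berezin (Suc m) X = F.symb m" by (simp add: berezin_def F.form_nkernel fun_eq_iff)
    moreover have "\<exists>C. AE z in lborel. cmod (F.symb m z) \<le> C" using F.symb_bound by blast
    ultimately show ?thesis using F.symb_measurable[of m] by (simp add: Linf_def)
  qed
  obtain C C' where "fock_form m (\<lambda>u v. ip (A u) v) C" "fock_form m (\<lambda>u v. ip (A' u) v) C'"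
    using operator_form A A' by blast
  then interpret F: fock_form m "\<lambda>u v. ip (A u) v - ip (A' u) v" "C + C'" by (rule form_diff)
  have symb: "F.symb m w = berezin (Suc m) A w - berezin (Suc m) A' w" for w
    by (simp add: berezin_def flip: F.form_nkernel)
  have "F.symb m w = 0" for w
  proof (rule F.symb_zero)
    fix c
    have p: "psi m c \<in> true_fock (Suc m)" by (rule psi_true_fock)
    have "ip (\<lambda>z. berezin (Suc m) A z * psi m c z) (psi m c) = ip (\<lambda>z. berezin (Suc m) A' z * psi m c z) (psi m c)"
      using ip_toeplitz[OF linf[OF A] p p] ip_toeplitz[OF linf[OF A'] p p] eq by simp
    then show "ip (\<lambda>w. F.symb m w * psi m c w) (psi m c) = 0"
      unfolding symb left_diff_distrib
      by (simp add: ip_diff_left toeplitz_eq_fockproj(1)[OF linf[OF A] p] toeplitz_eq_fockproj(1)[OF linf[OF A'] p] true_fock_L2[OF p])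
  qed
  then show "berezin (Suc m) A = berezin (Suc m) A'" unfolding symb by (simp add: fun_eq_iff)
qed

theorem theorem3p9:
  fixes k :: nat
  assumes "k \<ge> 1"
  shows "inj_on (berezin k) {toeplitz k f | f. f \<in> Linf} \<and>
         inj_on (toeplitz k) {berezin k A | A. A \<in> bounded_ops (true_fock k)}"
  using berezin_injective_on_toeplitz[of "k - 1"] toeplitz_injective_on_berezin[of "k - 1"] assms by simp

end
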